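(* Fix $N\ge 1$, $\Lambda\ge 1$, $\beta\in(0,1]$ and $\alpha=1-\beta$. There exist constants $\varepsilon_0>0$, $C>0$ and $\gamma>0$, depending only on $N,\Lambda,\alpha,\beta$ (in particular independent of $\varepsilon$, $R$, $u$, $f$ and $\nu$), such that the following holds. Let $R>0$ and $0<\varepsilon<\varepsilon_0R$, let $\nu$ be an admissible family of measures, let $f$ be a bounded Borel measurable real function on $B_{2R}$, and let $u:\mathbb{R}^N\to\mathbb{R}$ be a bounded Borel measurable function satisfying $$u(x)=\alpha\int_{\mathbb{R}^N}u(x+\varepsilon z)\,d\nu_x(z)+\frac{\beta}{|B_\varepsilon|}\int_{B_\varepsilon(x)}u(y)\,dy+\varepsilon^2f(x)\qquad\text{for every }x\in B_{2R}.$$ Then for every $x,z\in B_R$, $$|u(x)-u(z)|\le\frac{C}{R^\gamma}\Big(\sup_{B_{2R}}|u|+R^2\|f\|_\infty\Big)\big(|x-z|^\gamma+\varepsilon^\gamma\big).$$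
   Context: $B_r(x)=\{y\in\mathbb{R}^N:|x-y|<r\}$, $B_r=B_r(0)$, $|E|$ is Lebesgue measure, and $\|f\|_\infty$ is the supremum of $|f|$. Let $\mathcal{M}(B_\Lambda)$ be the set of Radon probability measures on $\mathbb{R}^N$ with support in $B_\Lambda$ that are symmetric, i.e. $\nu(E)=\nu(-E)$ for every measurable $E$. An admissible family of measures is a map $\nu:\mathbb{R}^N\to\mathcal{M}(B_\Lambda)$, $x\mapsto\nu_x$, such that $x\mapsto\int u(x+z)\,d\nu_x(z)$ is Borel measurable for every Borel measurable $u:\mathbb{R}^N\to\mathbb{R}$ (for which these integrals are defined). No further regularity of $x\mapsto\nu_x$ is assumed. *)

theory Defs
  imports "HOL-Probability.Probability"
begin

definition radon_measure :: "'a::topological_space measure \<Rightarrow> bool" where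
  "radon_measure M \<longleftrightarrow>
     sets M = sets borel \<and>
     (\<forall>K. compact K \<longrightarrow> emeasure M K < \<infinity>) \<and>
     (\<forall>E\<in>sets M. emeasure M E = (INF U\<in>{U. open U \<and> E \<subseteq> U}. emeasure M U)) \<and>
     (\<forall>E\<in>sets M. emeasure M E = (SUP K\<in>{K. compact K \<and> K \<subseteq> E}. emeasure M K))"

definition measure_support :: "'a::topological_space measure \<Rightarrow> 'a set" where
  "measure_support M = {x. \<forall>U. open U \<and> x \<in> U \<longrightarrow> emeasure M U > 0}"

(* The set M(B_Lambda).  The ball is open, as everywhere in this theory, so the
   (closed) support must be contained in the open ball. *)
definition symmetric_measures_on_ball :: "real \<Rightarrow> (real ^ 'n) measure set" where
  "symmetric_measures_on_ball \<Lambda> =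
     {M. radon_measure M \<and> prob_space M \<and> measure_support M \<subseteq> ball 0 \<Lambda> \<and>
         (\<forall>E\<in>sets M. emeasure M E = emeasure M (uminus ` E))}"

(* The integrability premise is needed because the Bochner integral of a
   non-integrable function is 0 by convention. *)
definition admissible_family :: "real \<Rightarrow> (real ^ 'n \<Rightarrow> (real ^ 'n) measure) \<Rightarrow> bool" where
  "admissible_family \<Lambda> \<nu> \<longleftrightarrow>
     (\<forall>x. \<nu> x \<in> symmetric_measures_on_ball \<Lambda>) \<and>
     (\<forall>u :: real ^ 'n \<Rightarrow> real. u \<in> borel_measurable borel \<longrightarrow>
        (\<forall>x. integrable (\<nu> x) (\<lambda>z. u (x + z))) \<longrightarrow>
        (\<lambda>x. LINT z|\<nu> x. u (x + z)) \<in> borel_measurable borel)"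

end

(*
  The theorem is a discrete Krylov-Safonov estimate. Symmetry of the measures lets the integral
  against nu_x be bounded below by the infimum of the symmetric averages
  (u(x + e h) + u(x - e h)) / 2 over |h| < Lambda, so that the measures disappear and only the
  extremal inequality "supersol" is used.

  Sliding paraboloids replace the convex envelope of the Aleksandrov-Bakelman-Pucci estimate:
  where a paraboloid touches u from below, the average over the e-ball forces u to be e^2-close
  to the paraboloid on most of that ball, and two paraboloids that touch within distance e have
  vertices within distance O(e). Since the vertices fill a ball, many disjoint e-balls must carry
  touching points, and u is small on a set of positive measure. A Gaussian barrier then spreads
  lower bounds from a ball to a larger one, at scale e plain averaging does the same, and a
  dyadic stopping argument that is cut off at scale e gives a lower bound from a density of
  one half. This is an oscillation decay at all scales above e.
*)
theory Submission
  imports Defs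
begin

section \<open>Averages over balls\<close>

text \<open>The function is merely Borel, so infima need not be attained and there is no gradient or
  contact set to work with. Touching arguments therefore use near-minimizers, and the slack is
  fitted to what the inequality tolerates: \<open>e^2\<close> in the measure estimate, less than the
  strict margin in the barrier comparison.

  Only the uniform part of the equation sees every direction. The extremal part may pick a
  displacement along which the comparison function does not curve upward, so all gains come from
  averaging and constants degenerate as \<beta> tends to 0.

  The inequality at a point sees values at distance up to \<open>\<Lambda> * e\<close>, so the
  homogeneous estimates ask for nonnegativity on the whole space. For the actual solution this is
  restored by adding a concave quadratic, which also absorbs the right-hand side, and truncating
  outside a slightly larger ball.

  The estimates on larger cubes hold for \<open>e \<le> e0 * l\<close> only. Below that side length
  plain averaging replaces them, and the same threshold ends the oscillation decay, leaving the term
  \<open>e powr \<gamma>\<close>.\<close>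

abbreviation uball :: "'a::euclidean_space measure" where
  "uball \<equiv> uniform_measure lborel (ball 0 1)"

text \<open>Pulled back to the unit ball, the average turns a rescaling of \<open>u\<close> into a
  substitution, and a negative \<open>e\<close> becomes a reflection.\<close>

definition ball_avg :: "('a::euclidean_space \<Rightarrow> real) \<Rightarrow> 'a \<Rightarrow> real \<Rightarrow> real" where
  "ball_avg u x e = (LINT h|uball. u (x + e *\<^sub>R h))"

text \<open>Boundedness is local because quadratics have to be averaged along with
  \<open>u\<close>.\<close>

definition loc_bdd :: "('a::euclidean_space \<Rightarrow> real) \<Rightarrow> bool" where
  "loc_bdd u \<longleftrightarrow> u \<in> borel_measurable borel \<and> (\<forall>r. bounded (u ` ball 0 r))"

lemma loc_bdd_measurable: "loc_bdd u \<Longrightarrow> u \<in> borel_measurable borel"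
  by (simp add: loc_bdd_def)

lemma loc_bddE:
  assumes "loc_bdd u" obtains B where "B > 0" "\<And>x. norm x < r \<Longrightarrow> \<bar>u x\<bar> \<le> B"
proof -
  from assms have "bounded (u ` ball 0 r)" by (simp add: loc_bdd_def)
  then obtain B where "B > 0" "\<forall>y\<in>u ` ball 0 r. norm y \<le> B" by (auto simp: bounded_pos)
  then show ?thesis using that[of B] by (auto simp: dist_norm)
qed

lemma loc_bddI:
  assumes "u \<in> borel_measurable borel" "\<And>r. \<exists>B. \<forall>x. norm x < r \<longrightarrow> \<bar>u x\<bar> \<le> B"
  shows "loc_bdd u"
  unfolding loc_bdd_def
proof (intro conjI allI)
  fix r show "bounded (u ` ball 0 r)"
    using assms(2)[of r] by (force simp: bounded_iff dist_norm)
qed fact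

lemma loc_bdd_continuous: "continuous_on UNIV u \<Longrightarrow> loc_bdd u"
  unfolding loc_bdd_def
proof (intro conjI allI)
  fix r :: real assume c: "continuous_on UNIV u"
  have "compact (u ` cball 0 r)" by (intro compact_continuous_image continuous_on_subset[OF c]) auto
  then show "bounded (u ` ball 0 r)"
    by (rule bounded_subset[OF compact_imp_bounded]) auto
qed (rule borel_measurable_continuous_onI)

lemma loc_bdd_add: assumes "loc_bdd u" "loc_bdd v" shows "loc_bdd (\<lambda>x. u x + v x)"
proof (rule loc_bddI)
  show "(\<lambda>x. u x + v x) \<in> borel_measurable borel" using assms by (auto simp: loc_bdd_def)
  fix r obtain B C where "\<And>x. norm x < r \<Longrightarrow> \<bar>u x\<bar> \<le> B" "\<And>x. norm x < r \<Longrightarrow> \<bar>v x\<bar> \<le> C"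
    by (metis assms loc_bddE)
  then show "\<exists>B. \<forall>x. norm x < r \<longrightarrow> \<bar>u x + v x\<bar> \<le> B"
    by (intro exI[of _ "B+C"]) (smt (verit))
qed

lemma loc_bdd_cmult: assumes "loc_bdd u" shows "loc_bdd (\<lambda>x. c * u x)"
proof (rule loc_bddI)
  show "(\<lambda>x. c * u x) \<in> borel_measurable borel" using assms by (auto simp: loc_bdd_def)
  fix r obtain B where "\<And>x. norm x < r \<Longrightarrow> \<bar>u x\<bar> \<le> B"
    by (metis assms loc_bddE)
  then show "\<exists>B. \<forall>x. norm x < r \<longrightarrow> \<bar>c * u x\<bar> \<le> B"
    by (intro exI[of _ "\<bar>c\<bar>*B"]) (auto simp: abs_mult mult_left_mono)
qed

lemma loc_bdd_affine: assumes "loc_bdd u" shows "loc_bdd (\<lambda>y. u (x + s *\<^sub>R y))"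
proof (rule loc_bddI)
  show "(\<lambda>y. u (x + s *\<^sub>R y)) \<in> borel_measurable borel" using loc_bdd_measurable[OF assms] by measurable
  fix r obtain B where B: "\<And>y. norm y < norm x + \<bar>s\<bar> * \<bar>r\<bar> + 1 \<Longrightarrow> \<bar>u y\<bar> \<le> B"
    by (metis assms loc_bddE)
  have "\<bar>u (x + s *\<^sub>R y)\<bar> \<le> B" if "norm y < r" for y
  proof (rule B)
    have "norm (x + s *\<^sub>R y) \<le> norm x + \<bar>s\<bar> * norm y" by (metis norm_scaleR norm_triangle_ineq)
    also have "\<dots> \<le> norm x + \<bar>s\<bar> * \<bar>r\<bar>" using that by (intro add_left_mono mult_left_mono) auto
    finally show "norm (x + s *\<^sub>R y) < norm x + \<bar>s\<bar> * \<bar>r\<bar> + 1" by simp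
  qed
  then show "\<exists>B. \<forall>y. norm y < r \<longrightarrow> \<bar>u (x + s *\<^sub>R y)\<bar> \<le> B" by blast
qed

lemma loc_bdd_truncate:
  assumes "loc_bdd u" "D \<in> sets borel" shows "loc_bdd (\<lambda>y. if y \<in> D then u y else 0)"
proof (rule loc_bddI)
  show "(\<lambda>y. if y \<in> D then u y else 0) \<in> borel_measurable borel"
    using loc_bdd_measurable[OF assms(1)] assms(2) by measurable
  fix r obtain B where "B > 0" "\<And>x. norm x < r \<Longrightarrow> \<bar>u x\<bar> \<le> B"
    by (metis assms(1) loc_bddE)
  then show "\<exists>B. \<forall>x. norm x < r \<longrightarrow> \<bar>if x \<in> D then u x else 0\<bar> \<le> B"
    by (intro exI[of _ B]) auto
qed

section \<open>The uniform probability measure on a ball and its rescalings\<close>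

lemma unit_ball_vol_neq_0 [simp]: "unit_ball_vol (real n) \<noteq> 0"
  using unit_ball_vol_pos[of "real n"] by linarith

lemma emeasure_unit_ball: "emeasure lborel (ball (0::'a::euclidean_space) 1) \<noteq> 0"
  "emeasure lborel (ball (0::'a::euclidean_space) 1) \<noteq> \<infinity>"
  by (simp_all add: emeasure_ball)

lemma prob_space_uball: "prob_space (uball :: 'a::euclidean_space measure)"
  using emeasure_unit_ball by (rule prob_space_uniform_measure)

lemma AE_uball: "AE h in (uball :: 'a::euclidean_space measure). norm h < 1"
  by (rule AE_uniform_measureI) (auto simp: dist_norm)

lemma integrable_uball:
  fixes g :: "'a::euclidean_space \<Rightarrow> real"
  assumes "g \<in> borel_measurable borel" "\<And>h. norm h < 1 \<Longrightarrow> \<bar>g h\<bar> \<le> B"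
  shows "integrable uball g"
proof -
  interpret prob_space "uball :: 'a measure" by (rule prob_space_uball)
  show ?thesis
    by (rule integrable_const_bound[where B=B]) (use AE_uball assms in \<open>auto elim: eventually_mono\<close>)
qed

lemma loc_bdd_integrable:
  assumes "loc_bdd u" shows "integrable uball (\<lambda>h. u (x + e *\<^sub>R h))"
proof -
  have l: "loc_bdd (\<lambda>h. u (x + e *\<^sub>R h))" by (rule loc_bdd_affine[OF assms])
  then obtain B where "\<And>h. norm h < 1 \<Longrightarrow> \<bar>u (x + e *\<^sub>R h)\<bar> \<le> B" by (metis loc_bddE)
  then show ?thesis using loc_bdd_measurable[OF l] by (rule integrable_uball[rotated])
qed

lemma loc_bdd_integrable':
  assumes "loc_bdd u" shows "integrable uball u"
  using loc_bdd_integrable[OF assms, of 0 1] by simp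

lemma emeasure_lborel_affine:
  fixes A :: "'a::euclidean_space set"
  assumes "e \<noteq> 0" "A \<in> sets borel"
  shows "emeasure lborel A = ennreal (\<bar>e\<bar> ^ DIM('a)) * emeasure lborel ((\<lambda>h. x + e *\<^sub>R h) -` A)"
proof -
  have "emeasure lborel A = emeasure (density (distr lborel borel (\<lambda>h. x + e *\<^sub>R h)) (\<lambda>_. ennreal (\<bar>e\<bar> ^ DIM('a)))) A"
    by (subst lborel_affine[OF assms(1), of x]) simp
  also have "\<dots> = ennreal (\<bar>e\<bar> ^ DIM('a)) * emeasure (distr lborel borel (\<lambda>h. x + e *\<^sub>R h)) A"
    using assms(2) by (subst emeasure_density_const) auto
  also have "emeasure (distr lborel borel (\<lambda>h. x + e *\<^sub>R h)) A = emeasure lborel ((\<lambda>h. x + e *\<^sub>R h) -` A)"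
    using assms(2) by (subst emeasure_distr) auto
  finally show ?thesis .
qed

lemma measure_lborel_affine:
  fixes A :: "'a::euclidean_space set"
  assumes "e \<noteq> 0" "A \<in> sets borel"
  shows "measure lborel A = \<bar>e\<bar> ^ DIM('a) * measure lborel ((\<lambda>h. x + e *\<^sub>R h) -` A)"
  unfolding measure_def by (subst emeasure_lborel_affine[OF assms, of x]) (simp add: enn2real_mult)

lemma affine_vimage_ball:
  fixes x :: "'a::euclidean_space"
  assumes "e \<noteq> 0" shows "(\<lambda>h. x + e *\<^sub>R h) -` ball x (\<bar>e\<bar> * r) = ball 0 r"
  using assms by (auto simp: dist_norm)

lemma distr_uball:
  fixes x :: "'a::euclidean_space"
  assumes "e \<noteq> 0"
  shows "distr uball borel (\<lambda>h. x + e *\<^sub>R h) = uniform_measure lborel (ball x \<bar>e\<bar>)"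
proof (rule measure_eqI)
  fix A assume "A \<in> sets (distr uball borel (\<lambda>h. x + e *\<^sub>R h))"
  then have A[measurable]: "A \<in> sets borel" by simp
  let ?T = "\<lambda>h. x + e *\<^sub>R h" and ?c = "ennreal (\<bar>e\<bar> ^ DIM('a))"
  have c: "?c \<noteq> 0" "?c \<noteq> \<infinity>" using assms by auto
  have "emeasure (distr uball borel ?T) A = emeasure lborel (ball 0 1 \<inter> ?T -` A) / emeasure lborel (ball (0::'a) 1)"
    using A measurable_sets_borel[of ?T borel A] by (subst emeasure_distr) auto
  also have "\<dots> = (?c * emeasure lborel (ball 0 1 \<inter> ?T -` A)) / (?c * emeasure lborel (ball (0::'a) 1))"
    using c emeasure_unit_ball[where 'a='a]
    by (cases "emeasure lborel (ball 0 1 \<inter> ?T -` A)"; cases "emeasure lborel (ball (0::'a) 1)")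
      (auto simp: divide_ennreal ennreal_mult[symmetric] top_unique ennreal_top_divide  ennreal_mult_top)
  also have "?c * emeasure lborel (ball 0 1 \<inter> ?T -` A) = emeasure lborel (ball x \<bar>e\<bar> \<inter> A)"
    using affine_vimage_ball[OF assms, of x 1]
    by (subst emeasure_lborel_affine[OF assms, of "ball x \<bar>e\<bar> \<inter> A" x]) auto
  also have "?c * emeasure lborel (ball (0::'a) 1) = emeasure lborel (ball x \<bar>e\<bar>)"
    using affine_vimage_ball[OF assms, of x 1]
    by (subst emeasure_lborel_affine[OF assms, of "ball x \<bar>e\<bar>" x]) auto
  finally show "emeasure (distr uball borel ?T) A = emeasure (uniform_measure lborel (ball x \<bar>e\<bar>)) A"
    by (simp add: emeasure_uniform_measure)
qed simp

lemma ball_avg_eq_uniform: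
  assumes "e \<noteq> 0" "u \<in> borel_measurable borel"
  shows "ball_avg u x e = (LINT y|uniform_measure lborel (ball x \<bar>e\<bar>). u y)"
  using assms by (simp add: ball_avg_def distr_uball[symmetric] integral_distr)

lemma ball_avg_reflect:
  assumes "u \<in> borel_measurable borel" shows "ball_avg u x (- e) = ball_avg u x e"
  by (cases "e = 0") (simp_all add: ball_avg_eq_uniform assms)

text \<open>The bridge to the normalised integral of the theorem; as there, the volume in the
  denominator is that of the ball centred at the origin.\<close>

lemma ball_avg_eq:
  fixes x :: "'a::euclidean_space"
  assumes "e > 0" and [measurable]: "u \<in> borel_measurable borel"
  shows "ball_avg u x e = (LINT y:ball x e|lborel. u y) / measure lborel (ball (0::'a) e)"
proof -
  have m: "emeasure lborel (ball x e) = ennreal (measure lborel (ball (0::'a) e))" "measure lborel (ball (0::'a) e) > 0"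
    using assms by (simp_all add: emeasure_ball content_ball)
  have d: "uniform_measure lborel (ball x e)
      = density lborel (\<lambda>y. ennreal (indicator (ball x e) y / measure lborel (ball (0::'a) e)))"
    unfolding uniform_measure_def m(1)
  proof (rule arg_cong[where f="density lborel"], rule ext)
    show "indicator (ball x e) y / ennreal (measure lborel (ball (0::'a) e))
        = ennreal (indicator (ball x e) y / measure lborel (ball (0::'a) e))" for y
      using m(2) divide_ennreal[of 1 "measure lborel (ball (0::'a) e)"] by (simp split: split_indicator)
  qed
  show ?thesis
    using assms(1) m(2) unfolding set_lebesgue_integral_def
    by (simp add: ball_avg_eq_uniform d, subst integral_density)
       (auto intro!: borel_measurable_times borel_measurable_indicator
           simp: divide_inverse_commute mult.assoc simp flip: integral_mult_right_zero)
qed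

lemma measure_uball_ball:
  fixes p :: "'a::euclidean_space"
  assumes "0 \<le> d" "ball p d \<subseteq> ball 0 1" shows "measure uball (ball p d) = d ^ DIM('a)"
proof -
  have "ball 0 1 \<inter> ball p d = ball p d" using assms by auto
  then show ?thesis using assms emeasure_unit_ball[where 'a='a]
    by (simp add: measure_uniform_measure content_ball)
qed

text \<open>The averages at \<open>e\<close> and \<open>-e\<close> coincide, so only the even part
  of \<open>u\<close> around \<open>x\<close> counts and first-order terms never have to be
  estimated.\<close>

lemma ball_avg_sym_ge:
  assumes u: "loc_bdd u" and g: "integrable uball g"
    and le: "\<And>h. norm h < 1 \<Longrightarrow> 2 * g h \<le> u (x + e *\<^sub>R h) + u (x - e *\<^sub>R h)"
  shows "(LINT h|uball. g h) \<le> ball_avg u x e"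
proof -
  have "(LINT h|uball. 2 * g h) \<le> (LINT h|uball. u (x + e *\<^sub>R h) + u (x + (-e) *\<^sub>R h))"
    using g loc_bdd_integrable[OF u, of x e] loc_bdd_integrable[OF u, of x "-e"] le
    by (intro integral_mono_AE) (auto intro: eventually_mono[OF AE_uball])
  also have "\<dots> = 2 * ball_avg u x e"
    using loc_bdd_integrable[OF u, of x e] loc_bdd_integrable[OF u, of x "-e"]
      ball_avg_reflect[OF loc_bdd_measurable[OF u], of x e] unfolding ball_avg_def by simp
  finally show ?thesis by simp
qed

lemma ball_avg_mono:
  assumes "loc_bdd u" "loc_bdd v" "e > 0" "\<And>y. y \<in> ball x e \<Longrightarrow> u y \<le> v y"
  shows "ball_avg u x e \<le> ball_avg v x e"
  unfolding ball_avg_def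
  by (intro integral_mono_AE loc_bdd_integrable assms)
    (use assms(3) in \<open>auto intro!: eventually_mono[OF AE_uball] assms(1,2,4) simp: dist_norm\<close>)

lemma ball_avg_ge_measure:
  fixes u :: "'a::euclidean_space \<Rightarrow> real"
  assumes u: "loc_bdd u" "\<And>y. y \<in> ball x e \<Longrightarrow> 0 \<le> u y" and e: "e > 0" and t: "0 \<le> t"
    and E: "E \<in> sets borel" "E \<subseteq> ball x e" "\<And>y. y \<in> E \<Longrightarrow> t \<le> u y"
  shows "t * measure lborel E / measure lborel (ball x e) \<le> ball_avg u x e"
proof -
  have m: "emeasure lborel (ball x e) \<noteq> 0" "emeasure lborel (ball x e) \<noteq> \<infinity>"
    using e by (simp_all add: emeasure_ball)
  interpret prob_space "uniform_measure lborel (ball x e)" by (rule prob_space_uniform_measure[OF m])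
  have EB: "ball x e \<inter> E = E" using E by auto
  have "t * (measure lborel E / measure lborel (ball x e)) = ball_avg (\<lambda>y. t * indicator E y) x e"
    using e E m EB by (simp add: ball_avg_eq_uniform measure_uniform_measure)
  also have "\<dots> \<le> ball_avg u x e"
    by (intro ball_avg_mono u e loc_bddI) 
       (use E t u(2) in \<open>auto simp: indicator_def intro!: exI[of _ t]\<close>)
  finally show ?thesis by simp
qed

text \<open>A crude stand-in for the exact factor 1/(N+2): the power is the mass of a subball of
  radius 1/4, and the final 1/4 is the square of 1/2.\<close>

definition moment_const :: "'a::euclidean_space itself \<Rightarrow> real" where
  "moment_const _ = (1/4) ^ DIM('a) / 4"

text \<open>Around the point of length 3/4 in the direction of \<open>b\<close>, the ball of radius
  1/4 stays in the unit ball, and on it the inner product with \<open>b\<close> is at least half of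
  \<open>norm b\<close>. This is how averaging detects curvature in an arbitrary direction.\<close>

lemma second_moment:
  fixes b :: "'a::euclidean_space"
  shows "moment_const TYPE('a) * (norm b)\<^sup>2 \<le> (LINT h|uball. (b \<bullet> h)\<^sup>2)"
proof (cases "b = 0")
  case False
  interpret prob_space "uball :: 'a measure" by (rule prob_space_uball)
  define p where "p = (3/4 / norm b) *\<^sub>R b"
  let ?B = "ball p (1/4)"
  have np: "norm p = 3/4" using False by (simp add: p_def)
  have sub: "?B \<subseteq> ball 0 1"
  proof
    fix y assume "y \<in> ?B"
    then have "norm (y - p) < 1/4" by (simp add: dist_norm norm_minus_commute)
    then show "y \<in> ball 0 1" using np norm_triangle_sub[of y p] by (simp add: dist_norm)
  qed
  have ge: "norm b / 2 \<le> b \<bullet> y" if "y \<in> ?B" for y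
  proof -
    have "norm (p - y) < 1/4" using that by (simp add: dist_norm)
    then have "b \<bullet> (p - y) \<le> norm b * (1/4)"
      by (meson less_imp_le mult_left_mono norm_cauchy_schwarz norm_ge_zero order_trans)
    moreover have "b \<bullet> p = norm b * (3/4)" using False by (simp add: p_def dot_square_norm power2_eq_square)
    ultimately show ?thesis by (simp add: inner_diff_right)
  qed
  have "moment_const TYPE('a) * (norm b)\<^sup>2 = (norm b / 2)\<^sup>2 * measure uball ?B"
    using measure_uball_ball[OF _ sub] by (simp add: moment_const_def field_simps power2_eq_square)
  also have "\<dots> = (LINT h|uball. (norm b / 2)\<^sup>2 * indicator ?B h)" by simp
  also have "\<dots> \<le> (LINT h|uball. (b \<bullet> h)\<^sup>2)"
  proof (intro integral_mono)
    show "integrable uball (\<lambda>h. (b \<bullet> h)\<^sup>2)"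
      by (intro loc_bdd_integrable' loc_bdd_continuous continuous_intros)
    show "(norm b / 2)\<^sup>2 * indicator ?B h \<le> (b \<bullet> h)\<^sup>2" for h
      using ge[of h] by (auto simp: indicator_def simp del: mem_ball intro!: power_mono)
    show "integrable uball (\<lambda>h::'a. (norm b / 2)\<^sup>2 * indicator ?B h)"
      by (rule integrable_uball[where B="(norm b / 2)\<^sup>2"]) (auto simp: indicator_def)
  qed
  finally show ?thesis .
qed simp

lemma moment_const_pos: "0 < moment_const TYPE('a::euclidean_space)" by (simp add: moment_const_def)

section \<open>Supersolutions of the extremal inequality\<close>

text \<open>Quantifying over all lower bounds \<open>m\<close> expresses the infimum of the
  symmetric averages without requiring it to be finite: a minimal operator of Pucci type, in
  discrete form. Each application only has to exhibit one convenient \<open>m\<close>.\<close>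

definition supersol :: "real \<Rightarrow> real \<Rightarrow> real \<Rightarrow> 'a::euclidean_space set \<Rightarrow> ('a \<Rightarrow> real) \<Rightarrow> bool" where
  "supersol \<beta> \<Lambda> e D u \<longleftrightarrow> (\<forall>x\<in>D. \<forall>m.
     (\<forall>h. norm h < \<Lambda> \<longrightarrow> 2 * m \<le> u (x + e *\<^sub>R h) + u (x - e *\<^sub>R h)) \<longrightarrow>
     (1 - \<beta>) * m + \<beta> * ball_avg u x e \<le> u x)"

lemma supersolD:
  assumes "supersol \<beta> \<Lambda> e D u" "x \<in> D"
    "\<And>h. norm h < \<Lambda> \<Longrightarrow> 2 * m \<le> u (x + e *\<^sub>R h) + u (x - e *\<^sub>R h)"
  shows "(1 - \<beta>) * m + \<beta> * ball_avg u x e \<le> u x"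
  using assms by (auto simp: supersol_def)

lemma supersol_subset: "supersol \<beta> \<Lambda> e D u \<Longrightarrow> D' \<subseteq> D \<Longrightarrow> supersol \<beta> \<Lambda> e D' u"
  by (auto simp: supersol_def)

lemma supersol_cmult:
  assumes "supersol \<beta> \<Lambda> e D u" "0 < c" shows "supersol \<beta> \<Lambda> e D (\<lambda>x. c * u x)"
  unfolding supersol_def
proof (intro ballI allI impI)
  fix x m assume x: "x \<in> D"
    and m: "\<forall>h. norm h < \<Lambda> \<longrightarrow> 2 * m \<le> c * u (x + e *\<^sub>R h) + c * u (x - e *\<^sub>R h)"
  have "(1 - \<beta>) * (m / c) + \<beta> * ball_avg u x e \<le> u x"
    using m \<open>0 < c\<close> by (intro supersolD[OF assms(1) x]) (simp add: field_simps)
  then have "c * ((1 - \<beta>) * (m / c) + \<beta> * ball_avg u x e) \<le> c * u x"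
    by (rule mult_left_mono) (use \<open>0 < c\<close> in simp)
  moreover have "c * ((1 - \<beta>) * (m / c)) = (1 - \<beta>) * m" using \<open>0 < c\<close> by simp
  moreover have "ball_avg (\<lambda>x. c * u x) x e = c * ball_avg u x e" by (simp add: ball_avg_def)
  ultimately show "(1 - \<beta>) * m + \<beta> * ball_avg (\<lambda>x. c * u x) x e \<le> c * u x"
    by (simp add: distrib_left mult.left_commute)
qed

lemma supersol_affine:
  assumes "supersol \<beta> \<Lambda> e (ball x0 (s * r)) u" "0 < s"
  shows "supersol \<beta> \<Lambda> (e / s) (ball 0 r) (\<lambda>y. u (x0 + s *\<^sub>R y))"
  unfolding supersol_def
proof (intro ballI allI impI)
  fix y m assume y: "y \<in> ball 0 r"
    and m: "\<forall>h. norm h < \<Lambda> \<longrightarrow> 2 * m \<le> u (x0 + s *\<^sub>R (y + (e / s) *\<^sub>R h)) + u (x0 + s *\<^sub>R (y - (e / s) *\<^sub>R h))"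
  have eq: "x0 + s *\<^sub>R (y + (e / s) *\<^sub>R h) = (x0 + s *\<^sub>R y) + e *\<^sub>R h"
     "x0 + s *\<^sub>R (y - (e / s) *\<^sub>R h) = (x0 + s *\<^sub>R y) - e *\<^sub>R h" for h
    using assms(2) by (simp_all add: algebra_simps)
  have "(1 - \<beta>) * m + \<beta> * ball_avg u (x0 + s *\<^sub>R y) e \<le> u (x0 + s *\<^sub>R y)"
    using m y assms(2) unfolding eq by (intro supersolD[OF assms(1)]) (auto simp: dist_norm)
  moreover have "ball_avg (\<lambda>y. u (x0 + s *\<^sub>R y)) y (e / s) = ball_avg u (x0 + s *\<^sub>R y) e"
    unfolding ball_avg_def eq ..
  ultimately show "(1 - \<beta>) * m + \<beta> * ball_avg (\<lambda>y. u (x0 + s *\<^sub>R y)) y (e / s) \<le> u (x0 + s *\<^sub>R y)"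
    by simp
qed

section \<open>Paraboloids touching from below\<close>

lemma parallelogram_sq:
  fixes x y :: "'a::euclidean_space"
  shows "(norm (x + h - y))\<^sup>2 + (norm (x - h - y))\<^sup>2 = 2 * (norm (x - y))\<^sup>2 + 2 * (norm h)\<^sup>2"
  by (simp add: power2_norm_eq_inner inner_add_left inner_add_right inner_diff_left inner_diff_right inner_commute)

lemma loc_bdd_sq: "loc_bdd (\<lambda>x::'a::euclidean_space. (norm (x - y))\<^sup>2)"
  by (intro loc_bdd_continuous continuous_intros)

lemma ball_avg_add: "loc_bdd u \<Longrightarrow> loc_bdd v \<Longrightarrow> ball_avg (\<lambda>x. u x + v x) x e = ball_avg u x e + ball_avg v x e"
  unfolding ball_avg_def by (intro Bochner_Integration.integral_add loc_bdd_integrable)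

lemma ball_avg_cmult: "ball_avg (\<lambda>x. c * u x) x e = c * ball_avg u x e"
  unfolding ball_avg_def by simp

lemma ball_avg_const: "ball_avg (\<lambda>x::'a::euclidean_space. c) x e = c"
proof -
  interpret prob_space "uball :: 'a measure" by (rule prob_space_uball)
  show ?thesis unfolding ball_avg_def using prob_space by simp
qed

lemma loc_bdd_const: "loc_bdd (\<lambda>x. c)" by (intro loc_bdd_continuous continuous_intros)

lemma ball_avg_sq_le:
  fixes x y :: "'a::euclidean_space" 
  shows "ball_avg (\<lambda>z. (norm (z - y))\<^sup>2) x e \<le> (norm (x - y))\<^sup>2 + e\<^sup>2"
proof -
  interpret prob_space "uball :: 'a measure" by (rule prob_space_uball)
  have "(LINT h|(uball::'a measure). - ((norm (x - y))\<^sup>2 + e\<^sup>2)) \<le> ball_avg (\<lambda>z. - 1 * (norm (z - y))\<^sup>2) x e"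
  proof (rule ball_avg_sym_ge[OF loc_bdd_cmult[OF loc_bdd_sq]])
    fix h :: 'a assume "norm h < 1"
    then have "(norm h)\<^sup>2 \<le> 1" by (simp add: power_le_one)
    then have "e\<^sup>2 * (norm h)\<^sup>2 \<le> e\<^sup>2" by (simp add: mult_left_le)
    then show "2 * - ((norm (x - y))\<^sup>2 + e\<^sup>2)
       \<le> - 1 * (norm (x + e *\<^sub>R h - y))\<^sup>2 + - 1 * (norm (x - e *\<^sub>R h - y))\<^sup>2"
      using parallelogram_sq[of x "e *\<^sub>R h" y] by (simp add: power_mult_distrib)
  qed simp
  then show ?thesis unfolding ball_avg_cmult using prob_space by simp
qed

text \<open>The paraboloid bounds the symmetric averages of \<open>u\<close> from below, so near a
  contact point the inequality leaves the average an excess of order \<open>e^2\<close> only. The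
  contributions, before division by \<beta>, are 1 from the inexact contact, at most
  \<open>\<Lambda>^2\<close> from the far displacements and \<beta> from the curvature of the
  paraboloid over the e-ball.\<close>

lemma touching_avg:
  fixes u :: "'a::euclidean_space \<Rightarrow> real"
  assumes \<beta>: "0 < \<beta>" "\<beta> \<le> 1" and ss: "supersol \<beta> \<Lambda> e D u" and u: "loc_bdd u" and x: "x \<in> D"
    and below: "\<And>z. c \<le> u z + (norm (z - y))\<^sup>2" and touch: "u x + (norm (x - y))\<^sup>2 \<le> c + e\<^sup>2"
  shows "ball_avg (\<lambda>z. u z + (norm (z - y))\<^sup>2 + - c) x e \<le> (2 + \<Lambda>\<^sup>2) / \<beta> * e\<^sup>2"
proof -
  define m where "m = c - (norm (x - y))\<^sup>2 - e\<^sup>2 * \<Lambda>\<^sup>2"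
  let ?b = "(norm (x - y))\<^sup>2"
  have le: "(1 - \<beta>) * m + \<beta> * ball_avg u x e \<le> u x"
  proof (rule supersolD[OF ss x])
    fix h :: 'a assume "norm h < \<Lambda>"
    then have "(norm h)\<^sup>2 \<le> \<Lambda>\<^sup>2" by (simp add: power_mono)
    then have "e\<^sup>2 * (norm h)\<^sup>2 \<le> e\<^sup>2 * \<Lambda>\<^sup>2" by (rule mult_left_mono) simp
    then show "2 * m \<le> u (x + e *\<^sub>R h) + u (x - e *\<^sub>R h)"
      using below[of "x + e *\<^sub>R h"] below[of "x - e *\<^sub>R h"] parallelogram_sq[of x "e *\<^sub>R h" y]
      by (simp add: m_def power_mult_distrib)
  qed
  have "ball_avg (\<lambda>z. u z + (norm (z - y))\<^sup>2 + - c) x e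
      = ball_avg u x e + ball_avg (\<lambda>z. (norm (z - y))\<^sup>2) x e - c"
    by (simp only: ball_avg_add loc_bdd_add loc_bdd_sq loc_bdd_const ball_avg_const u)
  also have "\<dots> \<le> ball_avg u x e + ?b + e\<^sup>2 - c" using ball_avg_sq_le[of y x e] by simp
  finally have "\<beta> * ball_avg (\<lambda>z. u z + (norm (z - y))\<^sup>2 + - c) x e \<le> \<beta> * (ball_avg u x e + ?b + e\<^sup>2 - c)"
    using \<beta> by simp
  also have "\<dots> \<le> c + e\<^sup>2 - ?b - (1 - \<beta>) * m + \<beta> * (?b + e\<^sup>2 - c)"
    using le touch by (simp add: algebra_simps)
  also have "\<dots> = e\<^sup>2 * (1 + (1 - \<beta>) * \<Lambda>\<^sup>2 + \<beta>)" by (simp add: m_def algebra_simps)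
  also have "\<dots> \<le> e\<^sup>2 * (2 + \<Lambda>\<^sup>2)"
  proof (rule mult_left_mono)
    have "(1 - \<beta>) * \<Lambda>\<^sup>2 \<le> 1 * \<Lambda>\<^sup>2" using \<beta> by (intro mult_right_mono) auto
    then show "1 + (1 - \<beta>) * \<Lambda>\<^sup>2 + \<beta> \<le> 2 + \<Lambda>\<^sup>2" using \<beta> by linarith
  qed simp
  finally show ?thesis using \<beta> by (simp add: field_simps)
qed

lemma fmeasurable_ball: "ball (x::'a::euclidean_space) r \<in> fmeasurable lborel"
  using emeasure_lborel_ball_finite[of x r] by (simp add: fmeasurable_def)

lemma fmeasurable_sub_ball: "A \<subseteq> ball (x::'a::euclidean_space) r \<Longrightarrow> A \<in> sets borel \<Longrightarrow> A \<in> fmeasurable lborel"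
  by (rule fmeasurableI2[OF fmeasurable_ball]) auto

text \<open>The e-ball has \<open>8^N\<close> times the volume of the subball, and the extra factor
  4 confines the large values to a quarter of it. The remaining three quarters are more than half,
  so two such sets in one subball must meet.\<close>

lemma markov_ball:
  fixes w :: "'a::euclidean_space \<Rightarrow> real"
  assumes w: "loc_bdd w" "\<And>z. 0 \<le> w z" and avg: "ball_avg w x e \<le> K" and K: "0 < K" and e: "0 < e"
    and sub: "ball p (e/8) \<subseteq> ball x e"
  shows "3/4 * measure lborel (ball p (e/8)) \<le> measure lborel {z\<in>ball p (e/8). w z \<le> 4 * 8 ^ DIM('a) * K}"
proof -
  let ?M = "4 * 8 ^ DIM('a) * K" and ?B = "ball p (e/8)"
  have [measurable]: "w \<in> borel_measurable borel" using w(1) by (rule loc_bdd_measurable)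
  define E where "E = {z\<in>?B. ?M < w z}"
  have [measurable]: "E \<in> sets borel" unfolding E_def by measurable
  have "?M * measure lborel E / measure lborel (ball x e) \<le> K"
    by (rule order_trans[OF ball_avg_ge_measure avg]) (use w e K sub in \<open>auto simp: E_def\<close>)
  then have "measure lborel E \<le> 1/4 * measure lborel ?B"
    using e K by (simp add: content_ball field_simps power_divide)
  moreover have "{z\<in>?B. w z \<le> ?M} = ?B - E" by (auto simp: E_def)
  moreover have "measure lborel (?B - E) = measure lborel ?B - measure lborel E"
    by (intro measurable_measure_Diff fmeasurable_ball) (auto simp: E_def)
  ultimately show ?thesis by simp
qed

text \<open>The difference of the two functions is affine and it is small on two separated subballs, which bounds its slope.\<close>

lemma vertices_close:
  fixes u :: "'a::euclidean_space \<Rightarrow> real"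
  assumes u: "loc_bdd u" and e: "0 < e" and K: "0 < K" and d: "dist x1 x2 \<le> e"
    and w1: "\<And>z. c1 \<le> u z + (norm (z - y1))\<^sup>2" "ball_avg (\<lambda>z. u z + (norm (z - y1))\<^sup>2 + - c1) x1 e \<le> K * e\<^sup>2"
    and w2: "\<And>z. c2 \<le> u z + (norm (z - y2))\<^sup>2" "ball_avg (\<lambda>z. u z + (norm (z - y2))\<^sup>2 + - c2) x2 e \<le> K * e\<^sup>2"
  shows "norm (y1 - y2) \<le> 4 * (4 * 8 ^ DIM('a) * K) * e"
proof (cases "y1 = y2")
  case False
  define v where "v = y1 - y2"
  have v: "norm v > 0" using False by (simp add: v_def)
  let ?w1 = "\<lambda>z. u z + (norm (z - y1))\<^sup>2 + - c1" and ?w2 = "\<lambda>z. u z + (norm (z - y2))\<^sup>2 + - c2"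
  define M where "M = 4 * 8 ^ DIM('a) * K"
  define mid where "mid = (1/2) *\<^sub>R (x1 + x2)"
  have lb: "loc_bdd ?w1" "loc_bdd ?w2" by (intro loc_bdd_add loc_bdd_sq loc_bdd_const u)+
  \<comment> \<open>The subball around \<open>p\<close> lies in both averaging balls, as e/2 + e/4 +
    e/8 < e. Each gap is small on three quarters of it, hence both are small at a common
    point.\<close>
  have pick: "\<exists>z. dist z p < e/8 \<and> ?w1 z \<le> M * e\<^sup>2 \<and> ?w2 z \<le> M * e\<^sup>2" if p: "norm (p - mid) \<le> e/4" for p
  proof (rule ccontr)
    assume n: "\<not> ?thesis"
    let ?B = "ball p (e/8)"
    have mid: "dist mid x1 \<le> e/2" "dist mid x2 \<le> e/2"
    proof -
      have "mid - x1 = (1/2) *\<^sub>R (x2 - x1)" "mid - x2 = (1/2) *\<^sub>R (x1 - x2)"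
        by (simp_all add: mid_def algebra_simps) (simp_all flip: scaleR_add_left)
      then show "dist mid x1 \<le> e/2" "dist mid x2 \<le> e/2"
        using d by (simp_all add: dist_norm norm_minus_commute)
    qed
    have sub: "?B \<subseteq> ball x1 e" "?B \<subseteq> ball x2 e"
    proof -
      have "dist x1 z < e \<and> dist x2 z < e" if "dist p z < e/8" for z
        using p mid that dist_triangle[of mid z p] dist_triangle[of x1 z mid] dist_triangle[of x2 z mid] e
        by (simp add: dist_norm norm_minus_commute)
      then show "?B \<subseteq> ball x1 e" "?B \<subseteq> ball x2 e" by auto
    qed
    define S1 where "S1 = {z\<in>?B. ?w1 z \<le> 4 * 8 ^ DIM('a) * (K * e\<^sup>2)}"
    define S2 where "S2 = {z\<in>?B. ?w2 z \<le> 4 * 8 ^ DIM('a) * (K * e\<^sup>2)}"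
    have [measurable]: "u \<in> borel_measurable borel" using u by (rule loc_bdd_measurable)
    have m: "S1 \<in> sets borel" "S2 \<in> sets borel" unfolding S1_def S2_def by measurable
    have "3/4 * measure lborel ?B \<le> measure lborel S1" unfolding S1_def
      by (rule markov_ball[OF lb(1) _ w1(2) _ e sub(1)]) (use w1(1) K e in \<open>auto simp: algebra_simps\<close>)
    moreover have "3/4 * measure lborel ?B \<le> measure lborel S2" unfolding S2_def
      by (rule markov_ball[OF lb(2) _ w2(2) _ e sub(2)]) (use w2(1) K e in \<open>auto simp: algebra_simps\<close>)
    moreover have "S1 \<inter> S2 = {}" using n by (auto simp: S1_def S2_def M_def dist_commute algebra_simps)
    then have "measure lborel (S1 \<union> S2) = measure lborel S1 + measure lborel S2"
      using m by (intro measure_Un2[THEN trans]) (auto simp: S1_def S2_def Diff_Int2 Diff_triv Int_commute intro!: fmeasurable_sub_ball[of _ p "e/8"] arg_cong2[where f="(+)"] arg_cong[where f="measure lborel"])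
    moreover have "measure lborel (S1 \<union> S2) \<le> measure lborel ?B"
      using m by (intro measure_mono_fmeasurable fmeasurable_ball) (auto simp: S1_def S2_def)
    moreover have "measure lborel ?B > 0" using e by (simp add: content_ball)
    ultimately show False by simp
  qed
  \<comment> \<open>The points \<open>p\<close> and \<open>q\<close> are e/2 apart along
    \<open>v\<close>. Moving each by less than e/8 still leaves a separation of e/4 in that
    direction.\<close>
  define p where "p = mid + (e / (4 * norm v)) *\<^sub>R v"
  define q where "q = mid - (e / (4 * norm v)) *\<^sub>R v"
  have "norm (p - mid) \<le> e/4" "norm (q - mid) \<le> e/4" using v e by (simp_all add: p_def q_def)
  then obtain p' q' where p': "dist p' p < e/8" "?w1 p' \<le> M * e\<^sup>2" "?w2 p' \<le> M * e\<^sup>2"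
    and q': "dist q' q < e/8" "?w1 q' \<le> M * e\<^sup>2" "?w2 q' \<le> M * e\<^sup>2" using pick by metis
  have pos: "0 \<le> ?w1 z" "0 \<le> ?w2 z" for z using w1(1)[of z] w2(1)[of z] by auto
  have id: "(?w1 q' - ?w2 q') - (?w1 p' - ?w2 p') = 2 * (v \<bullet> (p' - q'))"
    by (simp add: v_def power2_norm_eq_inner inner_add_left inner_add_right inner_diff_left inner_diff_right inner_commute)
  have "2 * (v \<bullet> (p' - q')) \<le> 2 * M * e\<^sup>2"
    unfolding id[symmetric] using pos[of q'] pos[of p'] p' q' by linarith
  moreover have "e/4 * norm v \<le> v \<bullet> (p' - q')"
  proof -
    have "v \<bullet> (p - q) = e/2 * norm v"
    proof -
      have "p - q = (e / (2 * norm v)) *\<^sub>R v"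
        using v by (simp add: p_def q_def field_simps flip: scaleR_add_left)
      then show ?thesis using v by (simp add: dot_square_norm power2_eq_square)
    qed
    moreover have "- (v \<bullet> (p' - p)) \<le> norm v * (e/8)"
      using p'(1) Cauchy_Schwarz_ineq2[of v "p' - p"] mult_left_mono[of "norm (p' - p)" "e/8" "norm v"]
      by (simp add: dist_norm)
    moreover have "v \<bullet> (q' - q) \<le> norm v * (e/8)"
      using q'(1) norm_cauchy_schwarz[of v "q' - q"] mult_left_mono[of "norm (q' - q)" "e/8" "norm v"]
      by (simp add: dist_norm)
    ultimately show ?thesis by (simp add: inner_diff_right algebra_simps)
  qed
  ultimately have "e * norm v \<le> e * (4 * M * e)" by (simp add: power2_eq_square algebra_simps)
  then show ?thesis using e by (simp add: v_def M_def)
qed (use e K in simp)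

section \<open>Measure of sublevel sets\<close>

text \<open>A uniform bound on the size of finite subfamilies makes the whole family finite. This is
  needed since the Vitali covering lemma supplies only a countable one.\<close>

lemma measure_packing:
  fixes A :: "'i \<Rightarrow> 'a::euclidean_space set" and c :: real
  assumes c: "0 < c" and S: "S \<in> fmeasurable lborel"
    and A: "\<And>i. i \<in> I \<Longrightarrow> A i \<in> sets borel" "\<And>i. i \<in> I \<Longrightarrow> A i \<subseteq> S" "\<And>i. i \<in> I \<Longrightarrow> c \<le> measure lborel (A i)"
    and disj: "disjoint_family_on A I"
  shows "finite I" "card I * c \<le> measure lborel S"
proof -
  have pw: "pairwise (\<lambda>i j. disjnt (A i) (A j)) F" if "F \<subseteq> I" for F
    using disj that unfolding pairwise_def disjnt_def disjoint_family_on_def by blast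
  have *: "card F * c \<le> measure lborel S" if F: "F \<subseteq> I" "finite F" for F
  proof -
    have fm: "A i \<in> fmeasurable lborel" if "i \<in> F" for i
      using that F A by (intro fmeasurableI2[OF S]) auto
    have "card F * c \<le> (\<Sum>i\<in>F. measure lborel (A i))"
      using F A(3) by (intro sum_bounded_below[of F c]) auto
    also have "\<dots> = measure lborel (\<Union>i\<in>F. A i)"
      using fm F pw by (intro measure_UNION'[symmetric]) auto
    also have "\<dots> \<le> measure lborel S"
      using F A fm by (intro measure_mono_fmeasurable S) auto
    finally show ?thesis .
  qed
  have "finite I \<and> card I \<le> nat \<lceil>measure lborel S / c\<rceil>"
  proof (rule finite_if_finite_subsets_card_bdd[of _ "nat \<lceil>measure lborel S / c\<rceil>"])
    fix F assume "F \<subseteq> I" "finite F"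
    then have "real (card F) \<le> measure lborel S / c" using *[of F] c by (simp add: field_simps)
    then show "card F \<le> nat \<lceil>measure lborel S / c\<rceil>" by linarith
  qed
  then show fin: "finite I" ..
  show "card I * c \<le> measure lborel S" using *[OF order_refl fin] .
qed

lemma fmeasurable_cball: "cball (x::'a::euclidean_space) r \<in> fmeasurable lborel"
  using emeasure_lborel_cball_finite[of x r] by (simp add: fmeasurable_def)

text \<open>The level is the exact infimum and bounds \<open>f\<close> everywhere; the whole error
  sits in the choice of the point.\<close>

lemma approx_minimizer:
  fixes f :: "'a \<Rightarrow> real"
  assumes "\<And>z. 0 \<le> f z" "0 < d"
  obtains x c where "\<And>z. c \<le> f z" "f x \<le> c + d"
proof -
  define c where "c = (INF z. f z)"
  have bdd: "bdd_below (range f)" using assms(1) by (auto intro!: bdd_belowI)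
  have "\<exists>y\<in>range f. y < c + d" unfolding c_def using assms(2) bdd
    by (subst cInf_less_iff[symmetric]) auto
  then obtain x where "f x < c + d" by auto
  moreover have "c \<le> f z" for z unfolding c_def using bdd by (intro cINF_lower) auto
  ultimately show ?thesis using that[of c x] by simp
qed

text \<open>The substitute for the Aleksandrov-Bakelman-Pucci estimate. Vertices whose contact
  points are e-close fit in a ball of radius \<open>4 * M * e\<close>, while all vertices fill a
  ball of radius 1/8, so at least \<open>(32 M e)^(-N)\<close> contact balls are disjoint. Each
  holds a volume of order \<open>e^N\<close> where \<open>u\<close> is small, and the powers of
  \<open>e\<close> cancel.\<close>

lemma sublevel_measure:
  fixes \<beta> \<Lambda> :: real
  assumes \<beta>: "0 < \<beta>" "\<beta> \<le> 1"
  obtains e0 \<mu> where "0 < e0" "0 < \<mu>"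
    "\<And>e u x. \<lbrakk>0 < e; e \<le> e0; loc_bdd (u :: 'a::euclidean_space \<Rightarrow> real); \<And>z. 0 \<le> u z;
      supersol \<beta> \<Lambda> e (ball 0 1) u; x \<in> ball 0 (1/2); u x \<le> 1/4\<rbrakk>
      \<Longrightarrow> \<mu> \<le> measure lborel {z\<in>ball 0 1. u z < 1}"
proof -
  define K where "K = (2 + \<Lambda>\<^sup>2) / \<beta>"
  define M where "M = 4 * 8 ^ DIM('a) * K"
  have K2: "2 \<le> K" using \<beta> unfolding K_def by (simp add: le_divide_eq) (smt (verit) zero_le_power2)
  have M: "1 \<le> M"
  proof -
    have "(1::real) * 1 \<le> (4 * 8 ^ DIM('a)) * K"
    proof (rule mult_mono)
      show "(1::real) \<le> 4 * 8 ^ DIM('a)" using one_le_power[of "8::real" "DIM('a)"] by linarith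
    qed (use K2 in auto)
    then show ?thesis by (simp add: M_def)
  qed
  \<comment> \<open>This gives \<open>e \<le> 1/8\<close> and makes both \<open>e^2\<close> and
    \<open>M * e^2\<close> at most 1/64.\<close>
  define e0 where "e0 = 1 / (8 * M)"
  define \<omega> where "\<omega> = unit_ball_vol (real DIM('a))"
  have \<omega>: "\<omega> > 0" by (simp add: \<omega>_def)
  \<comment> \<open>The number \<open>(32 M e)^(-N)\<close> of balls times the volume
    \<open>3/4 * \<omega> * (e/8)^N\<close> in each of them.\<close>
  define \<mu> where "\<mu> = 3/4 * \<omega> * (1/(256*M)) ^ DIM('a)"
  show ?thesis
  proof (rule that[of e0 \<mu>])
    show "0 < e0" "0 < \<mu>" using M \<omega> by (simp_all add: e0_def \<mu>_def)
    fix e and u :: "'a \<Rightarrow> real" and x :: 'a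
    assume e: "0 < e" "e \<le> e0" and u: "loc_bdd u" "\<And>z. 0 \<le> u z"
      and ss: "supersol \<beta> \<Lambda> e (ball 0 1) u" and x: "x \<in> ball 0 (1/2)" "u x \<le> 1/4"
    have eM: "e * M \<le> 1/8" using e M by (simp add: e0_def field_simps)
    have e8: "e \<le> 1/8"
      using eM M e mult_left_mono[of 1 M e] by linarith
    have "e * e \<le> 1/8 * (1/8)" using e8 e by (intro mult_mono) auto
    then have e2: "e\<^sup>2 \<le> 1/64" by (simp add: power2_eq_square)
    have "e * (e * M) \<le> 1/8 * (1/8)" using e8 e eM M by (intro mult_mono) auto
    then have Me2: "M * e\<^sup>2 \<le> 1/64" by (simp add: power2_eq_square mult_ac)
    have [measurable]: "u \<in> borel_measurable borel" using u(1) by (rule loc_bdd_measurable)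
    have "\<forall>y. \<exists>X c. (\<forall>z. c \<le> u z + (norm (z - y))\<^sup>2) \<and> u X + (norm (X - y))\<^sup>2 \<le> c + e\<^sup>2"
    proof
      fix y show "\<exists>X c. (\<forall>z. c \<le> u z + (norm (z - y))\<^sup>2) \<and> u X + (norm (X - y))\<^sup>2 \<le> c + e\<^sup>2"
        by (rule approx_minimizer[of "\<lambda>z. u z + (norm (z - y))\<^sup>2" "e\<^sup>2"]) (use u(2) e(1) in auto)
    qed
    then obtain X c where c: "\<And>y z. c y \<le> u z + (norm (z - y))\<^sup>2"
      and X: "\<And>y. u (X y) + (norm (X y - y))\<^sup>2 \<le> c y + e\<^sup>2" by metis
    let ?V = "ball (0::'a) (1/8)"
    let ?w = "\<lambda>y z. u z + (norm (z - y))\<^sup>2 + - c y"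
    \<comment> \<open>The paraboloid is tested at the low point \<open>x\<close>, which is within
      1/2 + 1/8 of each vertex: 1/4 + (5/8)^2 = 41/64.\<close>
    have c_le: "c y \<le> 41/64" if "y \<in> ?V" for y
    proof -
      have "norm (x - y) \<le> 5/8" using that x norm_triangle_ineq4[of x y] by (simp add: dist_norm)
      then have "(norm (x - y))\<^sup>2 \<le> (5/8)\<^sup>2" by (rule power_mono) simp
      then show ?thesis using c[of y x] x(2) by (simp add: power2_eq_square)
    qed
    \<comment> \<open>Otherwise (13/16)^2 = 169/256 would be at most 41/64 + 1/64 = 168/256. So
      contact takes place where the inequality is available, with room left for a ball of radius e/8
      inside the unit ball.\<close>
    have X_in: "norm (X y) < 15/16" if "y \<in> ?V" for y
    proof (rule ccontr)
      assume "\<not> ?thesis"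
      then have "13/16 \<le> norm (X y - y)" using that norm_triangle_ineq2[of "X y" y] by (simp add: dist_norm)
      then have "(13/16)\<^sup>2 \<le> (norm (X y - y))\<^sup>2" by (rule power_mono) simp
      then show False using X[of y] u(2)[of "X y"] c_le[OF that] e2 by (simp add: power2_eq_square)
    qed
    have avg: "ball_avg (?w y) (X y) e \<le> K * e\<^sup>2" if "y \<in> ?V" for y
      unfolding K_def by (rule touching_avg[OF \<beta> ss u(1) _ c X]) (use X_in[OF that] in \<open>simp add: dist_norm\<close>)
    \<comment> \<open>The index set consists of vertices, the covered balls sit at their contact
      points. Since 5 * (e/8) < e, each contact point is within \<open>e\<close> of a selected one,
      which is the hypothesis of \<open>vertices_close\<close>.\<close>
    obtain C where C: "countable C" "C \<subseteq> ?V"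
      "pairwise (\<lambda>i j. disjnt (cball (X i) (e/8)) (cball (X j) (e/8))) C"
      "\<And>i. i \<in> ?V \<Longrightarrow> \<exists>j. j \<in> C \<and> \<not> disjnt (cball (X i) (e/8)) (cball (X j) (e/8)) \<and>
                        cball (X i) (e/8) \<subseteq> ball (X j) (5 * (e/8))"
      by (rule Vitali_covering_lemma_cballs_balls[of ?V "\<lambda>_. e/8" "e/8" X]) (use e in auto)
    define A where "A y = {z\<in>ball (X y) (e/8). ?w y z \<le> M * e\<^sup>2}" for y
    let ?S = "{z\<in>ball 0 1. u z < 1}"
    let ?c = "3/4 * (\<omega> * (e/8) ^ DIM('a))"
    have pos: "0 < ?c" using \<omega> e by simp
    have fS: "?S \<in> fmeasurable lborel" by (rule fmeasurable_sub_ball[of _ 0 1]) auto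
    have mA: "A y \<in> sets borel" for y unfolding A_def by measurable
    have sub: "A y \<subseteq> ?S" if "y \<in> C" for y
    proof
      fix z assume z: "z \<in> A y"
      have yV: "y \<in> ?V" using that C by auto
      have "norm z < 1" using z X_in[OF yV] e8 norm_triangle_sub[of z "X y"]
        by (simp add: A_def dist_norm norm_minus_commute)
      moreover have "u z + (norm (z - y))\<^sup>2 \<le> M * e\<^sup>2 + c y" using z by (simp add: A_def)
      then have "u z < 1" using Me2 c_le[OF yV] zero_le_power2[of "norm (z - y)"] by linarith
      ultimately show "z \<in> ?S" by (simp add: dist_norm)
    qed
    have me: "?c \<le> measure lborel (A y)" if "y \<in> C" for y
    proof -
      have yV: "y \<in> ?V" using that C by auto
      have "3/4 * measure lborel (ball (X y) (e/8)) \<le> measure lborel {z\<in>ball (X y) (e/8). ?w y z \<le> 4 * 8 ^ DIM('a) * (K * e\<^sup>2)}"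
      proof (rule markov_ball[OF _ _ avg[OF yV] _ e(1)])
        show "loc_bdd (?w y)" by (intro loc_bdd_add loc_bdd_sq loc_bdd_const u)
        show "0 \<le> ?w y z" for z using c[of y z] by simp
        show "0 < K * e\<^sup>2" using K2 e by simp
        show "ball (X y) (e/8) \<subseteq> ball (X y) e" using e by (intro subset_ball) simp
      qed
      moreover have "measure lborel (ball (X y) (e/8)) = \<omega> * (e/8) ^ DIM('a)"
        unfolding \<omega>_def by (rule content_ball) (use e in simp)
      moreover have "4 * 8 ^ DIM('a) * (K * e\<^sup>2) = M * e\<^sup>2" by (simp add: M_def)
      ultimately show ?thesis by (simp only: A_def)
    qed
    have "A y \<subseteq> cball (X y) (e/8)" for y by (auto simp: A_def)
    then have disj: "disjoint_family_on A C" using C(3)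
      unfolding disjoint_family_on_def pairwise_def disjnt_def by blast
    note ALL = measure_packing[OF pos fS mA sub me disj]
    have cov: "?V \<subseteq> (\<Union>j\<in>C. cball j (4 * M * e))"
    proof
      fix y assume y: "y \<in> ?V"
      then obtain j where j: "j \<in> C" "cball (X y) (e/8) \<subseteq> ball (X j) (5 * (e/8))" using C(4) by blast
      have "X y \<in> cball (X y) (e/8)" using e by simp
      then have "X y \<in> ball (X j) (5 * (e/8))" by (rule subsetD[OF j(2)])
      then have "dist (X j) (X y) < 5 * (e/8)" by simp
      then have "dist (X y) (X j) \<le> e" using e by (simp add: dist_commute)
      then have "norm (y - j) \<le> 4 * M * e" unfolding M_def
        by (intro order_trans[OF vertices_close[OF u(1) e(1) _ _ c avg c avg]]) (use y j C(2) K2 in auto)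
      then show "y \<in> (\<Union>j\<in>C. cball j (4 * M * e))" using j by (auto simp: dist_norm norm_minus_commute)
    qed
    have "measure lborel ?V \<le> measure lborel (\<Union>j\<in>C. cball j (4 * M * e))"
      using ALL(1) by (intro measure_mono_fmeasurable cov fmeasurable.finite_UN)
        (auto intro: fmeasurable_cball)
    also have "\<dots> \<le> (\<Sum>j\<in>C. measure lborel (cball j (4 * M * e)))"
      using ALL(1) by (intro measure_UNION_le) auto
    also have "\<dots> = card C * (\<omega> * (4 * M * e) ^ DIM('a))"
      using e M by (simp add: content_cball \<omega>_def)
    finally have V: "\<omega> * (1/8) ^ DIM('a) \<le> card C * (\<omega> * (4 * M * e) ^ DIM('a))"
      by (simp add: content_ball \<omega>_def)
    have "\<mu> = 3/4 * (1/(32*M)) ^ DIM('a) * (\<omega> * (1/8) ^ DIM('a))"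
    proof -
      have "(1/(32*M)) ^ DIM('a) * (1/8) ^ DIM('a) = (1/(256*M)) ^ DIM('a)"
        by (subst power_mult_distrib[symmetric]) simp
      then show ?thesis by (simp only: \<mu>_def mult_ac)
    qed
    also have "\<dots> \<le> 3/4 * (1/(32*M)) ^ DIM('a) * (card C * (\<omega> * (4 * M * e) ^ DIM('a)))"
      using V M by (intro mult_left_mono) auto
    also have "\<dots> = card C * (3/4 * (\<omega> * ((1/(32*M)) * (4 * M * e)) ^ DIM('a)))"
      by (simp only: power_mult_distrib mult_ac)
    also have "(1/(32*M)) * (4 * M * e) = e/8" using M by (simp add: field_simps)
    also have "card C * (3/4 * (\<omega> * (e/8) ^ DIM('a))) \<le> measure lborel ?S" by (rule ALL(2))
    finally show "\<mu> \<le> measure lborel ?S" .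
  qed
qed

section \<open>The barrier\<close>

text \<open>The first two nonzero terms of the hyperbolic cosine series.\<close>

lemma exp_sym_ge: "2 + t\<^sup>2 \<le> exp t + exp (- t)" for t :: real
proof -
  have s: "(\<lambda>n. if even n then t ^ n /\<^sub>R fact n else 0) sums cosh t" by (rule cosh_converges)
  have "(\<Sum>n\<in>{0,2}. if even n then t ^ n /\<^sub>R fact n else 0) \<le> cosh t"
    unfolding sums_unique[OF s]
    by (intro sum_le_suminf sums_summable[OF s]) (auto simp: zero_le_even_power)
  then show ?thesis by (simp add: cosh_def fact_2)
qed

text \<open>The symmetric sum of a Gaussian factors exactly, so its curvature can be estimated
  without a Taylor remainder.\<close>

lemma barrier_pair:
  fixes x h :: "'a::euclidean_space"
  shows "exp (- q * (norm (x + h))\<^sup>2) + exp (- q * (norm (x - h))\<^sup>2)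
    = exp (- q * (norm x)\<^sup>2) * exp (- q * (norm h)\<^sup>2) * (exp (2 * q * (x \<bullet> h)) + exp (- (2 * q * (x \<bullet> h))))"
  by (simp add: power2_norm_eq_inner inner_add_left inner_add_right inner_diff_left inner_diff_right
      inner_commute algebra_simps flip: exp_add)

text \<open>Relative to the value of the Gaussian, the losses are linear in \<open>q\<close>: up to
  \<open>q * e^2 * \<Lambda>^2\<close> in the extremal part, where \<open>h\<close> may be
  orthogonal to \<open>x\<close>, and \<open>q * e^2\<close> in the average. The gain of the average
  in the radial direction is quadratic in \<open>q\<close>. The given \<open>q\<close> makes the
  gain, weighted by \<beta>, at least \<open>q * e^2 * (2 + \<Lambda>^2)\<close>, which covers the
  losses and leaves a strict margin.\<close>

lemma barrier_strict:
  fixes x :: "'a::euclidean_space"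
  assumes \<beta>: "0 < \<beta>" "\<beta> \<le> 1" and r: "0 < r" "r \<le> norm x" and e: "0 < e"
    and q: "q = (2 + \<Lambda>\<^sup>2) / (\<beta> * r\<^sup>2 * moment_const TYPE('a))" and qe: "q * e\<^sup>2 \<le> 1/2"
    and \<phi>: "\<phi> = (\<lambda>z::'a. exp (- q * (norm z)\<^sup>2) + k)"
  obtains m where "\<And>h. norm h < \<Lambda> \<Longrightarrow> 2 * m \<le> \<phi> (x + e *\<^sub>R h) + \<phi> (x - e *\<^sub>R h)"
    "\<phi> x + q * e\<^sup>2 * exp (- q * (norm x)\<^sup>2) \<le> (1 - \<beta>) * m + \<beta> * ball_avg \<phi> x e"
proof -
  define E where "E = exp (- q * (norm x)\<^sup>2)"
  have E: "0 < E" by (simp add: E_def)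
  have moment_const: "moment_const TYPE('a) > 0" by (rule moment_const_pos)
  have q0: "0 < q" unfolding q using \<beta> r moment_const by (intro divide_pos_pos) (auto intro: add_pos_nonneg)
  have pair: "\<phi> (x + e *\<^sub>R h) + \<phi> (x - e *\<^sub>R h) =
      E * (exp (- q * e\<^sup>2 * (norm h)\<^sup>2) * (exp (2 * q * e * (x \<bullet> h)) + exp (- (2 * q * e * (x \<bullet> h))))) + 2 * k" for h
    using barrier_pair[of q x "e *\<^sub>R h"] by (simp add: \<phi> E_def power_mult_distrib mult_ac)
  define m where "m = E * (1 - q * e\<^sup>2 * \<Lambda>\<^sup>2) + k"
  have 1: "2 * m \<le> \<phi> (x + e *\<^sub>R h) + \<phi> (x - e *\<^sub>R h)" if "norm h < \<Lambda>" for h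
  proof -
    have "(norm h)\<^sup>2 \<le> \<Lambda>\<^sup>2" using that by (simp add: power_mono)
    then have "q * e\<^sup>2 * (norm h)\<^sup>2 \<le> q * e\<^sup>2 * \<Lambda>\<^sup>2" using q0 by (intro mult_left_mono) auto
    then have "1 - q * e\<^sup>2 * \<Lambda>\<^sup>2 \<le> exp (- q * e\<^sup>2 * (norm h)\<^sup>2)"
      using exp_ge_add_one_self[of "- q * e\<^sup>2 * (norm h)\<^sup>2"] by simp
    moreover have "2 \<le> exp (2 * q * e * (x \<bullet> h)) + exp (- (2 * q * e * (x \<bullet> h)))"
      using exp_sym_ge[of "2 * q * e * (x \<bullet> h)"] zero_le_power2[of "2 * q * e * (x \<bullet> h)"] by linarith
    then have "exp (- q * e\<^sup>2 * (norm h)\<^sup>2) * 2 \<le> exp (- q * e\<^sup>2 * (norm h)\<^sup>2) * (exp (2 * q * e * (x \<bullet> h)) + exp (- (2 * q * e * (x \<bullet> h))))"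
      by (rule mult_left_mono) simp
    ultimately have "2 * (1 - q * e\<^sup>2 * \<Lambda>\<^sup>2) \<le> exp (- q * e\<^sup>2 * (norm h)\<^sup>2) * (exp (2 * q * e * (x \<bullet> h)) + exp (- (2 * q * e * (x \<bullet> h))))"
      by (intro order_trans[OF _ \<open>exp (- q * e\<^sup>2 * (norm h)\<^sup>2) * 2 \<le> _\<close>]) simp
    then have "E * (2 * (1 - q * e\<^sup>2 * \<Lambda>\<^sup>2)) \<le> E * (exp (- q * e\<^sup>2 * (norm h)\<^sup>2) * (exp (2 * q * e * (x \<bullet> h)) + exp (- (2 * q * e * (x \<bullet> h)))))"
      by (rule mult_left_mono) (use E in simp)
    then show ?thesis unfolding pair m_def by (simp add: algebra_simps)
  qed
  interpret prob_space "uball :: 'a measure" by (rule prob_space_uball)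
  let ?g = "\<lambda>h. E * (1 - q * e\<^sup>2) + k + E * q\<^sup>2 * e\<^sup>2 * (x \<bullet> h)\<^sup>2"
  have i: "integrable uball (\<lambda>h. (x \<bullet> h)\<^sup>2)"
    by (intro loc_bdd_integrable' loc_bdd_continuous continuous_intros)
  have 2: "(LINT h|uball. ?g h) \<le> ball_avg \<phi> x e"
  proof (rule ball_avg_sym_ge)
    show "loc_bdd \<phi>" unfolding \<phi> by (intro loc_bdd_continuous continuous_intros)
    show "integrable uball ?g" using i by simp
    fix h :: 'a assume h: "norm h < 1"
    define t where "t = 2 * q * e * (x \<bullet> h)"
    have "(norm h)\<^sup>2 \<le> 1" using h by (simp add: power_le_one)
    then have "q * e\<^sup>2 * (norm h)\<^sup>2 \<le> q * e\<^sup>2 * 1" using q0 by (intro mult_left_mono) auto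
    then have a: "1 - q * e\<^sup>2 \<le> exp (- q * e\<^sup>2 * (norm h)\<^sup>2)"
      using exp_ge_add_one_self[of "- q * e\<^sup>2 * (norm h)\<^sup>2"] by simp
    have "(1 - q * e\<^sup>2) * (2 + t\<^sup>2) \<le> exp (- q * e\<^sup>2 * (norm h)\<^sup>2) * (exp t + exp (- t))"
      by (rule mult_mono[OF a exp_sym_ge]) auto
    \<comment> \<open>Here \<open>q * e^2 \<le> 1/2\<close> saves half of the quadratic term from
      the damping factor.\<close>
    moreover have "1/2 * t\<^sup>2 \<le> (1 - q * e\<^sup>2) * t\<^sup>2" using qe by (intro mult_right_mono) auto
    ultimately have "2 * (1 - q * e\<^sup>2) + 1/2 * t\<^sup>2 \<le> exp (- q * e\<^sup>2 * (norm h)\<^sup>2) * (exp t + exp (- t))"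
      by (simp add: distrib_left)
    then have "E * (2 * (1 - q * e\<^sup>2) + 1/2 * t\<^sup>2) \<le> E * (exp (- q * e\<^sup>2 * (norm h)\<^sup>2) * (exp t + exp (- t)))"
      by (rule mult_left_mono) (use E in simp)
    then show "2 * ?g h \<le> \<phi> (x + e *\<^sub>R h) + \<phi> (x - e *\<^sub>R h)"
      unfolding pair t_def by (simp add: algebra_simps power_mult_distrib)
  qed
  have "(LINT h|uball. ?g h) = E * (1 - q * e\<^sup>2) + k + E * q\<^sup>2 * e\<^sup>2 * (LINT h|uball. (x \<bullet> h)\<^sup>2)"
    using i prob_space by simp
  moreover have "r\<^sup>2 * moment_const TYPE('a) \<le> (LINT h|uball. (x \<bullet> h)\<^sup>2)"
  proof -
    have "moment_const TYPE('a) * r\<^sup>2 \<le> moment_const TYPE('a) * (norm x)\<^sup>2" using r moment_const by (intro mult_left_mono power_mono) auto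
    then show ?thesis using second_moment[of x] by (simp add: mult.commute)
  qed
  then have "E * q\<^sup>2 * e\<^sup>2 * (r\<^sup>2 * moment_const TYPE('a)) \<le> E * q\<^sup>2 * e\<^sup>2 * (LINT h|uball. (x \<bullet> h)\<^sup>2)"
    using E by (intro mult_left_mono) auto
  ultimately have "E * (1 - q * e\<^sup>2) + k + E * q\<^sup>2 * e\<^sup>2 * (r\<^sup>2 * moment_const TYPE('a)) \<le> ball_avg \<phi> x e"
    using 2 by linarith
  then have "\<beta> * (E * (1 - q * e\<^sup>2) + k + E * q\<^sup>2 * e\<^sup>2 * (r\<^sup>2 * moment_const TYPE('a))) \<le> \<beta> * ball_avg \<phi> x e"
    using \<beta> by simp
  moreover have "\<beta> * (q * (r\<^sup>2 * moment_const TYPE('a))) = 2 + \<Lambda>\<^sup>2" unfolding q using \<beta> r moment_const by (simp add: field_simps)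
  then have "\<beta> * (E * q\<^sup>2 * e\<^sup>2 * (r\<^sup>2 * moment_const TYPE('a))) = E * q * e\<^sup>2 * (2 + \<Lambda>\<^sup>2)"
    by (simp add: power2_eq_square mult_ac)
  ultimately have "(1 - \<beta>) * m + \<beta> * ball_avg \<phi> x e
      \<ge> (1 - \<beta>) * m + \<beta> * (E * (1 - q * e\<^sup>2) + k) + E * q * e\<^sup>2 * (2 + \<Lambda>\<^sup>2)"
    by (simp add: distrib_left)
  also have "(1 - \<beta>) * m + \<beta> * (E * (1 - q * e\<^sup>2) + k) + E * q * e\<^sup>2 * (2 + \<Lambda>\<^sup>2)
     = E + k + E * q * e\<^sup>2 + E * q * e\<^sup>2 * ((1 - \<beta>) + \<beta> * \<Lambda>\<^sup>2)"
    by (simp add: m_def algebra_simps)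
  finally have "E + k + E * q * e\<^sup>2 + E * q * e\<^sup>2 * ((1 - \<beta>) + \<beta> * \<Lambda>\<^sup>2) \<le> (1 - \<beta>) * m + \<beta> * ball_avg \<phi> x e" .
  moreover have "0 \<le> E * q * e\<^sup>2 * ((1 - \<beta>) + \<beta> * \<Lambda>\<^sup>2)" using E q0 \<beta> by auto
  ultimately have "\<phi> x + q * e\<^sup>2 * E \<le> (1 - \<beta>) * m + \<beta> * ball_avg \<phi> x e"
    by (simp add: \<phi> E_def mult_ac)
  then show ?thesis using that[OF 1] by (simp add: E_def)
qed

text \<open>The barrier is at most 1 on the inner ball and at most 0 outside
  \<open>ball 0 D\<close>, so it can exceed \<open>u\<close> only in the annulus, where it is a
  strict subsolution. The near-minimum of the difference is taken over the whole space, which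
  accounts for displacements that leave the ball.\<close>

lemma barrier_lower_bound:
  fixes \<beta> \<Lambda> r \<rho> D :: real
  assumes \<beta>: "0 < \<beta>" "\<beta> \<le> 1" and r: "0 < r" "0 < \<rho>" "\<rho> < D"
  obtains e0 c where "0 < e0" "0 < c"
    "\<And>e u x. \<lbrakk>0 < e; e \<le> e0; loc_bdd (u :: 'a::euclidean_space \<Rightarrow> real); \<And>z. 0 \<le> u z;
      supersol \<beta> \<Lambda> e (ball 0 D) u; \<And>z. z \<in> ball 0 r \<Longrightarrow> 1 \<le> u z; x \<in> ball 0 \<rho>\<rbrakk>
      \<Longrightarrow> c \<le> u x"
proof -
  define q where "q = (2 + \<Lambda>\<^sup>2) / (\<beta> * r\<^sup>2 * moment_const TYPE('a))"
  have q0: "0 < q" unfolding q_def using \<beta> r moment_const_pos[where 'a='a] by (intro divide_pos_pos) (auto intro: add_pos_nonneg)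
  define e0 where "e0 = min 1 (1 / (2 * q))"
  define eD where "eD = exp (- q * D\<^sup>2)"
  define c where "c = exp (- q * \<rho>\<^sup>2) - eD"
  show ?thesis
  proof (rule that[of e0 c])
    show "0 < e0" using q0 by (simp add: e0_def)
    have "\<rho>\<^sup>2 < D\<^sup>2" using r by (intro power_strict_mono) auto
    then show "0 < c" using q0 by (simp add: c_def eD_def)
    fix e and u :: "'a \<Rightarrow> real" and x :: 'a
    assume e: "0 < e" "e \<le> e0" and u: "loc_bdd u" "\<And>z. 0 \<le> u z"
      and ss: "supersol \<beta> \<Lambda> e (ball 0 D) u" and u1: "\<And>z. z \<in> ball 0 r \<Longrightarrow> 1 \<le> u z" and x: "x \<in> ball 0 \<rho>"
    have "q * (e * e) \<le> q * (1 / (2 * q) * 1)" using e q0 by (intro mult_left_mono mult_mono) (auto simp: e0_def)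
    then have qe: "q * e\<^sup>2 \<le> 1/2" using q0 by (simp add: power2_eq_square)
    define \<phi> where "\<phi> = (\<lambda>z::'a. exp (- q * (norm z)\<^sup>2) + - eD)"
    have \<phi>1: "\<phi> z \<le> 1" for z using q0 by (simp add: \<phi>_def eD_def) (smt (verit) exp_ge_zero exp_le_one_iff mult_nonneg_nonneg zero_le_power2)
    have \<phi>_bdd: "loc_bdd \<phi>" unfolding \<phi>_def by (intro loc_bdd_continuous continuous_intros)
    have main: "\<phi> z \<le> u z" for z
    proof (rule ccontr)
      assume "\<not> \<phi> z \<le> u z"
      \<comment> \<open>The error must be smaller than the violation, so that the near-minimum is
        still negative, and smaller than the margin of the barrier, which is at least
        \<open>q * e^2 * eD\<close> inside \<open>ball 0 D\<close>.\<close>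
      define d where "d = min ((\<phi> z - u z) / 2) (q * e\<^sup>2 * eD / 2)"
      have d: "0 < d" "d < \<phi> z - u z" "d < q * e\<^sup>2 * eD"
        using \<open>\<not> \<phi> z \<le> u z\<close> q0 e by (auto simp: d_def eD_def min_less_iff_disj)
      \<comment> \<open>The shift by 1 makes the function nonnegative, because the barrier is at
        most 1; the lower bound for the difference itself is \<open>k - 1\<close>.\<close>
      obtain y k where k: "\<And>z. k \<le> u z - \<phi> z + 1" and y: "u y - \<phi> y + 1 \<le> k + d"
      proof (rule approx_minimizer[of "\<lambda>z. u z - \<phi> z + 1" d])
        show "0 \<le> u z - \<phi> z + 1" for z using u(2)[of z] \<phi>1[of z] by linarith
      qed (use d in auto)
      have neg: "u y < \<phi> y" using y k[of z] d by linarith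
      have ry: "r \<le> norm y" using u1[of y] \<phi>1[of y] neg by (force simp: dist_norm)
      have yD: "y \<in> ball 0 D"
      proof (rule ccontr)
        assume "y \<notin> ball 0 D"
        then have "D\<^sup>2 \<le> (norm y)\<^sup>2" using r by (intro power_mono) (auto simp: dist_norm)
        then have "\<phi> y \<le> 0" using q0 by (simp add: \<phi>_def eD_def)
        then show False using neg u(2)[of y] by linarith
      qed
      obtain m where m: "\<And>h. norm h < \<Lambda> \<Longrightarrow> 2 * m \<le> \<phi> (y + e *\<^sub>R h) + \<phi> (y - e *\<^sub>R h)"
        and gap: "\<phi> y + q * e\<^sup>2 * exp (- q * (norm y)\<^sup>2) \<le> (1 - \<beta>) * m + \<beta> * ball_avg \<phi> y e"
        using barrier_strict[OF \<beta> r(1) ry e(1) q_def qe \<phi>_def] by blast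
      have "(1 - \<beta>) * (m + (k - 1)) + \<beta> * ball_avg u y e \<le> u y"
      proof (rule supersolD[OF ss yD])
        fix h :: 'a assume h: "norm h < \<Lambda>"
        show "2 * (m + (k - 1)) \<le> u (y + e *\<^sub>R h) + u (y - e *\<^sub>R h)"
          using add_mono[OF k[of "y + e *\<^sub>R h"] k[of "y - e *\<^sub>R h"]] m[OF h] by (simp add: algebra_simps)
      qed
      moreover have "ball_avg (\<lambda>z. \<phi> z + (k - 1)) y e \<le> ball_avg u y e"
        by (intro ball_avg_mono loc_bdd_add \<phi>_bdd loc_bdd_const u e) (smt (verit) k)
      then have "ball_avg \<phi> y e + (k - 1) \<le> ball_avg u y e"
        by (simp only: ball_avg_add[OF \<phi>_bdd loc_bdd_const] ball_avg_const)
      then have "\<beta> * (ball_avg \<phi> y e + (k - 1)) \<le> \<beta> * ball_avg u y e" using \<beta> by simp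
      ultimately have "(1 - \<beta>) * m + \<beta> * ball_avg \<phi> y e + (k - 1) \<le> u y" by (simp add: algebra_simps)
      moreover have "eD \<le> exp (- q * (norm y)\<^sup>2)"
        using yD q0 by (simp add: eD_def dist_norm power_mono)
      then have "q * e\<^sup>2 * eD \<le> q * e\<^sup>2 * exp (- q * (norm y)\<^sup>2)" using q0 by (intro mult_left_mono) auto
      ultimately show False using gap y d by linarith
    qed
    have "(norm x)\<^sup>2 \<le> \<rho>\<^sup>2" using x by (simp add: dist_norm power_mono)
    then have "c \<le> \<phi> x" using q0 by (simp add: c_def \<phi>_def)
    then show "c \<le> u x" using main[of x] by linarith
  qed
qed

section \<open>Cubes and propagation at the smallest scale\<close>

text \<open>Half-open, so that the dyadic children partition their parent exactly; \<open>a\<close>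
  is the corner with the smallest coordinates.\<close>

definition cube :: "'a::euclidean_space \<Rightarrow> real \<Rightarrow> 'a set" where
  "cube a l = {x. \<forall>b\<in>Basis. a \<bullet> b \<le> x \<bullet> b \<and> x \<bullet> b < a \<bullet> b + l}"

definition cube_center :: "'a::euclidean_space \<Rightarrow> real \<Rightarrow> 'a" where
  "cube_center a l = a + (l/2) *\<^sub>R One"

lemma sets_cube: "cube a l \<in> sets borel"
  unfolding cube_def by measurable

lemma cube_center_inner: "b \<in> Basis \<Longrightarrow> cube_center a l \<bullet> b = a \<bullet> b + l/2"
  by (simp add: cube_center_def inner_add_left)

lemma norm_le_DIM:
  fixes x :: "'a::euclidean_space" and d :: real
  assumes "\<And>b. b \<in> Basis \<Longrightarrow> \<bar>x \<bullet> b\<bar> \<le> d" shows "norm x \<le> DIM('a) * d"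
proof -
  have "norm x \<le> (\<Sum>b\<in>Basis. \<bar>x \<bullet> b\<bar>)" by (rule norm_le_l1)
  also have "\<dots> \<le> DIM('a) * d" using assms by (intro sum_bounded_above) auto
  finally show ?thesis .
qed

lemma ball_subset_cube: "ball (cube_center a l) (l/2) \<subseteq> cube a l"
proof
  fix x assume x: "x \<in> ball (cube_center a l) (l/2)"
  have "a \<bullet> b \<le> x \<bullet> b \<and> x \<bullet> b < a \<bullet> b + l" if b: "b \<in> Basis" for b
  proof -
    have "\<bar>(x - cube_center a l) \<bullet> b\<bar> < l/2"
      using Basis_le_norm[OF b, of "x - cube_center a l"] x by (simp add: dist_norm norm_minus_commute)
    then show ?thesis using b by (simp only: inner_diff_left cube_center_inner abs_less_iff) linarith
  qed
  then show "x \<in> cube a l" by (simp add: cube_def)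
qed

lemma cube_subset_cball: "cube (a::'a::euclidean_space) l \<subseteq> cball (cube_center a l) (DIM('a) * (l/2))"
proof
  fix x assume x: "x \<in> cube a l"
  have "norm (x - cube_center a l) \<le> DIM('a) * (l/2)"
  proof (rule norm_le_DIM)
    fix b :: 'a assume b: "b \<in> Basis"
    then have "a \<bullet> b \<le> x \<bullet> b \<and> x \<bullet> b < a \<bullet> b + l" using x by (simp add: cube_def)
    then show "\<bar>(x - cube_center a l) \<bullet> b\<bar> \<le> l/2"
      unfolding inner_diff_left cube_center_inner[OF b] abs_le_iff by linarith
  qed
  then show "x \<in> cball (cube_center a l) (DIM('a) * (l/2))" by (simp add: dist_norm norm_minus_commute)
qed

lemma fmeasurable_cube: "cube a l \<in> fmeasurable lborel"
  by (rule fmeasurableI2[OF fmeasurable_cball cube_subset_cball]) (simp add: sets_cube)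

lemma measure_cube:
  fixes a :: "'a::euclidean_space"
  assumes "0 \<le> l" shows "measure lborel (cube a l) = l ^ DIM('a)"
proof (rule antisym)
  have c: "measure lborel (cbox a (a + l *\<^sub>R One)) = l ^ DIM('a)"
    "measure lborel (box a (a + l *\<^sub>R One)) = l ^ DIM('a)"
    using assms by (simp_all add: measure_lborel_cbox_eq measure_lborel_box_eq inner_add_left inner_diff_left)
  show "measure lborel (cube a l) \<le> l ^ DIM('a)"
    unfolding c(1)[symmetric]
    by (intro measure_mono_fmeasurable) (auto simp: cube_def mem_box inner_add_left sets_cube less_imp_le)
  show "l ^ DIM('a) \<le> measure lborel (cube a l)"
    unfolding c(2)[symmetric]
    by (intro measure_mono_fmeasurable fmeasurable_cube) (auto simp: cube_def mem_box inner_add_left intro: less_imp_le)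
qed

text \<open>Subsets of the basis encode the 0-1 vectors, which are the offsets of the dyadic
  children in units of their side.\<close>

lemma sum_Basis_subset_inner:
  fixes b :: "'a::euclidean_space"
  assumes "S \<subseteq> Basis" "b \<in> Basis" shows "(\<Sum>S) \<bullet> b = (if b \<in> S then 1 else 0)"
proof -
  have fin: "finite S" using assms(1) finite_Basis by (rule finite_subset)
  have "(\<Sum>S) \<bullet> b = (\<Sum>i\<in>S. i \<bullet> b)" by (simp add: inner_sum_left)
  also have "\<dots> = (\<Sum>i\<in>S. if i = b then 1 else 0)"
    using assms by (intro sum.cong) (auto simp: inner_Basis)
  also have "\<dots> = (if b \<in> S then 1 else 0)" using fin by (simp add: sum.delta)
  finally show ?thesis .
qed

lemma cube_split:
  fixes a :: "'a::euclidean_space"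
  assumes "0 < l" shows "cube a (2 * l) = (\<Union>S\<in>Pow Basis. cube (a + l *\<^sub>R \<Sum>S) l)"
proof (intro equalityI subsetI)
  fix x assume x: "x \<in> cube a (2 * l)"
  define S where "S = {b\<in>Basis. a \<bullet> b + l \<le> x \<bullet> b}"
  have S: "S \<subseteq> Basis" by (auto simp: S_def)
  have "x \<in> cube (a + l *\<^sub>R \<Sum>S) l"
    using x sum_Basis_subset_inner[OF S] by (auto simp: cube_def inner_add_left) (auto simp: S_def)
  then show "x \<in> (\<Union>S\<in>Pow Basis. cube (a + l *\<^sub>R \<Sum>S) l)" using S by auto
next
  fix x assume "x \<in> (\<Union>S\<in>Pow Basis. cube (a + l *\<^sub>R \<Sum>S) l)"
  then obtain S where S: "S \<subseteq> Basis" and x: "x \<in> cube (a + l *\<^sub>R \<Sum>S) l" by auto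
  show "x \<in> cube a (2 * l)"
    unfolding cube_def
  proof (intro CollectI ballI)
    fix b :: 'a assume b: "b \<in> Basis"
    then show "a \<bullet> b \<le> x \<bullet> b \<and> x \<bullet> b < a \<bullet> b + 2 * l"
      using x sum_Basis_subset_inner[OF S b] assms by (auto simp: cube_def inner_add_left split: if_splits)
  qed
qed

lemma cube_split_disjoint:
  fixes a :: "'a::euclidean_space"
  assumes "S \<subseteq> Basis" "T \<subseteq> Basis" "S \<noteq> T"
  shows "cube (a + l *\<^sub>R \<Sum>S) l \<inter> cube (a + l *\<^sub>R \<Sum>T) l = {}"
proof -
  obtain b where b: "b \<in> Basis" "(b \<in> S) \<noteq> (b \<in> T)" using assms by blast
  show ?thesis
    using b sum_Basis_subset_inner[OF assms(1) b(1)] sum_Basis_subset_inner[OF assms(2) b(1)]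
    by (force simp: cube_def inner_add_left)
qed

lemma supersol_ge_avg:
  assumes "0 < \<beta>" "\<beta> \<le> 1" "supersol \<beta> \<Lambda> e D u" "x \<in> D" "\<And>z. 0 \<le> u z"
  shows "\<beta> * ball_avg u x e \<le> u x"
  using supersolD[OF assms(3,4), of 0] assms(5) by (simp add: add_nonneg_nonneg)

lemma supersol_ge_measure:
  fixes u :: "'a::euclidean_space \<Rightarrow> real"
  assumes \<beta>: "0 < \<beta>" "\<beta> \<le> 1" and ss: "supersol \<beta> \<Lambda> e D u" and u: "loc_bdd u" "\<And>z. 0 \<le> u z"
    and x: "x \<in> D" and e: "0 < e" and t: "0 \<le> t" and d: "0 \<le> d" "d \<le> measure lborel E"
    and E: "E \<in> sets borel" "E \<subseteq> ball x e" "\<And>y. y \<in> E \<Longrightarrow> t \<le> u y"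
  shows "\<beta> * (d / (unit_ball_vol (DIM('a)) * e ^ DIM('a))) * t \<le> u x"
proof -
  have "t * d / (unit_ball_vol (DIM('a)) * e ^ DIM('a)) \<le> t * measure lborel E / (unit_ball_vol (DIM('a)) * e ^ DIM('a))"
    using t d e by (intro divide_right_mono mult_left_mono) auto
  also have "\<dots> \<le> ball_avg u x e"
    using ball_avg_ge_measure[OF u(1) u(2) e t E] e by (simp add: content_ball)
  finally have "\<beta> * (t * d / (unit_ball_vol (DIM('a)) * e ^ DIM('a))) \<le> \<beta> * ball_avg u x e"
    by (rule mult_left_mono) (use \<beta> in simp)
  also have "\<dots> \<le> u x" by (rule supersol_ge_avg[OF \<beta> ss x u(2)])
  finally show ?thesis by (simp add: mult_ac)
qed

text \<open>Pigeonhole yields a ball of radius 1/4 that carries mass, from which averaging gains 1/4 in radius per step.\<close>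

lemma unit_scale_lower_bound:
  fixes \<beta> \<Lambda> K \<eta> :: real
  assumes \<beta>: "0 < \<beta>" "\<beta> \<le> 1" and K: "1 \<le> K" and \<eta>: "0 < \<eta>"
  obtains c where "0 < c"
    "\<And>u t E x. \<lbrakk>loc_bdd (u :: 'a::euclidean_space \<Rightarrow> real); \<And>z. 0 \<le> u z;
      supersol \<beta> \<Lambda> 1 (ball 0 (4 * K)) u; E \<in> sets borel; E \<subseteq> cball 0 K; \<eta> \<le> measure lborel E; 0 < t;
      \<And>y. y \<in> E \<Longrightarrow> t \<le> u y; x \<in> cball 0 K\<rbrakk> \<Longrightarrow> c * t \<le> u x"
proof -
  define \<omega> where "\<omega> = unit_ball_vol (real DIM('a))"
  have \<omega>: "\<omega> > 0" by (simp add: \<omega>_def)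
  have "compact (cball (0::'a) K)" by simp
  then obtain F where F: "F \<subseteq> cball (0::'a) K" "finite F" "cball 0 K \<subseteq> (\<Union>p\<in>F. ball p (1/4))"
    by (rule compactE_image[of _ "cball 0 K" "\<lambda>p. ball p (1/4)"]) auto
  have F0: "card F > 0" using F K by (auto simp: card_gt_0_iff)
  define d where "d = \<eta> / card F"
  have d: "0 < d" using \<eta> F0 by (simp add: d_def)
  \<comment> \<open>After \<open>k\<close> steps the bound reaches distance 1/2 + k/4 from
    \<open>p\<close>, and two points of the ball of radius \<open>K\<close> are at most
    \<open>2 * K\<close> apart. The factor \<open>s\<close> lost per step is \<beta> times the
    relative volume of a ball of radius 1/4 in a unit ball.\<close>
  define n where "n = nat \<lceil>8 * K\<rceil>"
  define s where "s = \<beta> * (1/4) ^ DIM('a)"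
  define c where "c = \<beta> * (d / \<omega>) * s ^ n"
  show ?thesis
  proof (rule that[of c])
    show "0 < c" using \<beta> d \<omega> by (simp add: c_def s_def)
    fix u :: "'a \<Rightarrow> real" and t E and x :: 'a
    assume u: "loc_bdd u" "\<And>z. 0 \<le> u z" and ss: "supersol \<beta> \<Lambda> 1 (ball 0 (4 * K)) u"
      and E: "E \<in> sets borel" "E \<subseteq> cball 0 K" "\<eta> \<le> measure lborel E" and t: "0 < t"
      and uE: "\<And>y. y \<in> E \<Longrightarrow> t \<le> u y" and x: "x \<in> cball 0 K"
    have "\<exists>p\<in>F. d \<le> measure lborel (E \<inter> ball p (1/4))"
    proof (rule ccontr)
      assume n: "\<not> ?thesis"
      have "measure lborel E \<le> measure lborel (\<Union>p\<in>F. E \<inter> ball p (1/4))"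
        using E F by (intro measure_mono_fmeasurable fmeasurable.finite_UN)
          (auto intro!: fmeasurableI2[OF fmeasurable_ball])
      also have "\<dots> \<le> (\<Sum>p\<in>F. measure lborel (E \<inter> ball p (1/4)))"
        using F E by (intro measure_UNION_le) auto
      also have "\<dots> < (\<Sum>p\<in>F. d)" using n F F0 by (intro sum_strict_mono) (auto simp: not_le)
      also have "\<dots> = \<eta>" using F0 by (simp add: d_def)
      finally show False using E by simp
    qed
    then obtain p where p: "p \<in> F" "d \<le> measure lborel (E \<inter> ball p (1/4))" by blast
    have np: "norm p \<le> K" using p F by auto
    have chain: "\<beta> * (d / \<omega>) * t * s ^ k \<le> u y" if "k \<le> n" "dist p y \<le> 1/2 + k/4" for k y
      using that
    proof (induction k arbitrary: y)
      case 0
      have "y \<in> ball 0 (4 * K)" using 0 np K norm_triangle_sub[of y p] by (simp add: dist_norm norm_minus_commute)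
      moreover have "E \<inter> ball p (1/4) \<subseteq> ball y 1"
      proof
        fix z assume "z \<in> E \<inter> ball p (1/4)"
        then have "dist y p + dist p z < 1/2 + 1/4" using 0 by (intro add_le_less_mono) (auto simp: dist_commute)
        then show "z \<in> ball y 1" using dist_triangle[of y z p] by simp
      qed
      ultimately have "\<beta> * (d / (\<omega> * 1 ^ DIM('a))) * t \<le> u y" unfolding \<omega>_def
        by (intro supersol_ge_measure[OF \<beta> ss u _ _ _ _ p(2)]) (use t d E uE in auto)
      then show ?case by simp
    next
      case (Suc k)
      have kn: "real k < 8 * K" using Suc.prems(1) unfolding n_def by linarith
      \<comment> \<open>This puts \<open>q\<close> on the segment from \<open>p\<close> to
        \<open>y\<close>, within (1 + k)/4 of \<open>p\<close> and 1/2 of \<open>y\<close>. The ball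
        of radius 1/4 around \<open>q\<close> then lies both in the region already reached and in
        the averaging ball of \<open>y\<close>.\<close>
      define \<theta> where "\<theta> = (1 + real k) / (3 + real k)"
      define q where "q = p + \<theta> *\<^sub>R (y - p)"
      have D: "norm (y - p) \<le> (3 + real k) / 4" using Suc.prems(2) by (simp add: dist_norm norm_minus_commute field_simps)
      have \<theta>: "0 \<le> \<theta>" "\<theta> \<le> 1" "1 - \<theta> = 2 / (3 + real k)" by (simp_all add: \<theta>_def field_simps)
      have "norm (q - p) = \<theta> * norm (y - p)" using \<theta> by (simp add: q_def)
      also have "\<dots> \<le> \<theta> * ((3 + real k) / 4)" using \<theta> D by (intro mult_left_mono) auto
      also have "\<dots> = (1 + real k) / 4" by (simp add: \<theta>_def)
      finally have qp: "norm (q - p) \<le> (1 + real k) / 4" .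
      have "y - q = (1 - \<theta>) *\<^sub>R (y - p)" by (simp add: q_def algebra_simps)
      then have "norm (y - q) = (1 - \<theta>) * norm (y - p)" using \<theta> by simp
      also have "\<dots> \<le> (1 - \<theta>) * ((3 + real k) / 4)" using \<theta> D by (intro mult_left_mono) auto
      also have "\<dots> = 1/2" by (simp add: \<theta>(3) field_simps)
      finally have yq: "norm (y - q) \<le> 1/2" .
      have yD: "y \<in> ball 0 (4 * K)"
        using D np K kn norm_triangle_sub[of y p] by (simp add: dist_norm)
      have "\<beta> * ((\<omega> * (1/4) ^ DIM('a)) / (\<omega> * 1 ^ DIM('a))) * (\<beta> * (d / \<omega>) * t * s ^ k) \<le> u y"
        unfolding \<omega>_def
      proof (rule supersol_ge_measure[OF \<beta> ss u yD, where E="ball q (1/4)"])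
        show "ball q (1/4) \<subseteq> ball y 1"
        proof
          fix z assume "z \<in> ball q (1/4)"
          then have "dist q z < 1/4" by simp
          then show "z \<in> ball y 1" using yq dist_triangle[of y z q] by (simp add: dist_norm)
        qed
        fix z assume "z \<in> ball q (1/4)"
        then have "dist q z < 1/4" by simp
        then have "dist p z \<le> 1/2 + k/4" using qp dist_triangle[of p z q] by (simp add: dist_norm norm_minus_commute field_simps)
        then show "\<beta> * (d / unit_ball_vol (real DIM('a))) * t * s ^ k \<le> u z"
          using Suc.IH Suc.prems(1) unfolding \<omega>_def by simp
      qed (use \<beta> d t \<omega> in \<open>auto simp: content_ball s_def \<omega>_def\<close>)
      then show ?case using \<omega> by (simp add: s_def mult_ac)
    qed
    have "dist p x \<le> 2 * K" using x np norm_triangle_ineq4[of p x] by (simp add: dist_norm)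
    also have "\<dots> \<le> 1/2 + real n / 4" unfolding n_def by linarith
    finally have "\<beta> * (d / \<omega>) * t * s ^ n \<le> u x" by (intro chain) auto
    then show "c * t \<le> u x" by (simp add: c_def mult_ac)
  qed
qed

section \<open>Dyadic decomposition\<close>

lemma rescaled_supersol:
  fixes u :: "'a::euclidean_space \<Rightarrow> real"
  assumes "supersol \<beta> \<Lambda> e (ball z r) u" "loc_bdd u" "\<And>x. 0 \<le> u x" "0 < s" "0 < c" "s * r' \<le> r"
  defines "v \<equiv> \<lambda>y. c * u (z + s *\<^sub>R y)"
  shows "loc_bdd v" "\<And>y. 0 \<le> v y" "supersol \<beta> \<Lambda> (e / s) (ball 0 r') v"
proof -
  show "loc_bdd v" unfolding v_def by (intro loc_bdd_cmult loc_bdd_affine assms)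
  show "\<And>y. 0 \<le> v y" using assms(3,5) by (simp add: v_def)
  have "supersol \<beta> \<Lambda> e (ball z (s * r')) u"
    by (rule supersol_subset[OF assms(1)]) (rule subset_ball[OF assms(6)])
  then show "supersol \<beta> \<Lambda> (e / s) (ball 0 r') v"
    unfolding v_def by (intro supersol_cmult supersol_affine assms)
qed

text \<open>The sublevel estimate is used in contrapositive form: a value at most
  \<open>t / 4\<close> near the centre would make \<open>{u < t}\<close> too large a part of the
  cube. The barrier then carries \<open>t / 4\<close> from radius \<open>l / 4\<close> to radius
  \<open>3 * N * l\<close>, which covers the dyadic parent whichever child the cube is.\<close>

lemma dense_cube_lower_bound:
  fixes \<beta> \<Lambda> :: real
  assumes \<beta>: "0 < \<beta>" "\<beta> \<le> 1"
  obtains e0 \<mu> c :: real where "0 < e0" "0 < \<mu>" "\<mu> \<le> 1/2" "0 < c"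
    "\<And>e a (l::real) u t x. \<lbrakk>0 < e; e \<le> e0 * l; 0 < l; loc_bdd (u :: 'a::euclidean_space \<Rightarrow> real); \<And>z. 0 \<le> u z;
      supersol \<beta> \<Lambda> e (ball (cube_center a l) (4 * real DIM('a) * l)) u; 0 < t;
      (1 - \<mu>) * l ^ DIM('a) < measure lborel (cube a l \<inter> {z. t \<le> u z});
      x \<in> ball (cube_center a l) (3 * real DIM('a) * l)\<rbrakk> \<Longrightarrow> c * t \<le> u x"
proof -
  let ?N = "real DIM('a)"
  have N: "1 \<le> ?N" by (simp add: Suc_leI)
  obtain e1 \<mu>1 where e1: "0 < e1" and \<mu>1: "0 < \<mu>1"
    and S: "\<And>e u x. \<lbrakk>0 < e; e \<le> e1; loc_bdd (u :: 'a \<Rightarrow> real); \<And>z. 0 \<le> u z;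
      supersol \<beta> \<Lambda> e (ball 0 1) u; x \<in> ball 0 (1/2); u x \<le> 1/4\<rbrakk>
      \<Longrightarrow> \<mu>1 \<le> measure lborel {z\<in>ball 0 1. u z < 1}"
    using sublevel_measure[OF \<beta>, of \<Lambda>, where 'a='a] by blast
  obtain e2 c2 where e2: "0 < e2" and c2: "0 < c2"
    and B: "\<And>e u x. \<lbrakk>0 < e; e \<le> e2; loc_bdd (u :: 'a \<Rightarrow> real); \<And>z. 0 \<le> u z;
      supersol \<beta> \<Lambda> e (ball 0 (4 * ?N)) u; \<And>z. z \<in> ball 0 (1/4) \<Longrightarrow> 1 \<le> u z; x \<in> ball 0 (3 * ?N)\<rbrakk>
      \<Longrightarrow> c2 \<le> u x"
    using barrier_lower_bound[OF \<beta>, of "1/4" "3 * ?N" "4 * ?N" \<Lambda>, where 'a='a] N by auto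
  \<comment> \<open>The power of 1/2 comes from rescaling the inscribed ball of radius
    \<open>l/2\<close> to the unit ball; the cap 1/2 serves the growth argument for
    densities.\<close>
  define \<mu> where "\<mu> = min (1/2) (\<mu>1 * (1/2) ^ DIM('a))"
  show ?thesis
  \<comment> \<open>Rescaling by \<open>l/2\<close> turns \<open>e\<close> into
    \<open>2 * e / l\<close>, hence the half of \<open>e1\<close>.\<close>
  proof (rule that[of "min (e1/2) e2" \<mu> "c2 / 4"])
    show "0 < min (e1/2) e2" "0 < \<mu>" "\<mu> \<le> 1/2" "0 < c2/4" using e1 e2 c2 \<mu>1 by (simp_all add: \<mu>_def)
    fix e l t and u :: "'a \<Rightarrow> real" and a x :: 'a
    assume e: "0 < e" "e \<le> min (e1/2) e2 * l" and l: "0 < l" and u: "loc_bdd u" "\<And>z. 0 \<le> u z"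
      and ss: "supersol \<beta> \<Lambda> e (ball (cube_center a l) (4 * ?N * l)) u" and t: "0 < t"
      and dense: "(1 - \<mu>) * l ^ DIM('a) < measure lborel (cube a l \<inter> {z. t \<le> u z})"
      and x: "x \<in> ball (cube_center a l) (3 * ?N * l)"
    have [measurable]: "u \<in> borel_measurable borel" using u(1) by (rule loc_bdd_measurable)
    define z where "z = cube_center a l"
    have "min (e1/2) e2 * l \<le> (e1/2) * l" "min (e1/2) e2 * l \<le> e2 * l"
      using l by (intro mult_right_mono; simp)+
    then have el: "e \<le> e1/2 * l" "e \<le> e2 * l" using e(2) by linarith+
    have Nl: "l \<le> ?N * l" using N l by simp
    define v where "v = (\<lambda>y. (1/t) * u (z + (l/2) *\<^sub>R y))"
    have "0 < l/2" "0 < 1/t" "l/2 * 1 \<le> 4 * ?N * l" using Nl l t by (simp, simp, linarith)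
    note v_facts = rescaled_supersol[OF ss[folded z_def] u this]
    have v: "loc_bdd v" "\<And>y. 0 \<le> v y" "supersol \<beta> \<Lambda> (e / (l/2)) (ball 0 1) v"
      unfolding v_def by (fact v_facts)+
    have quarter: "t / 4 < u y" if y: "y \<in> ball z (l/4)" for y
    proof (rule ccontr)
      assume n: "\<not> t / 4 < u y"
      define y' where "y' = (2/l) *\<^sub>R (y - z)"
      have y': "z + (l/2) *\<^sub>R y' = y" using l by (simp add: y'_def)
      have "\<mu>1 \<le> measure lborel {w\<in>ball 0 1. v w < 1}"
      proof (rule S[OF _ _ v])
        have "norm y' = (2/l) * norm (y - z)" unfolding y'_def norm_scaleR using l by simp
        moreover have "(2/l) * norm (y - z) < (2/l) * (l/4)"
          using y l by (intro mult_strict_left_mono) (auto simp: dist_norm norm_minus_commute)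
        ultimately show "y' \<in> ball 0 (1/2)" using l by (simp add: dist_norm)
        show "v y' \<le> 1/4" using n t y' by (simp add: v_def field_simps)
        show "0 < e / (l/2)" "e / (l/2) \<le> e1" using e l el by (simp_all add: field_simps)
      qed
      moreover have "measure lborel {w\<in>ball z (l/2). u w < t} = (l/2) ^ DIM('a) * measure lborel {w\<in>ball 0 1. v w < 1}"
      proof -
        have "(\<lambda>h. z + (l/2) *\<^sub>R h) -` {w\<in>ball z (l/2). u w < t} = {w\<in>ball 0 1. v w < 1}"
          using l t by (auto simp: v_def dist_norm field_simps)
        then show ?thesis using l
          by (subst measure_lborel_affine[of "l/2" _ z]) auto
      qed
      ultimately have "(l/2) ^ DIM('a) * \<mu>1 \<le> measure lborel {w\<in>ball z (l/2). u w < t}" using l by simp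
      moreover have "\<mu> * l ^ DIM('a) \<le> \<mu>1 * (1/2) ^ DIM('a) * l ^ DIM('a)"
        using l by (intro mult_right_mono) (auto simp: \<mu>_def)
      then have "\<mu> * l ^ DIM('a) \<le> (l/2) ^ DIM('a) * \<mu>1" by (simp add: power_divide field_simps)
      ultimately have "\<mu> * l ^ DIM('a) \<le> measure lborel {w\<in>ball z (l/2). u w < t}" by linarith
      also have "\<dots> \<le> measure lborel (cube a l - (cube a l \<inter> {z. t \<le> u z}))"
      proof (rule measure_mono_fmeasurable)
        show "{w \<in> ball z (l/2). u w < t} \<subseteq> cube a l - (cube a l \<inter> {z. t \<le> u z})"
          using ball_subset_cube[of a l] by (auto simp: z_def)
        have "cube a l \<inter> {z. t \<le> u z} \<in> sets borel" using sets_cube[of a l] by auto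
        then show "cube a l - (cube a l \<inter> {z. t \<le> u z}) \<in> fmeasurable lborel"
          by (intro fmeasurable_Diff fmeasurable_cube) auto
      qed auto
      also have "\<dots> = l ^ DIM('a) - measure lborel (cube a l \<inter> {z. t \<le> u z})"
        using l sets_cube[of a l]
        by (subst measurable_measure_Diff) (auto simp: measure_cube fmeasurable_cube)
      finally show False using dense by (simp add: algebra_simps)
    qed
    define w where "w = (\<lambda>y. (4/t) * u (z + l *\<^sub>R y))"
    have "0 < l" "0 < 4/t" "l * (4 * ?N) \<le> 4 * ?N * l" using l t by simp_all
    note w_facts = rescaled_supersol[OF ss[folded z_def] u this]
    have w: "loc_bdd w" "\<And>y. 0 \<le> w y" "supersol \<beta> \<Lambda> (e / l) (ball 0 (4 * ?N)) w"
      unfolding w_def by (fact w_facts)+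
    have "c2 \<le> w ((1/l) *\<^sub>R (x - z))"
    proof (rule B[OF _ _ w])
      show "0 < e / l" "e / l \<le> e2" using e l el by (simp_all add: field_simps)
      have "norm ((1/l) *\<^sub>R (x - z)) = (1/l) * norm (x - z)" unfolding norm_scaleR using l by simp
      then show "(1/l) *\<^sub>R (x - z) \<in> ball 0 (3 * ?N)"
        using x l by (simp add: z_def dist_norm norm_minus_commute pos_divide_less_eq)
      fix y :: 'a assume "y \<in> ball 0 (1/4)"
      then have "z + l *\<^sub>R y \<in> ball z (l/4)" using l by (simp add: dist_norm field_simps)
      then have "t/4 < u (z + l *\<^sub>R y)" by (rule quarter)
      then show "1 \<le> w y" using t by (simp add: w_def field_simps)
    qed
    then show "c2 / 4 * t \<le> u x" using l t by (simp add: w_def field_simps)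
  qed
qed

text \<open>For cubes with side comparable to \<open>e\<close> the number of averaging steps needed
  to cross them is bounded. Any positive density \<eta> is then enough, at the price of a constant
  that depends on it.\<close>

lemma small_cube_lower_bound:
  fixes \<beta> \<Lambda> k1 k2 \<eta> :: real
  assumes \<beta>: "0 < \<beta>" "\<beta> \<le> 1" and k: "0 < k1" and \<eta>: "0 < \<eta>"
  obtains c D where "0 < c" "0 < D"
    "\<And>e a l u t x. \<lbrakk>0 < e; k1 * e \<le> l; l \<le> k2 * e; loc_bdd (u :: 'a::euclidean_space \<Rightarrow> real); \<And>z. 0 \<le> u z;
      supersol \<beta> \<Lambda> e (ball (cube_center a l) (D * e)) u; 0 < t;
      \<eta> * l ^ DIM('a) \<le> measure lborel (cube a l \<inter> {z. t \<le> u z}); x \<in> cube a l\<rbrakk> \<Longrightarrow> c * t \<le> u x"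
proof -
  define K where "K = max 1 (DIM('a) * (k2/2))"
  have K: "1 \<le> K" "DIM('a) * (k2/2) \<le> K" by (simp_all add: K_def)
  have "0 < \<eta> * k1 ^ DIM('a)" using k \<eta> by simp
  then obtain c where c: "0 < c"
    and U: "\<And>u t E x. \<lbrakk>loc_bdd (u :: 'a \<Rightarrow> real); \<And>z. 0 \<le> u z;
      supersol \<beta> \<Lambda> 1 (ball 0 (4 * K)) u; E \<in> sets borel; E \<subseteq> cball 0 K; \<eta> * k1 ^ DIM('a) \<le> measure lborel E; 0 < t;
      \<And>y. y \<in> E \<Longrightarrow> t \<le> u y; x \<in> cball 0 K\<rbrakk> \<Longrightarrow> c * t \<le> u x"
    using unit_scale_lower_bound[OF \<beta> K(1), of "\<eta> * k1 ^ DIM('a)" \<Lambda>, where 'a='a] by blast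
  show ?thesis
  proof (rule that[of c "4 * K"])
    show "0 < c" "0 < 4 * K" using c K by simp_all
    fix e l t and u :: "'a \<Rightarrow> real" and a x :: 'a
    assume e: "0 < e" "k1 * e \<le> l" "l \<le> k2 * e" and u: "loc_bdd u" "\<And>z. 0 \<le> u z"
      and ss: "supersol \<beta> \<Lambda> e (ball (cube_center a l) (4 * K * e)) u" and t: "0 < t"
      and dense: "\<eta> * l ^ DIM('a) \<le> measure lborel (cube a l \<inter> {z. t \<le> u z})" and x: "x \<in> cube a l"
    have [measurable]: "u \<in> borel_measurable borel" using u(1) by (rule loc_bdd_measurable)
    define z where "z = cube_center a l"
    define v where "v = (\<lambda>y. 1 * u (z + e *\<^sub>R y))"
    have "0 < e" "(0::real) < 1" "e * (4 * K) \<le> 4 * K * e" using e by simp_all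
    note v_facts = rescaled_supersol[OF ss[folded z_def] u this]
    have v: "loc_bdd v" "\<And>y. 0 \<le> v y" "supersol \<beta> \<Lambda> (e / e) (ball 0 (4 * K)) v"
      unfolding v_def by (fact v_facts)+
    let ?E = "cube a l \<inter> {z. t \<le> u z}" and ?T = "\<lambda>y. z + e *\<^sub>R y"
    have E: "?E \<in> sets borel" using sets_cube[of a l] by auto
    have l: "0 < l" using e k by (meson less_le_trans mult_pos_pos)
    have in_ball: "y \<in> cball 0 K" if "?T y \<in> cube a l" for y
    proof -
      have "e * norm y \<le> DIM('a) * (l/2)"
        using subsetD[OF cube_subset_cball that] e by (simp add: z_def dist_norm)
      also have "\<dots> \<le> DIM('a) * (k2 * e / 2)" using e by (intro mult_left_mono) auto
      also have "\<dots> = e * (DIM('a) * (k2/2))" by simp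
      also have "\<dots> \<le> e * K" using K e by (intro mult_left_mono) auto
      finally show ?thesis using e by simp
    qed
    define y where "y = (1/e) *\<^sub>R (x - z)"
    have y: "?T y = x" using e by (simp add: y_def)
    have "c * t \<le> v y"
    proof (rule U[where E="?T -` ?E"])
      show "supersol \<beta> \<Lambda> 1 (ball 0 (4 * K)) v" using v(3) e by simp
      show "?T -` ?E \<in> sets borel" using measurable_sets_borel[of ?T borel ?E] E by simp
      show "?T -` ?E \<subseteq> cball 0 K" using in_ball by blast
      have "\<eta> * k1 ^ DIM('a) * e ^ DIM('a) = \<eta> * (k1 * e) ^ DIM('a)" by (simp add: power_mult_distrib)
      also have "\<dots> \<le> \<eta> * l ^ DIM('a)" using e k \<eta> by (intro mult_left_mono power_mono) auto
      also have "\<dots> \<le> e ^ DIM('a) * measure lborel (?T -` ?E)"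
        using dense measure_lborel_affine[OF _ E, of e z] e by simp
      finally show "\<eta> * k1 ^ DIM('a) \<le> measure lborel (?T -` ?E)" using e by (simp add: mult.commute)
      show "y \<in> cball 0 K" using in_ball[of y] y x by simp
    qed (use v t in \<open>auto simp: v_def\<close>)
    then show "c * t \<le> u x" using y by (simp add: v_def)
  qed
qed

text \<open>The term with \<open>\<eta>\<close> accounts for the cubes of the smallest scale in which \<open>E\<close> is too thin to be propagated.\<close>

lemma calderon_zygmund:
  fixes E F Q :: "'a::euclidean_space set" and \<rho> \<mu> \<eta> :: real
  assumes E: "E \<in> sets borel" and F: "F \<in> sets borel" and \<rho>: "0 < \<rho>" and \<mu>: "\<mu> \<le> 1" and \<eta>: "0 \<le> \<eta>"
    and base: "\<And>a. cube a \<rho> \<subseteq> Q \<Longrightarrow> \<eta> * \<rho> ^ DIM('a) \<le> measure lborel (cube a \<rho> \<inter> E) \<Longrightarrow> cube a \<rho> \<subseteq> F"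
    and step: "\<And>a j S. \<lbrakk>cube a (2 * (2 ^ j * \<rho>)) \<subseteq> Q; S \<subseteq> Basis;
        (1 - \<mu>) * (2 ^ j * \<rho>) ^ DIM('a) < measure lborel (cube (a + (2 ^ j * \<rho>) *\<^sub>R \<Sum>S) (2 ^ j * \<rho>) \<inter> E)\<rbrakk>
        \<Longrightarrow> cube a (2 * (2 ^ j * \<rho>)) \<subseteq> F"
    and Q: "cube a (2 ^ j * \<rho>) \<subseteq> Q"
  shows "(1 - \<mu>) * (2 ^ j * \<rho>) ^ DIM('a) < measure lborel (cube a (2 ^ j * \<rho>) \<inter> E) \<or>
    measure lborel (cube a (2 ^ j * \<rho>) \<inter> E)
      \<le> (1 - \<mu>) * measure lborel (cube a (2 ^ j * \<rho>) \<inter> F) + \<eta> * (2 ^ j * \<rho>) ^ DIM('a)"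
  using Q
\<comment> \<open>Induction from the smallest cubes upward replaces stopping from above: a cube
  either satisfies the bound or is dense, and a dense one is left to its parent.\<close>
proof (induction j arbitrary: a)
  case 0
  show ?case
  proof (cases "\<eta> * \<rho> ^ DIM('a) \<le> measure lborel (cube a \<rho> \<inter> E)")
    case True
    then have "cube a \<rho> \<inter> F = cube a \<rho>" using base[of a] 0 by auto
    then show ?thesis using \<rho> \<eta> by (auto simp: measure_cube not_less intro: add_increasing2)
  next
    case False
    moreover have "0 \<le> (1 - \<mu>) * measure lborel (cube a \<rho> \<inter> F)" using \<mu> by simp
    ultimately show ?thesis by (intro disjI2) simp
  qed
next
  case (Suc j)
  define l where "l = 2 ^ j * \<rho>"
  have l: "0 < l" using \<rho> by (simp add: l_def)
  have l2: "2 ^ Suc j * \<rho> = 2 * l" by (simp add: l_def)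
  let ?m = "\<lambda>A. measure lborel A" and ?C = "\<lambda>S. cube (a + l *\<^sub>R \<Sum>S) l"
  have fin: "finite (Pow (Basis :: 'a set))" by simp
  have split: "?m (cube a (2 * l) \<inter> A) = (\<Sum>S\<in>Pow Basis. ?m (?C S \<inter> A))" if "A \<in> sets borel" for A
  proof -
    have "cube a (2 * l) \<inter> A = (\<Union>S\<in>Pow Basis. ?C S \<inter> A)" using cube_split[OF l, of a] by auto
    moreover have "?m (\<Union>S\<in>Pow Basis. ?C S \<inter> A) = (\<Sum>S\<in>Pow Basis. ?m (?C S \<inter> A))"
    proof (rule measure_UNION'[OF fin])
      show "?C S \<inter> A \<in> fmeasurable lborel" for S
        using that by (intro fmeasurableI2[OF fmeasurable_cube]) (auto simp: sets_cube)
      show "pairwise (\<lambda>S T. disjnt (?C S \<inter> A) (?C T \<inter> A)) (Pow Basis)"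
        using cube_split_disjoint[of _ _ a l] unfolding pairwise_def disjnt_def by blast
    qed
    ultimately show ?thesis by simp
  qed
  have sub: "?C S \<subseteq> Q" if "S \<subseteq> Basis" for S
    using that Suc.prems cube_split[OF l, of a] unfolding l2 by blast
  show ?case unfolding l2
  proof (cases "\<exists>S\<in>Pow Basis. (1 - \<mu>) * l ^ DIM('a) < ?m (?C S \<inter> E)")
    \<comment> \<open>A dense child puts the whole parent into \<open>F\<close>. If the parent is
      not dense itself, its part of \<open>E\<close> has measure at most \<open>1 - \<mu>\<close>
      times its volume, which gives the bound.\<close>
    case True
    then have "cube a (2 * l) \<inter> F = cube a (2 * l)" using step[of a j] Suc.prems unfolding l2 l_def[symmetric] by blast
    then show "(1 - \<mu>) * (2 * l) ^ DIM('a) < ?m (cube a (2 * l) \<inter> E) \<or>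
      ?m (cube a (2 * l) \<inter> E) \<le> (1 - \<mu>) * ?m (cube a (2 * l) \<inter> F) + \<eta> * (2 * l) ^ DIM('a)"
      using l \<eta> by (auto simp: measure_cube not_less intro: add_increasing2)
  next
    case False
    have "?m (cube a (2 * l) \<inter> E) = (\<Sum>S\<in>Pow Basis. ?m (?C S \<inter> E))" by (rule split[OF E])
    also have "\<dots> \<le> (\<Sum>S\<in>Pow Basis. (1 - \<mu>) * ?m (?C S \<inter> F) + \<eta> * l ^ DIM('a))"
    proof (rule sum_mono)
      fix S :: "'a set" assume S: "S \<in> Pow Basis"
      have "(1 - \<mu>) * l ^ DIM('a) < ?m (?C S \<inter> E) \<or> ?m (?C S \<inter> E) \<le> (1 - \<mu>) * ?m (?C S \<inter> F) + \<eta> * l ^ DIM('a)"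
        using Suc.IH[of "a + l *\<^sub>R \<Sum>S"] sub[of S] S unfolding l_def[symmetric] by simp
      then show "?m (?C S \<inter> E) \<le> (1 - \<mu>) * ?m (?C S \<inter> F) + \<eta> * l ^ DIM('a)"
        using False S by blast
    qed
    \<comment> \<open>There are \<open>2^N\<close> children, so the terms with \<eta> add up to
      exactly that of the parent.\<close>
    also have "\<dots> = (1 - \<mu>) * ?m (cube a (2 * l) \<inter> F) + \<eta> * (2 * l) ^ DIM('a)"
      unfolding split[OF F] by (simp add: sum.distrib sum_distrib_left[symmetric] card_Pow power_mult_distrib)
    finally show "(1 - \<mu>) * (2 * l) ^ DIM('a) < ?m (cube a (2 * l) \<inter> E) \<or>
      ?m (cube a (2 * l) \<inter> E) \<le> (1 - \<mu>) * ?m (cube a (2 * l) \<inter> F) + \<eta> * (2 * l) ^ DIM('a)"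
      by blast
  qed
qed

section \<open>From density one half to a pointwise lower bound\<close>

lemma dyadic_scale:
  fixes x :: real
  assumes "0 < x" "x \<le> 1" obtains J where "x \<le> (1/2) ^ J" "(1/2) ^ J \<le> 2 * x"
proof -
  obtain n where n: "(1/2) ^ n < x" using real_arch_pow_inv[OF assms(1), of "1/2"] by auto
  define m where "m = (LEAST m. (1/2) ^ m < x)"
  have m: "(1/2) ^ m < x" unfolding m_def by (rule LeastI) (rule n)
  then have "m \<noteq> 0" using assms(2) by (cases m) auto
  then obtain J where J: "m = Suc J" by (cases m) auto
  have "\<not> (1/2) ^ J < x" using not_less_Least[of J "\<lambda>m. (1/2) ^ m < x"] by (simp add: m_def[symmetric] J)
  then show ?thesis using that[of J] m by (simp add: J)
qed

definition origin_cube :: "'a::euclidean_space set" where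
  "origin_cube = cube (- (1/2) *\<^sub>R One) 1"

lemma cube_center_origin: "cube_center (- (1/2) *\<^sub>R One) 1 = (0 :: 'a::euclidean_space)"
  by (simp add: cube_center_def)

lemma origin_cube_subset: "origin_cube \<subseteq> cball (0::'a::euclidean_space) (DIM('a) / 2)"
  using cube_subset_cball[of "- (1/2) *\<^sub>R One :: 'a" 1] unfolding cube_center_origin by (simp add: origin_cube_def)

lemma measure_origin_cube: "measure lborel (origin_cube :: 'a::euclidean_space set) = 1"
  by (simp add: origin_cube_def measure_cube)

lemma fmeasurable_origin_cube: "origin_cube \<in> fmeasurable lborel"
  by (simp add: origin_cube_def fmeasurable_cube)

lemma cube_center_in: "0 < l \<Longrightarrow> cube_center a l \<in> cube a l"
  by (simp add: cube_def cube_center_inner)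

lemma cube_in_origin:
  assumes "cube a l \<subseteq> (origin_cube :: 'a::euclidean_space set)" "0 < l"
  shows "l \<le> 1" "norm (cube_center a l) \<le> DIM('a) / 2"
proof -
  have "measure lborel (cube a l) \<le> measure lborel (origin_cube :: 'a set)"
    using assms by (intro measure_mono_fmeasurable fmeasurable_origin_cube) (auto simp: sets_cube)
  then have "l ^ DIM('a) \<le> 1" using assms by (simp add: measure_cube measure_origin_cube)
  then show "l \<le> 1" using assms(2) power_le_one_iff[of l "DIM('a)"] by simp
  show "norm (cube_center a l) \<le> DIM('a) / 2"
    using assms(1) cube_center_in[OF assms(2), of a] origin_cube_subset by fastforce
qed

text \<open>Since \<open>g \<ge> 1/2\<close>, the additive \<open>\<mu> / 4\<close> costs at most
  half of the gain \<mu>. Until the density passes \<open>1 - \<mu>\<close>, each step therefore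
  multiplies it by at least \<open>1 + \<mu>/2\<close>, and \<open>n\<close> such steps would push
  it above 1.\<close>

lemma geometric_growth:
  fixes g :: "nat \<Rightarrow> real"
  assumes \<mu>: "0 < \<mu>" "\<mu> \<le> 1/2" and g0: "1/2 \<le> g 0" and le1: "\<And>k. g k \<le> 1"
    and step: "\<And>k. 1 - \<mu> < g k \<or> g k \<le> (1 - \<mu>) * g (Suc k) + \<mu> / 4"
    and mono: "\<And>k. g k \<le> g (Suc k)" and n: "2 < (1 + \<mu>/2) ^ n"
  shows "1 - \<mu> < g n"
proof -
  have half: "1/2 \<le> g k" for k by (induction k) (use g0 mono order_trans in blast)+
  have "1 - \<mu> < g k \<or> 1/2 * (1 + \<mu>/2) ^ k \<le> g k" for k
  proof (induction k)
    case 0 then show ?case using g0 by simp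
  next
    case (Suc k)
    show ?case
    proof (cases "1 - \<mu> < g k")
      case True then show ?thesis using mono[of k] by linarith
    next
      case False
      then have 1: "g k \<le> (1 - \<mu>) * g (Suc k) + \<mu> / 4" and 2: "1/2 * (1 + \<mu>/2) ^ k \<le> g k" using step Suc by blast+
      have "\<mu> / 4 \<le> \<mu>/2 * g k" using mult_left_mono[OF half[of k], of "\<mu>/2"] \<mu> by simp
      then have a: "(1 - \<mu>/2) * g k \<le> (1 - \<mu>) * g (Suc k)" using 1 by (simp add: algebra_simps)
      have "(1 - \<mu>) * (1 + \<mu>/2) \<le> 1 - \<mu>/2" by (simp add: algebra_simps)
      then have "(1 - \<mu>) * (1 + \<mu>/2) * g k \<le> (1 - \<mu>/2) * g k" using half[of k] by (intro mult_right_mono) auto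
      then have "(1 - \<mu>) * ((1 + \<mu>/2) * g k) \<le> (1 - \<mu>) * g (Suc k)" using a by (simp add: mult.assoc)
      then have "(1 + \<mu>/2) * g k \<le> g (Suc k)" using \<mu> by simp
      moreover have "(1 + \<mu>/2) * (1/2 * (1 + \<mu>/2) ^ k) \<le> (1 + \<mu>/2) * g k"
        using 2 \<mu> by (intro mult_left_mono) auto
      ultimately show ?thesis by simp
    qed
  qed
  from this[of n] show ?thesis using n le1[of n] by linarith
qed

text \<open>Lowering the level by a factor \<open>c\<close> enlarges the superlevel set at a
  geometric rate, so a number of levels independent of \<open>e\<close> makes the unit cube dense.
  The dense-cube estimate on that cube concludes and dictates the radius \<open>4 * N\<close> of the
  domain.\<close>

lemma half_measure_lower_bound:
  fixes \<beta> \<Lambda> :: real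
  assumes \<beta>: "0 < \<beta>" "\<beta> \<le> 1"
  obtains e0 c :: real where "0 < e0" "0 < c"
    "\<And>e u x. \<lbrakk>0 < e; e \<le> e0; loc_bdd (u :: 'a::euclidean_space \<Rightarrow> real); \<And>z. 0 \<le> u z;
      supersol \<beta> \<Lambda> e (ball 0 (4 * real DIM('a))) u;
      1/2 \<le> measure lborel (origin_cube \<inter> {z. 1 \<le> u z}); x \<in> ball 0 1\<rbrakk> \<Longrightarrow> c \<le> u x"
proof -
  let ?N = "real DIM('a)"
  have N: "1 \<le> ?N" by (simp add: Suc_leI)
  obtain e1 \<mu> c1 where e1: "0 < e1" and \<mu>: "0 < \<mu>" "\<mu> \<le> 1/2" and c1: "0 < c1"
    and DC: "\<And>e a (l::real) u t x. \<lbrakk>0 < e; e \<le> e1 * l; 0 < l; loc_bdd (u :: 'a \<Rightarrow> real); \<And>z. 0 \<le> u z;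
      supersol \<beta> \<Lambda> e (ball (cube_center a l) (4 * ?N * l)) u; 0 < t;
      (1 - \<mu>) * l ^ DIM('a) < measure lborel (cube a l \<inter> {z. t \<le> u z});
      x \<in> ball (cube_center a l) (3 * ?N * l)\<rbrakk> \<Longrightarrow> c1 * t \<le> u x"
    using dense_cube_lower_bound[OF \<beta>, of \<Lambda>, where 'a='a] by blast
  \<comment> \<open>\<open>k1 * e\<close> is the smallest side for which the dense-cube estimate is
    available; the decomposition ends at a dyadic side between this and its double.\<close>
  define k1 where "k1 = 1 / e1"
  have k1: "0 < k1" using e1 by (simp add: k1_def)
  have \<eta>: "0 < \<mu> / 4" using \<mu> by simp
  obtain c2 D where c2: "0 < c2" and D: "0 < D"
    and SC: "\<And>e a l u t x. \<lbrakk>0 < e; k1 * e \<le> l; l \<le> (2 * k1) * e; loc_bdd (u :: 'a \<Rightarrow> real); \<And>z. 0 \<le> u z;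
      supersol \<beta> \<Lambda> e (ball (cube_center a l) (D * e)) u; 0 < t;
      \<mu> / 4 * l ^ DIM('a) \<le> measure lborel (cube a l \<inter> {z. t \<le> u z}); x \<in> cube a l\<rbrakk> \<Longrightarrow> c2 * t \<le> u x"
    using small_cube_lower_bound[OF \<beta> k1 \<eta>, of "2 * k1" \<Lambda>, where 'a='a] by blast
  define c where "c = min 1 (min c1 c2)"
  have c: "0 < c" "c \<le> 1" "c \<le> c1" "c \<le> c2" using c1 c2 by (simp_all add: c_def)
  obtain n where n: "2 < (1 + \<mu>/2) ^ n" using real_arch_pow[of "1 + \<mu>/2" 2] \<mu> by auto
  \<comment> \<open>\<open>D * e \<le> 1\<close> keeps the balls needed for the smallest cubes
    inside the domain.\<close>
  define e0 where "e0 = min e1 (1 / D)"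
  show ?thesis
  proof (rule that[of e0 "c1 * c ^ n"])
    show "0 < e0" "0 < c1 * c ^ n" using e1 D c1 c by (simp_all add: e0_def)
    fix e and u :: "'a \<Rightarrow> real" and x :: 'a
    assume e: "0 < e" "e \<le> e0" and u: "loc_bdd u" "\<And>z. 0 \<le> u z"
      and ss: "supersol \<beta> \<Lambda> e (ball 0 (4 * ?N)) u"
      and half: "1/2 \<le> measure lborel (origin_cube \<inter> {z. 1 \<le> u z})" and x: "x \<in> ball 0 1"
    have [measurable]: "u \<in> borel_measurable borel" using u(1) by (rule loc_bdd_measurable)
    have ee: "k1 * e \<le> 1" "D * e \<le> 1" using e e1 D by (simp_all add: k1_def e0_def field_simps)
    obtain J where J: "k1 * e \<le> (1/2) ^ J" "(1/2) ^ J \<le> 2 * (k1 * e)"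
      using dyadic_scale[of "k1 * e"] k1 e ee by auto
    define \<rho> where "\<rho> = (1/2::real) ^ J"
    have \<rho>: "0 < \<rho>" "k1 * e \<le> \<rho>" "\<rho> \<le> 2 * k1 * e" "2 ^ J * \<rho> = 1" using J by (simp_all add: \<rho>_def power_divide)
    have ssb: "supersol \<beta> \<Lambda> e (ball z r) u" if "norm z + r \<le> 4 * ?N" for z r
    proof (rule supersol_subset[OF ss], rule subsetI)
      fix y assume "y \<in> ball z r"
      then show "y \<in> ball 0 (4 * ?N)" using that norm_triangle_sub[of y z] by (simp add: dist_norm norm_minus_commute)
    qed
    define g where "g k = measure lborel (origin_cube \<inter> {z. c ^ k \<le> u z})" for k
    have lev: "{z. t \<le> u z} \<in> sets borel" for t by measurable
    have fm: "origin_cube \<inter> {z. t \<le> u z} \<in> fmeasurable lborel" for t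
      using lev by (intro fmeasurableI2[OF fmeasurable_origin_cube]) (auto simp: origin_cube_def sets_cube)
    have "1 - \<mu> < g n"
    proof (rule geometric_growth[OF \<mu> _ _ _ _ n])
      show "1/2 \<le> g 0" using half by (simp add: g_def)
      show "g k \<le> 1" for k
        unfolding g_def measure_origin_cube[symmetric, where 'a='a]
        using fm[of "c ^ k"] by (intro measure_mono_fmeasurable fmeasurable_origin_cube) auto
      show "g k \<le> g (Suc k)" for k
      proof -
        have "c ^ Suc k \<le> c ^ k" using c by (intro power_decreasing) auto
        then show ?thesis unfolding g_def
          using fm[of "c ^ k"] by (intro measure_mono_fmeasurable fm) auto
      qed
      show "1 - \<mu> < g k \<or> g k \<le> (1 - \<mu>) * g (Suc k) + \<mu> / 4" for k
      proof -
        let ?E = "{z. c ^ k \<le> u z}" and ?F = "{z. c ^ Suc k \<le> u z}" and ?a = "- (1/2) *\<^sub>R One :: 'a"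
        have ck: "0 < c ^ k" using c by simp
        have \<mu>1: "\<mu> \<le> 1" "0 \<le> \<mu> / 4" using \<mu> by auto
        have "(1 - \<mu>) * (2 ^ J * \<rho>) ^ DIM('a) < measure lborel (cube ?a (2 ^ J * \<rho>) \<inter> ?E) \<or>
          measure lborel (cube ?a (2 ^ J * \<rho>) \<inter> ?E)
            \<le> (1 - \<mu>) * measure lborel (cube ?a (2 ^ J * \<rho>) \<inter> ?F) + \<mu> / 4 * (2 ^ J * \<rho>) ^ DIM('a)"
        proof (rule calderon_zygmund[OF lev lev \<rho>(1) \<mu>1, where Q=origin_cube])
          show "cube ?a (2 ^ J * \<rho>) \<subseteq> origin_cube" unfolding \<rho>(4) origin_cube_def ..
        next
          fix a :: 'a assume a: "cube a \<rho> \<subseteq> origin_cube"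
            and d: "\<mu> / 4 * \<rho> ^ DIM('a) \<le> measure lborel (cube a \<rho> \<inter> ?E)"
          show "cube a \<rho> \<subseteq> ?F"
          proof
            fix y assume y: "y \<in> cube a \<rho>"
            have "c2 * c ^ k \<le> u y"
            proof (rule SC[OF e(1) \<rho>(2,3) u _ ck d y])
              show "supersol \<beta> \<Lambda> e (ball (cube_center a \<rho>) (D * e)) u"
                using cube_in_origin(2)[OF a \<rho>(1)] ee N by (intro ssb) linarith
            qed
            moreover have "c * c ^ k \<le> c2 * c ^ k" using c by (intro mult_right_mono) auto
            ultimately show "y \<in> ?F" by simp
          qed
        next
          fix a :: 'a and j S
          define l where "l = 2 ^ j * \<rho>"
          assume a: "cube a (2 * (2 ^ j * \<rho>)) \<subseteq> origin_cube" and S: "S \<subseteq> Basis"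
            and d: "(1 - \<mu>) * (2 ^ j * \<rho>) ^ DIM('a) < measure lborel (cube (a + (2 ^ j * \<rho>) *\<^sub>R \<Sum>S) (2 ^ j * \<rho>) \<inter> ?E)"
          note a = a[folded l_def] and d = d[folded l_def]
          have l: "0 < l" using \<rho> by (simp add: l_def)
          have "1 * \<rho> \<le> l" unfolding l_def using \<rho> by (intro mult_right_mono) auto
          then have "k1 * e \<le> l" using \<rho>(2) by simp
          then have el: "e \<le> e1 * l" using e1 by (simp add: k1_def field_simps)
          let ?b = "a + l *\<^sub>R \<Sum>S"
          have sub: "cube ?b l \<subseteq> cube a (2 * l)" using cube_split[OF l, of a] S by blast
          have l2: "2 * l \<le> 1" using cube_in_origin(1)[OF a] l by simp
          have ctr: "norm (cube_center ?b l) \<le> ?N / 2" using cube_in_origin(2)[of ?b l] sub a l by blast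
          show "cube a (2 * (2 ^ j * \<rho>)) \<subseteq> ?F" unfolding l_def[symmetric]
          proof
            fix y assume y: "y \<in> cube a (2 * l)"
            have "c1 * c ^ k \<le> u y"
            proof (rule DC[OF e(1) el l u _ ck d])
              have "4 * ?N * l \<le> 4 * ?N * (1/2)" using l2 by (intro mult_left_mono) auto
              then show "supersol \<beta> \<Lambda> e (ball (cube_center ?b l) (4 * ?N * l)) u"
                using ctr N by (intro ssb) linarith
              \<comment> \<open>In each coordinate the centre of the child is \<open>l/2\<close> or
                \<open>3/2 * l\<close> from the corner of the parent, so it is at most
                \<open>3/2 * l\<close> from any point of the parent.\<close>
              have "norm (y - cube_center ?b l) \<le> ?N * (3/2 * l)"
              proof (rule norm_le_DIM)
                fix b :: 'a assume b: "b \<in> Basis"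
                have y': "a \<bullet> b \<le> y \<bullet> b" "y \<bullet> b < a \<bullet> b + 2 * l" using y b by (simp_all add: cube_def)
                have z': "a \<bullet> b + l/2 \<le> cube_center ?b l \<bullet> b" "cube_center ?b l \<bullet> b \<le> a \<bullet> b + 3/2 * l"
                  using b l by (simp_all add: cube_center_inner inner_add_left sum_Basis_subset_inner[OF S b])
                show "\<bar>(y - cube_center ?b l) \<bullet> b\<bar> \<le> 3/2 * l"
                  unfolding inner_diff_left abs_le_iff using y' z' l by linarith
              qed
              also have "?N * (3/2 * l) < 3 * ?N * l" using N l by simp
              finally show "y \<in> ball (cube_center ?b l) (3 * ?N * l)"
                by (simp add: dist_norm norm_minus_commute)
            qed
            moreover have "c * c ^ k \<le> c1 * c ^ k" using c by (intro mult_right_mono) auto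
            ultimately show "y \<in> ?F" by simp
          qed
        qed
        then show ?thesis unfolding \<rho>(4) g_def origin_cube_def by simp
      qed
    qed
    then have d: "(1 - \<mu>) * 1 ^ DIM('a) < measure lborel (cube (- (1/2) *\<^sub>R One :: 'a) 1 \<inter> {z. c ^ n \<le> u z})"
      by (simp add: g_def origin_cube_def)
    show "c1 * c ^ n \<le> u x"
    proof (rule DC[OF e(1) _ _ u _ _ d])
      show "e \<le> e1 * 1" using e by (simp add: e0_def)
      show "supersol \<beta> \<Lambda> e (ball (cube_center (- (1/2) *\<^sub>R One) 1) (4 * ?N * 1)) u"
        unfolding cube_center_origin using ss by simp
      show "x \<in> ball (cube_center (- (1/2) *\<^sub>R One) 1) (3 * ?N * 1)"
      proof -
        have "norm x < 1" using x by (simp add: dist_norm)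
        then have "norm x < 3 * ?N * 1" using N by linarith
        then show ?thesis unfolding cube_center_origin by (simp add: dist_norm)
      qed
    qed (use c in auto)
  qed
qed

section \<open>Inhomogeneous supersolutions\<close>

text \<open>\<kappa> stands for a bound on the right-hand side. With the factor \<open>e^2\<close>
  it scales like a second derivative.\<close>

definition almost_supersol :: "real \<Rightarrow> real \<Rightarrow> real \<Rightarrow> real \<Rightarrow> 'a::euclidean_space set \<Rightarrow> ('a \<Rightarrow> real) \<Rightarrow> bool" where
  "almost_supersol \<beta> \<Lambda> e \<kappa> D u \<longleftrightarrow> (\<forall>x\<in>D. \<forall>m.
     (\<forall>h. norm h < \<Lambda> \<longrightarrow> 2 * m \<le> u (x + e *\<^sub>R h) + u (x - e *\<^sub>R h)) \<longrightarrow>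
     (1 - \<beta>) * m + \<beta> * ball_avg u x e \<le> u x + \<kappa> * e\<^sup>2)"

lemma almost_supersolD:
  assumes "almost_supersol \<beta> \<Lambda> e \<kappa> D u" "x \<in> D"
    "\<And>h. norm h < \<Lambda> \<Longrightarrow> 2 * m \<le> u (x + e *\<^sub>R h) + u (x - e *\<^sub>R h)"
  shows "(1 - \<beta>) * m + \<beta> * ball_avg u x e \<le> u x + \<kappa> * e\<^sup>2"
  using assms by (auto simp: almost_supersol_def)

lemma almost_supersol_subset:
  "almost_supersol \<beta> \<Lambda> e \<kappa> D u \<Longrightarrow> D' \<subseteq> D \<Longrightarrow> almost_supersol \<beta> \<Lambda> e \<kappa> D' u"
  by (auto simp: almost_supersol_def)

text \<open>Zooming in by \<open>s\<close> multiplies the inhomogeneity by \<open>s^2\<close>, which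
  makes it negligible at small scales.\<close>

lemma almost_supersol_affine:
  fixes u :: "'a::euclidean_space \<Rightarrow> real"
  assumes as: "almost_supersol \<beta> \<Lambda> e \<kappa> (ball z (s * r)) u" and u: "loc_bdd u" and s: "0 < s" and k: "0 < k"
  shows "almost_supersol \<beta> \<Lambda> (e / s) (k * \<kappa> * s\<^sup>2) (ball 0 r) (\<lambda>y. k * (u (z + s *\<^sub>R y) + b))"
  unfolding almost_supersol_def
proof (intro ballI allI impI)
  fix y m assume y: "y \<in> ball 0 r" and m: "\<forall>h. norm h < \<Lambda> \<longrightarrow>
      2 * m \<le> k * (u (z + s *\<^sub>R (y + (e / s) *\<^sub>R h)) + b) + k * (u (z + s *\<^sub>R (y - (e / s) *\<^sub>R h)) + b)"
  define x where "x = z + s *\<^sub>R y"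
  have eq: "z + s *\<^sub>R (y + (e / s) *\<^sub>R h) = x + e *\<^sub>R h" "z + s *\<^sub>R (y - (e / s) *\<^sub>R h) = x - e *\<^sub>R h" for h
    using s by (simp_all add: x_def algebra_simps)
  have "(1 - \<beta>) * (m / k - b) + \<beta> * ball_avg u x e \<le> u x + \<kappa> * e\<^sup>2"
  proof (rule almost_supersolD[OF as])
    show "x \<in> ball z (s * r)" using y s by (simp add: x_def dist_norm)
    fix h :: 'a assume "norm h < \<Lambda>"
    then show "2 * (m / k - b) \<le> u (x + e *\<^sub>R h) + u (x - e *\<^sub>R h)"
      using m k unfolding eq by (simp add: field_simps)
  qed
  then have "k * ((1 - \<beta>) * (m / k - b) + \<beta> * ball_avg u x e) \<le> k * (u x + \<kappa> * e\<^sup>2)"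
    using k by simp
  moreover have av: "ball_avg (\<lambda>y. k * (u (z + s *\<^sub>R y) + b)) y (e / s) = k * (ball_avg u x e + b)"
  proof -
    have "ball_avg (\<lambda>y. k * (u (z + s *\<^sub>R y) + b)) y (e / s) = k * ball_avg (\<lambda>y. u y + b) x e"
      unfolding ball_avg_def eq by simp
    also have "ball_avg (\<lambda>y. u y + b) x e = ball_avg u x e + b"
      by (simp only: ball_avg_add[OF u loc_bdd_const] ball_avg_const)
    finally show ?thesis .
  qed
  moreover have "k * ((1 - \<beta>) * (m / k - b) + \<beta> * ball_avg u x e) = (1 - \<beta>) * m + \<beta> * (k * (ball_avg u x e + b)) - k * b"
  proof -
    define n where "n = m / k"
    have "m = k * n" using k by (simp add: n_def)
    then show ?thesis unfolding n_def[symmetric] by (simp add: algebra_simps)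
  qed
  moreover have "k * \<kappa> * s\<^sup>2 * (e / s)\<^sup>2 = k * (\<kappa> * e\<^sup>2)" using s by (simp add: power_divide)
  ultimately show "(1 - \<beta>) * m + \<beta> * ball_avg (\<lambda>y. k * (u (z + s *\<^sub>R y) + b)) y (e / s)
       \<le> k * (u (z + s *\<^sub>R y) + b) + k * \<kappa> * s\<^sup>2 * (e / s)\<^sup>2"
    unfolding x_def[symmetric] av by (simp only: distrib_left[of k] distrib_left[of \<beta>])
qed

lemma ball_avg_sq_ge:
  fixes x :: "'a::euclidean_space"
  shows "(norm x)\<^sup>2 + moment_const TYPE('a) * e\<^sup>2 \<le> ball_avg (\<lambda>z. (norm z)\<^sup>2) x e"
proof -
  interpret prob_space "uball :: 'a measure" by (rule prob_space_uball)
  obtain b :: 'a where b: "b \<in> Basis" using nonempty_Basis by blast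
  have i: "integrable uball (\<lambda>h. (b \<bullet> h)\<^sup>2)"
    by (intro loc_bdd_integrable' loc_bdd_continuous continuous_intros)
  have "(norm x)\<^sup>2 + moment_const TYPE('a) * e\<^sup>2 \<le> (norm x)\<^sup>2 + e\<^sup>2 * (LINT h|uball. (b \<bullet> h)\<^sup>2)"
    using second_moment[of b] b mult_left_mono[of "moment_const TYPE('a)" "LINT h|uball. (b \<bullet> h)\<^sup>2" "e\<^sup>2"] by (simp add: mult.commute)
  also have "\<dots> = (LINT h|uball. (norm x)\<^sup>2 + e\<^sup>2 * (b \<bullet> h)\<^sup>2)" using i prob_space by simp
  also have "\<dots> \<le> ball_avg (\<lambda>z. (norm z)\<^sup>2) x e"
  proof (rule ball_avg_sym_ge)
    show "loc_bdd (\<lambda>z::'a. (norm z)\<^sup>2)" by (intro loc_bdd_continuous continuous_intros)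
    show "integrable uball (\<lambda>h. (norm x)\<^sup>2 + e\<^sup>2 * (b \<bullet> h)\<^sup>2)" using i by simp
    fix h :: 'a
    have "(b \<bullet> h)\<^sup>2 \<le> (norm h)\<^sup>2" using Cauchy_Schwarz_ineq[of b h] b by (simp add: power2_norm_eq_inner inner_Basis)
    then have "e\<^sup>2 * (b \<bullet> h)\<^sup>2 \<le> e\<^sup>2 * (norm h)\<^sup>2" by (intro mult_left_mono) auto
    then show "2 * ((norm x)\<^sup>2 + e\<^sup>2 * (b \<bullet> h)\<^sup>2) \<le> (norm (x + e *\<^sub>R h))\<^sup>2 + (norm (x - e *\<^sub>R h))\<^sup>2"
      using parallelogram_sq[of x "e *\<^sub>R h" 0] by (simp add: power_mult_distrib)
  qed
  finally show ?thesis .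
qed

text \<open>The concave quadratic term absorbs the inhomogeneity, and the truncation makes the function nonnegative everywhere.\<close>

lemma supersol_corrected:
  fixes u :: "'a::euclidean_space \<Rightarrow> real"
  assumes \<beta>: "0 < \<beta>" "\<beta> \<le> 1" and e: "0 < e" "e \<le> 1" "\<Lambda> * e \<le> 1" and u: "loc_bdd u"
    and as: "almost_supersol \<beta> \<Lambda> e \<kappa> (ball 0 L) u" and C: "C * (\<beta> * moment_const TYPE('a)) = \<kappa>" "0 \<le> C"
  shows "supersol \<beta> \<Lambda> e (ball 0 L) (\<lambda>x. if x \<in> ball 0 (L + 1) then u x + C * ((L + 1)\<^sup>2 - (norm x)\<^sup>2) else 0)"
    (is "supersol \<beta> \<Lambda> e _ ?v")
  unfolding supersol_def
proof (intro ballI allI impI)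
  fix x m assume x: "x \<in> ball (0::'a) L"
    and m: "\<forall>h. norm h < \<Lambda> \<longrightarrow> 2 * m \<le> ?v (x + e *\<^sub>R h) + ?v (x - e *\<^sub>R h)"
  define P where "P = C * ((L + 1)\<^sup>2 - (norm x)\<^sup>2)"
  have le: "(1 - \<beta>) * (m - P) + \<beta> * ball_avg u x e \<le> u x + \<kappa> * e\<^sup>2"
  proof (rule almost_supersolD[OF as x])
    fix h :: 'a assume h: "norm h < \<Lambda>"
    have "e * norm h \<le> e * \<Lambda>" using h e by (intro mult_left_mono) auto
    then have "e * norm h \<le> 1" using e(3) by (simp add: mult.commute)
    then have "x + e *\<^sub>R h \<in> ball 0 (L + 1)" "x - e *\<^sub>R h \<in> ball 0 (L + 1)"
      using x e norm_triangle_ineq[of x "e *\<^sub>R h"] norm_triangle_ineq4[of x "e *\<^sub>R h"] by simp_all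
    moreover have "2 * m \<le> ?v (x + e *\<^sub>R h) + ?v (x - e *\<^sub>R h)" using m h by blast
    ultimately have "2 * m \<le> u (x + e *\<^sub>R h) + u (x - e *\<^sub>R h)
        + C * (2 * (L + 1)\<^sup>2 - ((norm (x + e *\<^sub>R h))\<^sup>2 + (norm (x - e *\<^sub>R h))\<^sup>2))"
      by (simp add: algebra_simps)
    \<comment> \<open>By concavity the quadratic adds at most \<open>2 * P\<close> to the symmetric
      sum, so \<open>m - P\<close> bounds the symmetric averages of \<open>u\<close> itself.\<close>
    also have "(norm (x + e *\<^sub>R h))\<^sup>2 + (norm (x - e *\<^sub>R h))\<^sup>2 = 2 * (norm x)\<^sup>2 + 2 * (norm (e *\<^sub>R h))\<^sup>2"
      using parallelogram_sq[of x "e *\<^sub>R h" 0] by simp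
    also have "C * (2 * (L + 1)\<^sup>2 - (2 * (norm x)\<^sup>2 + 2 * (norm (e *\<^sub>R h))\<^sup>2)) = 2 * P - 2 * (C * (norm (e *\<^sub>R h))\<^sup>2)"
      by (simp add: P_def algebra_simps)
    finally show "2 * (m - P) \<le> u (x + e *\<^sub>R h) + u (x - e *\<^sub>R h)"
      using mult_nonneg_nonneg[OF C(2) zero_le_power2[of "norm (e *\<^sub>R h)"]] by (simp only: right_diff_distrib)
  qed
  have "ball_avg ?v x e \<le> ball_avg u x e + P - C * moment_const TYPE('a) * e\<^sup>2"
  proof -
    have q: "loc_bdd (\<lambda>z::'a. (norm z)\<^sup>2)" by (intro loc_bdd_continuous continuous_intros)
    let ?w = "\<lambda>x. u x + (C * (L + 1)\<^sup>2 + (- C) * (norm x)\<^sup>2)"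
    have w: "loc_bdd ?w" by (intro loc_bdd_add u loc_bdd_const loc_bdd_cmult q)
    have "ball x e \<subseteq> ball 0 (L + 1)"
    proof
      fix y assume "y \<in> ball x e"
      then show "y \<in> ball 0 (L + 1)" using x e norm_triangle_sub[of y x] by (simp add: dist_norm norm_minus_commute)
    qed
    then have "ball_avg ?v x e \<le> ball_avg ?w x e"
      by (intro ball_avg_mono w e loc_bdd_truncate[of "\<lambda>x. u x + C * ((L + 1)\<^sup>2 - (norm x)\<^sup>2)"])
         (use w in \<open>auto simp: algebra_simps\<close>)
    also have "\<dots> = ball_avg u x e + (C * (L + 1)\<^sup>2 + (- C) * ball_avg (\<lambda>z. (norm z)\<^sup>2) x e)"
      by (simp only: ball_avg_add[OF u loc_bdd_add[OF loc_bdd_const loc_bdd_cmult[OF q]]]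
          ball_avg_add[OF loc_bdd_const loc_bdd_cmult[OF q]] ball_avg_const ball_avg_cmult)
    finally show ?thesis
      using mult_left_mono[OF ball_avg_sq_ge[of x e] C(2)] by (simp add: P_def algebra_simps)
  qed
  then have "\<beta> * ball_avg ?v x e \<le> \<beta> * (ball_avg u x e + P - C * moment_const TYPE('a) * e\<^sup>2)" using \<beta> by simp
  also have "\<dots> = \<beta> * ball_avg u x e + \<beta> * P - \<kappa> * e\<^sup>2"
    by (simp add: C(1)[symmetric] algebra_simps)
  also have "\<dots> = ((1 - \<beta>) * (m - P) + \<beta> * ball_avg u x e) - \<kappa> * e\<^sup>2 + P - (1 - \<beta>) * m"
    by (simp add: algebra_simps)
  finally have "(1 - \<beta>) * m + \<beta> * ball_avg ?v x e \<le> ((1 - \<beta>) * (m - P) + \<beta> * ball_avg u x e) - \<kappa> * e\<^sup>2 + P"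
    by simp
  also have "\<dots> \<le> u x + P" using le by simp
  finally have "(1 - \<beta>) * m + \<beta> * ball_avg ?v x e \<le> u x + P" .
  then show "(1 - \<beta>) * m + \<beta> * ball_avg ?v x e \<le> ?v x" using x by (simp add: P_def)
qed

text \<open>The correction only raises \<open>u\<close> on the relevant ball, so the half-measure
  hypothesis survives. It raises it by at most a multiple of \<kappa>, which is subtracted again in
  the conclusion.\<close>

lemma almost_half_measure:
  fixes \<beta> \<Lambda> :: real
  assumes \<beta>: "0 < \<beta>" "\<beta> \<le> 1" and \<Lambda>: "0 < \<Lambda>"
  obtains e0 c C :: real where "0 < e0" "0 < c" "c \<le> 1" "0 < C"
    "\<And>e \<kappa> u x. \<lbrakk>0 < e; e \<le> e0; 0 \<le> \<kappa>; loc_bdd (u :: 'a::euclidean_space \<Rightarrow> real);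
      \<And>z. z \<in> ball 0 (4 * real DIM('a) + 1) \<Longrightarrow> 0 \<le> u z;
      almost_supersol \<beta> \<Lambda> e \<kappa> (ball 0 (4 * real DIM('a))) u;
      1/2 \<le> measure lborel (origin_cube \<inter> {z. 1 \<le> u z}); x \<in> ball 0 1\<rbrakk> \<Longrightarrow> c - C * \<kappa> \<le> u x"
proof -
  let ?N = "real DIM('a)"
  have N: "1 \<le> ?N" by (simp add: Suc_leI)
  define L where "L = 4 * ?N"
  obtain e1 c where e1: "0 < e1" and c: "0 < c"
    and H: "\<And>e u x. \<lbrakk>0 < e; e \<le> e1; loc_bdd (u :: 'a \<Rightarrow> real); \<And>z. 0 \<le> u z;
      supersol \<beta> \<Lambda> e (ball 0 L) u;
      1/2 \<le> measure lborel (origin_cube \<inter> {z. 1 \<le> u z}); x \<in> ball 0 1\<rbrakk> \<Longrightarrow> c \<le> u x"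
    unfolding L_def using half_measure_lower_bound[OF \<beta>, of \<Lambda>, where 'a='a] by blast
  let ?k = "\<beta> * moment_const TYPE('a)"
  have k: "0 < ?k" using \<beta> moment_const_pos[where 'a='a] by simp
  define e0 where "e0 = min e1 (min 1 (1 / \<Lambda>))"
  show ?thesis
  \<comment> \<open>The cap at 1 keeps the later oscillation factor nonnegative.\<close>
  proof (rule that[of e0 "min 1 c" "(L + 1)\<^sup>2 / ?k"])
    show "0 < e0" "0 < min 1 c" "min 1 c \<le> 1" "0 < (L + 1)\<^sup>2 / ?k" using e1 \<Lambda> c k N by (simp_all add: e0_def L_def)
    fix e \<kappa> and u :: "'a \<Rightarrow> real" and x :: 'a
    assume e: "0 < e" "e \<le> e0" and \<kappa>: "0 \<le> \<kappa>" and u: "loc_bdd u"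
      and u0: "\<And>z. z \<in> ball 0 (4 * ?N + 1) \<Longrightarrow> 0 \<le> u z"
      and as: "almost_supersol \<beta> \<Lambda> e \<kappa> (ball 0 (4 * ?N)) u"
      and half: "1/2 \<le> measure lborel (origin_cube \<inter> {z. 1 \<le> u z})" and x: "x \<in> ball 0 1"
    define C where "C = \<kappa> / ?k"
    have "C * ?k = \<kappa>" unfolding C_def by (rule nonzero_eq_divide_eq[THEN iffD1, OF _ refl]) (rule less_imp_neq[OF k, THEN not_sym])
    moreover have "0 \<le> C" unfolding C_def using k \<kappa> by (intro divide_nonneg_pos)
    ultimately have C: "C * ?k = \<kappa>" "0 \<le> C" by auto
    define w where "w = (\<lambda>x. u x + C * ((L + 1)\<^sup>2 - (norm x)\<^sup>2))"
    define v where "v = (\<lambda>x. if x \<in> ball 0 (L + 1) then w x else 0)"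
    have e': "e \<le> e1" "e \<le> 1" "\<Lambda> * e \<le> 1" using e \<Lambda> by (simp_all add: e0_def field_simps)
    have ss: "supersol \<beta> \<Lambda> e (ball 0 L) v"
      unfolding v_def w_def by (rule supersol_corrected[OF \<beta> e(1) e'(2,3) u as[folded L_def] C])
    have wu: "u z \<le> w z" if "z \<in> ball 0 (L + 1)" for z
    proof -
      have "(norm z)\<^sup>2 \<le> (L + 1)\<^sup>2" using that by (intro power_mono) (auto simp: dist_norm)
      then show ?thesis using C by (simp add: w_def)
    qed
    have wb: "loc_bdd w" unfolding w_def
      by (intro loc_bdd_add u loc_bdd_continuous continuous_intros)
    then have vb: "loc_bdd v" unfolding v_def by (rule loc_bdd_truncate) simp
    have v0: "0 \<le> v z" for z using wu[of z] u0[of z] by (auto simp: v_def L_def)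
    have meas: "{z. 1 \<le> f z} \<in> sets borel" if "loc_bdd f" for f :: "'a \<Rightarrow> real"
      using loc_bdd_measurable[OF that] by measurable
    have "measure lborel (origin_cube \<inter> {z. 1 \<le> u z}) \<le> measure lborel (origin_cube \<inter> {z. 1 \<le> v z})"
    proof (rule measure_mono_fmeasurable)
      have "origin_cube \<subseteq> ball (0::'a) (L + 1)"
        using origin_cube_subset[where 'a='a] N by (auto simp: L_def)
      then show "origin_cube \<inter> {z. 1 \<le> u z} \<subseteq> origin_cube \<inter> {z. 1 \<le> v z}"
        using wu by (auto simp: v_def intro: order_trans)
      show "origin_cube \<inter> {z. 1 \<le> u z} \<in> sets lborel" using meas[OF u] by (intro sets.Int) (simp_all add: origin_cube_def sets_cube)
      show "origin_cube \<inter> {z. 1 \<le> v z} \<in> fmeasurable lborel"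
        using meas[OF vb] by (intro fmeasurableI2[OF fmeasurable_origin_cube] sets.Int) (simp_all add: origin_cube_def sets_cube)
    qed
    then have "1/2 \<le> measure lborel (origin_cube \<inter> {z. 1 \<le> v z})" using half by linarith
    then have "c \<le> v x" by (rule H[OF e(1) e'(1) vb v0 ss _ x])
    moreover have "x \<in> ball 0 (L + 1)" using x N by (simp add: L_def dist_norm)
    moreover have "C * ((L + 1)\<^sup>2 - (norm x)\<^sup>2) \<le> C * (L + 1)\<^sup>2" using C by (intro mult_left_mono) auto
    ultimately have "c \<le> u x + C * (L + 1)\<^sup>2" by (simp add: v_def w_def)
    then show "min 1 c - (L + 1)\<^sup>2 / ?k * \<kappa> \<le> u x" by (simp add: C_def mult.commute)
  qed
qed

section \<open>Oscillation decay and the Hoelder estimate\<close>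

lemma half_measure_alternative:
  fixes u :: "'a::euclidean_space \<Rightarrow> real"
  assumes "loc_bdd u"
  shows "1/2 \<le> measure lborel (origin_cube \<inter> {z. m \<le> u z}) \<or> 1/2 \<le> measure lborel (origin_cube \<inter> {z. u z \<le> m})"
proof -
  have [measurable]: "u \<in> borel_measurable borel" using assms by (rule loc_bdd_measurable)
  have o: "origin_cube \<in> sets (borel :: 'a measure)" by (simp add: origin_cube_def sets_cube)
  have "{z. m \<le> u z} \<in> sets borel" "{z. u z \<le> m} \<in> sets borel" by measurable
  then have s: "origin_cube \<inter> {z. m \<le> u z} \<in> sets borel" "origin_cube \<inter> {z. u z \<le> m} \<in> sets borel"
    using o by (simp_all only: sets.Int)
  have "(origin_cube :: 'a set) = (origin_cube \<inter> {z. m \<le> u z}) \<union> (origin_cube \<inter> {z. u z \<le> m})" by auto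
  then have "1 = measure lborel ((origin_cube \<inter> {z. m \<le> u z}) \<union> (origin_cube \<inter> {z. u z \<le> m}))"
    using measure_origin_cube[where 'a='a] by simp
  also have "\<dots> \<le> measure lborel (origin_cube \<inter> {z. m \<le> u z}) + measure lborel (origin_cube \<inter> {z. u z \<le> m})"
    by (rule measure_Un_le) (use s in auto)
  finally show ?thesis by linarith
qed

text \<open>One of \<open>u - m\<close> and \<open>M - u\<close> is at least half of
  \<open>M - m\<close> on half of a cube, and the lower bound for it removes a fixed part of the
  range. The ratio \<open>lam\<close> is 1/(4N+1), because that lower bound on the unit ball
  requires nonnegativity up to radius 4N+1.\<close>

lemma oscillation_decay:
  fixes \<beta> \<Lambda> :: real
  assumes \<beta>: "0 < \<beta>" "\<beta> \<le> 1" and \<Lambda>: "0 < \<Lambda>"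
  obtains e0 c C lam :: real where "0 < e0" "0 < c" "c \<le> 1" "0 < C" "0 < lam" "lam < 1"
    "\<And>e \<kappa> u z r m M. \<lbrakk>0 < e; 0 < r; e \<le> e0 * r; 0 \<le> \<kappa>; loc_bdd (u :: 'a::euclidean_space \<Rightarrow> real);
      \<And>x. x \<in> ball z r \<Longrightarrow> m \<le> u x \<and> u x \<le> M;
      almost_supersol \<beta> \<Lambda> e \<kappa> (ball z r) u; almost_supersol \<beta> \<Lambda> e \<kappa> (ball z r) (\<lambda>x. - u x)\<rbrakk>
     \<Longrightarrow> \<exists>m' M'. (\<forall>x\<in>ball z (lam * r). m' \<le> u x \<and> u x \<le> M') \<and> M' - m' \<le> (1 - c) * (M - m) + C * \<kappa> * r\<^sup>2"
proof -
  let ?N = "real DIM('a)"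
  obtain e0 c C where e0: "0 < e0" and c: "0 < c" "c \<le> 1" and C: "0 < C"
    and H: "\<And>e \<kappa> u x. \<lbrakk>0 < e; e \<le> e0; 0 \<le> \<kappa>; loc_bdd (u :: 'a \<Rightarrow> real);
      \<And>z. z \<in> ball 0 (4 * ?N + 1) \<Longrightarrow> 0 \<le> u z;
      almost_supersol \<beta> \<Lambda> e \<kappa> (ball 0 (4 * ?N)) u;
      1/2 \<le> measure lborel (origin_cube \<inter> {z. 1 \<le> u z}); x \<in> ball 0 1\<rbrakk> \<Longrightarrow> c - C * \<kappa> \<le> u x"
    using almost_half_measure[OF \<beta> \<Lambda>, where 'a='a] by blast
  define L where "L = 4 * ?N + 1"
  have L: "1 < L" by (simp add: L_def)
  have lower: "\<forall>x\<in>ball z s. m + c * d - C * \<kappa> * s\<^sup>2 \<le> u x"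
    if e: "0 < e" "0 < s" "e \<le> e0 * s" and \<kappa>: "0 \<le> \<kappa>" and u: "loc_bdd u"
      and m: "\<And>x. x \<in> ball z (L * s) \<Longrightarrow> m \<le> u x" and as: "almost_supersol \<beta> \<Lambda> e \<kappa> (ball z (L * s)) u"
      and d: "0 < d" and half: "1/2 \<le> measure lborel (origin_cube \<inter> {y. m + d \<le> u (z + s *\<^sub>R y)})"
    for e s \<kappa> m d and u :: "'a \<Rightarrow> real" and z
  proof
    fix x assume x: "x \<in> ball z s"
    define v where "v = (\<lambda>y. (1/d) * (u (z + s *\<^sub>R y) + - m))"
    have "c - C * (1/d * \<kappa> * s\<^sup>2) \<le> v ((1/s) *\<^sub>R (x - z))"
    proof (rule H)
      show "0 < e / s" "e / s \<le> e0" using e by (simp_all add: field_simps)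
      show "0 \<le> 1/d * \<kappa> * s\<^sup>2" using d \<kappa> by simp
      show "loc_bdd v" unfolding v_def by (intro loc_bdd_cmult loc_bdd_add loc_bdd_affine[OF u] loc_bdd_const)
      show "almost_supersol \<beta> \<Lambda> (e / s) (1/d * \<kappa> * s\<^sup>2) (ball 0 (4 * ?N)) v"
        unfolding v_def
      proof (rule almost_supersol_affine[OF almost_supersol_subset[OF as] u e(2)])
        show "ball z (s * (4 * ?N)) \<subseteq> ball z (L * s)" using e(2) by (intro subset_ball) (simp add: L_def algebra_simps)
      qed (use d in simp)
      have "{y. m + d \<le> u (z + s *\<^sub>R y)} = {y. 1 \<le> v y}" using d by (auto simp: v_def field_simps)
      then show "1/2 \<le> measure lborel (origin_cube \<inter> {y. 1 \<le> v y})" using half by simp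
      have "norm ((1/s) *\<^sub>R (x - z)) = (1/s) * norm (x - z)" unfolding norm_scaleR using e by simp
      then show "(1/s) *\<^sub>R (x - z) \<in> ball 0 1"
        using x e by (simp add: dist_norm norm_minus_commute)
      fix y :: 'a assume "y \<in> ball 0 (4 * ?N + 1)"
      then have "s * norm y < s * L" unfolding L_def using e by simp
      then have "z + s *\<^sub>R y \<in> ball z (L * s)" using e by (simp add: dist_norm mult.commute)
      from m[OF this] show "0 \<le> v y" using d by (simp add: v_def)
    qed
    also have "v ((1/s) *\<^sub>R (x - z)) = (u x - m) / d" using e by (simp add: v_def)
    finally have "d * (c - C * (1/d * \<kappa> * s\<^sup>2)) \<le> d * ((u x - m) / d)"
      by (rule mult_left_mono) (use d in simp)
    moreover have "d * (c - C * (1/d * \<kappa> * s\<^sup>2)) = c * d - C * \<kappa> * s\<^sup>2"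
      using d by (simp add: right_diff_distrib mult_ac)
    moreover have "d * ((u x - m) / d) = u x - m" using d by simp
    ultimately show "m + c * d - C * \<kappa> * s\<^sup>2 \<le> u x" by linarith
  qed
  show ?thesis
  proof (rule that[of "e0 / L" "c / 2" C "1 / L"])
    show "0 < e0 / L" "0 < c / 2" "c / 2 \<le> 1" "0 < C" "0 < 1 / L" "1 / L < 1" using e0 c C L by simp_all
    fix e \<kappa> r m M and u :: "'a \<Rightarrow> real" and z :: 'a
    assume e: "0 < e" and r: "0 < r" and er: "e \<le> e0 / L * r" and \<kappa>: "0 \<le> \<kappa>" and u: "loc_bdd u"
      and mM: "\<And>x. x \<in> ball z r \<Longrightarrow> m \<le> u x \<and> u x \<le> M"
      and as: "almost_supersol \<beta> \<Lambda> e \<kappa> (ball z r) u" "almost_supersol \<beta> \<Lambda> e \<kappa> (ball z r) (\<lambda>x. - u x)"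
    define s where "s = 1 / L * r"
    have s: "0 < s" "L * s = r" "e \<le> e0 * s" using r L er by (simp_all add: s_def)
    have "s\<^sup>2 \<le> r\<^sup>2" using s L r mult_right_mono[of 1 L s] by (intro power_mono) auto
    then have sr: "C * \<kappa> * s\<^sup>2 \<le> C * \<kappa> * r\<^sup>2" using C \<kappa> by (intro mult_left_mono) auto
    have z: "z \<in> ball z r" using r by simp
    have bnd: "m \<le> u x \<and> u x \<le> M" if "x \<in> ball z s" for x
      using that mM s L mult_right_mono[of 1 L s] by auto
    define d where "d = (M - m) / 2"
    show "\<exists>m' M'. (\<forall>x\<in>ball z (1 / L * r). m' \<le> u x \<and> u x \<le> M') \<and> M' - m' \<le> (1 - c / 2) * (M - m) + C * \<kappa> * r\<^sup>2"
    proof (cases "d \<le> 0")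
      \<comment> \<open>Normalisation divides by \<open>d\<close>. The degenerate case forces
        \<open>M = m\<close>, as the value at \<open>z\<close> lies between them.\<close>
      case True
      then have "M = m" using mM[OF z] by (simp add: d_def)
      then show ?thesis unfolding s_def[symmetric] using bnd C \<kappa> by (intro exI[of _ m] exI[of _ M]) auto
    next
      case False
      then have d: "0 < d" by simp
      have dd: "c * d = c / 2 * (M - m)" by (simp add: d_def)
      from half_measure_alternative[OF loc_bdd_affine[OF u, of z s], of "m + d"] show ?thesis
      proof
        assume "1/2 \<le> measure lborel (origin_cube \<inter> {y. m + d \<le> u (z + s *\<^sub>R y)})"
        then have "\<forall>x\<in>ball z s. m + c * d - C * \<kappa> * s\<^sup>2 \<le> u x"
          using mM as(1) s(2) by (intro lower[OF e s(1,3) \<kappa> u _ _ d]) auto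
        moreover have "M - (m + c * d - C * \<kappa> * s\<^sup>2) \<le> (1 - c / 2) * (M - m) + C * \<kappa> * r\<^sup>2"
          using sr unfolding dd by (simp add: algebra_simps)
        ultimately show ?thesis unfolding s_def[symmetric] using bnd by blast
      next
        assume h: "1/2 \<le> measure lborel (origin_cube \<inter> {y. u (z + s *\<^sub>R y) \<le> m + d})"
        have "m + d = M - d" by (simp add: d_def field_simps)
        then have "{y. u (z + s *\<^sub>R y) \<le> m + d} = {y. - M + d \<le> - u (z + s *\<^sub>R y)}" by auto
        then have "\<forall>x\<in>ball z s. - M + c * d - C * \<kappa> * s\<^sup>2 \<le> - u x"
          using mM as(2) s(2) h loc_bdd_cmult[OF u, of "-1"] by (intro lower[OF e s(1,3) \<kappa> _ _ _ d]) auto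
        then have "\<forall>x\<in>ball z s. u x \<le> M - c * d + C * \<kappa> * s\<^sup>2" by (metis add_diff_eq diff_diff_eq2 minus_diff_eq neg_le_iff_le uminus_add_conv_diff add.commute)
        moreover have "(M - c * d + C * \<kappa> * s\<^sup>2) - m \<le> (1 - c / 2) * (M - m) + C * \<kappa> * r\<^sup>2"
          using sr unfolding dd by (simp add: algebra_simps)
        ultimately show ?thesis unfolding s_def[symmetric] using bnd by blast
      qed
    qed
  qed
qed

text \<open>Oscillation decay works at radii of at least \<open>e / e0\<close>, so the distance is
  replaced by its maximum with \<open>e / e0\<close>; this produces the term
  \<open>e powr \<gamma>\<close>. If that maximum reaches \<open>R\<close>, the trivial bound
  \<open>2 * S\<close> is strong enough.\<close>

lemma holder_estimate:
  fixes \<beta> \<Lambda> :: real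
  assumes \<beta>: "0 < \<beta>" "\<beta> \<le> 1" and \<Lambda>: "0 < \<Lambda>"
  obtains C \<gamma> :: real where "0 < C" "0 < \<gamma>"
    "\<And>R e \<kappa> S u x z. \<lbrakk>0 < R; 0 < e; 0 \<le> \<kappa>; loc_bdd (u :: 'a::euclidean_space \<Rightarrow> real);
      \<And>x. x \<in> ball 0 (2 * R) \<Longrightarrow> \<bar>u x\<bar> \<le> S;
      almost_supersol \<beta> \<Lambda> e \<kappa> (ball 0 (2 * R)) u; almost_supersol \<beta> \<Lambda> e \<kappa> (ball 0 (2 * R)) (\<lambda>x. - u x);
      x \<in> ball 0 R; z \<in> ball 0 R\<rbrakk>
     \<Longrightarrow> \<bar>u x - u z\<bar> \<le> C / R powr \<gamma> * (S + R\<^sup>2 * \<kappa>) * (norm (x - z) powr \<gamma> + e powr \<gamma>)"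
proof -
  obtain e0 c C lam where e0: "0 < e0" and c: "0 < c" "c \<le> 1" and C: "0 < C" and lam: "0 < lam" "lam < 1"
    and O: "\<And>e \<kappa> u z r m M. \<lbrakk>0 < e; 0 < r; e \<le> e0 * r; 0 \<le> \<kappa>; loc_bdd (u :: 'a \<Rightarrow> real);
      \<And>x. x \<in> ball z r \<Longrightarrow> m \<le> u x \<and> u x \<le> M;
      almost_supersol \<beta> \<Lambda> e \<kappa> (ball z r) u; almost_supersol \<beta> \<Lambda> e \<kappa> (ball z r) (\<lambda>x. - u x)\<rbrakk>
     \<Longrightarrow> \<exists>m' M'. (\<forall>x\<in>ball z (lam * r). m' \<le> u x \<and> u x \<le> M') \<and> M' - m' \<le> (1 - c) * (M - m) + C * \<kappa> * r\<^sup>2"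
    using oscillation_decay[OF \<beta> \<Lambda>, where 'a='a] by blast
  \<comment> \<open>Compared with the decay factor \<open>1 - c\<close>, the value
    \<open>1 - c/2\<close> reserves room for the inhomogeneity; \<open>lam^2 \<le> \<theta>\<close>
    makes the square of the radius decay at least as fast as the bound on the oscillation.\<close>
  define \<theta> where "\<theta> = max (1 - c/2) (lam\<^sup>2)"
  have \<theta>: "0 < \<theta>" "\<theta> < 1" "lam\<^sup>2 \<le> \<theta>" "c/2 \<le> \<theta> - (1 - c)"
  proof -
    have "lam\<^sup>2 < 1" using lam by (simp add: power_less_one_iff)
    then show "\<theta> < 1" using c by (simp add: \<theta>_def)
    show "0 < \<theta>" using lam by (simp add: \<theta>_def less_max_iff_disj)
    show "lam\<^sup>2 \<le> \<theta>" by (simp add: \<theta>_def)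
    have "1 - c/2 \<le> \<theta>" by (simp add: \<theta>_def)
    then show "c/2 \<le> \<theta> - (1 - c)" by simp
  qed
  \<comment> \<open>The solution of \<open>lam powr \<gamma> = \<theta>\<close>, so that geometric
    decay reads as a power of the radius.\<close>
  define \<gamma> where "\<gamma> = ln \<theta> / ln lam"
  have \<gamma>: "0 < \<gamma>" using \<theta> lam by (simp add: \<gamma>_def divide_neg_neg)
  have lam_\<gamma>: "(lam ^ k) powr \<gamma> = \<theta> ^ k" for k
  proof -
    have "lam powr \<gamma> = exp (\<gamma> * ln lam)" using lam by (simp add: powr_def)
    also have "\<gamma> * ln lam = ln \<theta>" using lam by (simp add: \<gamma>_def)
    finally have "lam powr \<gamma> = \<theta>" using \<theta> by simp
    moreover have "(lam ^ k) powr \<gamma> = (lam powr \<gamma>) ^ k"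
      by (induction k) (use lam in \<open>simp_all add: powr_mult\<close>)
    ultimately show ?thesis by simp
  qed
  \<comment> \<open>With this weight in \<open>A\<close>, the term \<open>C * \<kappa> * r^2\<close>
    is at most \<open>c/2\<close> times the current bound, which is the room reserved in
    \<theta>.\<close>
  define B where "B = 2 * C / c"
  have B: "0 < B" using C c by (simp add: B_def)
  define G where "G = 1 + (1/e0) powr \<gamma>"
  define K where "K = (2 + B) / \<theta> * G"
  have G: "1 \<le> G" by (simp add: G_def)
  have K: "0 < K" using B \<theta> G by (simp add: K_def)
  show ?thesis
  proof (rule that[OF K \<gamma>])
    fix R e \<kappa> S and u :: "'a \<Rightarrow> real" and x z :: 'a
    assume R: "0 < R" and e: "0 < e" and \<kappa>: "0 \<le> \<kappa>" and u: "loc_bdd u"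
      and S: "\<And>x. x \<in> ball 0 (2 * R) \<Longrightarrow> \<bar>u x\<bar> \<le> S"
      and as: "almost_supersol \<beta> \<Lambda> e \<kappa> (ball 0 (2 * R)) u" "almost_supersol \<beta> \<Lambda> e \<kappa> (ball 0 (2 * R)) (\<lambda>x. - u x)"
      and x: "x \<in> ball 0 R" and z: "z \<in> ball 0 R"
    have S0: "0 \<le> S" using S[of 0] R by (auto intro: order_trans[OF abs_ge_zero])
    have big: "ball x R \<subseteq> ball 0 (2 * R)"
    proof
      fix y assume "y \<in> ball x R"
      then show "y \<in> ball 0 (2 * R)" using x norm_triangle_sub[of y x] by (simp add: dist_norm norm_minus_commute)
    qed
    define A where "A = 2 * S + B * (R\<^sup>2 * \<kappa>)"
    have A: "0 \<le> A" using S0 B \<kappa> by (simp add: A_def)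
    have osc: "\<exists>m M. (\<forall>y\<in>ball x (lam ^ k * R). m \<le> u y \<and> u y \<le> M) \<and> M - m \<le> A * \<theta> ^ k"
      if "\<And>i. i < k \<Longrightarrow> e \<le> e0 * (lam ^ i * R)" for k
      using that
    proof (induction k)
      case 0
      have "- S \<le> u y \<and> u y \<le> S" if "y \<in> ball x R" for y using S[of y] big that by (auto simp: abs_le_iff)
      moreover have "S - - S \<le> A" using B \<kappa> by (simp add: A_def)
      ultimately show ?case by (intro exI[of _ "- S"] exI[of _ S]) simp
    next
      case (Suc k)
      have "\<exists>m M. (\<forall>y\<in>ball x (lam ^ k * R). m \<le> u y \<and> u y \<le> M) \<and> M - m \<le> A * \<theta> ^ k"
        by (rule Suc.IH) (rule Suc.prems, simp)
      then obtain m M where mM: "\<And>y. y \<in> ball x (lam ^ k * R) \<Longrightarrow> m \<le> u y \<and> u y \<le> M" and d: "M - m \<le> A * \<theta> ^ k"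
        by blast
      define r where "r = lam ^ k * R"
      have r: "0 < r" "r \<le> R" using lam R by (simp_all add: r_def mult_left_le_one_le power_le_one)
      have sub: "ball x r \<subseteq> ball 0 (2 * R)" using big r by auto
      have "\<exists>m' M'. (\<forall>y\<in>ball x (lam * r). m' \<le> u y \<and> u y \<le> M') \<and> M' - m' \<le> (1 - c) * (M - m) + C * \<kappa> * r\<^sup>2"
        using O[OF e r(1) _ \<kappa> u mM[folded r_def] almost_supersol_subset[OF as(1) sub] almost_supersol_subset[OF as(2) sub]]
          Suc.prems[of k] by (simp add: r_def)
      then obtain m' M' where m': "\<forall>y\<in>ball x (lam * r). m' \<le> u y \<and> u y \<le> M'"
        and d': "M' - m' \<le> (1 - c) * (M - m) + C * \<kappa> * r\<^sup>2" by blast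
      have "(1 - c) * (M - m) \<le> (1 - c) * (A * \<theta> ^ k)" using d c by (intro mult_left_mono) auto
      moreover have "C * \<kappa> * r\<^sup>2 \<le> c/2 * A * \<theta> ^ k"
      proof -
        have "(lam ^ k)\<^sup>2 = (lam\<^sup>2) ^ k" by (simp add: power_mult[symmetric] mult.commute)
        then have "r\<^sup>2 = (lam\<^sup>2) ^ k * R\<^sup>2" by (simp add: r_def power_mult_distrib)
        also have "\<dots> \<le> \<theta> ^ k * R\<^sup>2" using \<theta> by (intro mult_right_mono power_mono) auto
        finally have "C * \<kappa> * r\<^sup>2 \<le> C * \<kappa> * (\<theta> ^ k * R\<^sup>2)" using C \<kappa> by (intro mult_left_mono) auto
        also have "\<dots> = (c/2 * (B * (R\<^sup>2 * \<kappa>))) * \<theta> ^ k" using c by (simp add: B_def)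
        also have "\<dots> \<le> (c/2 * A) * \<theta> ^ k" using c S0 \<theta> by (intro mult_right_mono mult_left_mono) (auto simp: A_def)
        finally show ?thesis .
      qed
      ultimately have "M' - m' \<le> (1 - c) * (A * \<theta> ^ k) + c/2 * A * \<theta> ^ k" using d' by linarith
      also have "\<dots> = ((1 - c) + c/2) * (A * \<theta> ^ k)" by (simp add: algebra_simps)
      also have "\<dots> \<le> \<theta> * (A * \<theta> ^ k)" by (rule mult_right_mono) (use \<theta> A in simp_all)
      also have "\<dots> = A * \<theta> ^ Suc k" by simp
      finally have fin: "M' - m' \<le> A * \<theta> ^ Suc k" .
      have eq: "lam ^ Suc k * R = lam * r" by (simp add: r_def)
      show ?case unfolding eq using m' fin by blast
    qed
    define d where "d = max (norm (x - z)) (e / e0)"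
    have d0: "0 < d" using e e0 by (simp add: d_def less_max_iff_disj)
    have main: "\<bar>u x - u z\<bar> \<le> A / \<theta> * (d / R) powr \<gamma>"
    proof (cases "R \<le> d")
      case True
      have "\<bar>u x\<bar> \<le> S" "\<bar>u z\<bar> \<le> S" using S[of x] S[of z] x z R by auto
      then have "\<bar>u x - u z\<bar> \<le> 2 * S" by linarith
      also have "\<dots> \<le> A" using B \<kappa> by (simp add: A_def)
      also have "\<dots> \<le> A / \<theta>" using \<theta> A by (simp add: pos_le_divide_eq mult_left_le)
      also have "\<dots> = A / \<theta> * 1" by simp
      also have "\<dots> \<le> A / \<theta> * (d / R) powr \<gamma>"
      proof (rule mult_left_mono)
        show "1 \<le> (d / R) powr \<gamma>" using True R \<gamma> by (intro ge_one_powr_ge_zero) auto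
      qed (use A \<theta> in simp)
      finally show ?thesis .
    next
      case False
      then have dR: "0 < d / R" "d / R < 1" using d0 R by simp_all
      obtain n where n: "lam ^ n < d / R" using real_arch_pow_inv[OF dR(1) lam(2)] by blast
      \<comment> \<open>The scale used is one step before the first radius at most \<open>d\<close>:
        its ball still contains \<open>z\<close>, and all larger scales satisfy the threshold. The
        step given up is the factor \<open>1 / \<theta>\<close>.\<close>
      define n' where "n' = (LEAST n. lam ^ n \<le> d / R)"
      have n': "lam ^ n' \<le> d / R" unfolding n'_def by (rule LeastI[of _ n]) (use n in simp)
      then have "n' \<noteq> 0" using dR by (cases n') auto
      then obtain k where k: "n' = Suc k" by (cases n') auto
      have "\<not> lam ^ k \<le> d / R" using not_less_Least[of k "\<lambda>n. lam ^ n \<le> d / R"] by (simp add: n'_def[symmetric] k)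
      then have dk: "d < lam ^ k * R" using R by (simp add: field_simps)
      have "e \<le> e0 * (lam ^ i * R)" if "i < k" for i
      proof -
        have "lam ^ k * R \<le> lam ^ i * R" using that lam R by (intro mult_right_mono power_decreasing) auto
        then have "e / e0 \<le> lam ^ i * R" using dk by (simp add: d_def)
        then show ?thesis using e0 by (simp add: field_simps)
      qed
      then obtain m M where mM: "\<forall>y\<in>ball x (lam ^ k * R). m \<le> u y \<and> u y \<le> M" "M - m \<le> A * \<theta> ^ k"
        using osc by blast
      have "x \<in> ball x (lam ^ k * R)" "z \<in> ball x (lam ^ k * R)" using dk d0 by (auto simp: d_def dist_norm)
      then have "m \<le> u x \<and> u x \<le> M" "m \<le> u z \<and> u z \<le> M" using mM(1) by blast+
      then have "\<bar>u x - u z\<bar> \<le> A * \<theta> ^ k" using mM(2) by linarith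
      also have "\<dots> = A / \<theta> * (lam ^ n') powr \<gamma>" unfolding lam_\<gamma> k using \<theta> by simp
      also have "\<dots> \<le> A / \<theta> * (d / R) powr \<gamma>"
        using n' \<gamma> A \<theta> lam by (intro mult_left_mono powr_mono2) auto
      finally show ?thesis .
    qed
    have dG: "d powr \<gamma> \<le> G * (norm (x - z) powr \<gamma> + e powr \<gamma>)"
    proof -
      have "d powr \<gamma> \<le> norm (x - z) powr \<gamma> + (e / e0) powr \<gamma>" by (simp add: d_def max_def)
      also have "(e / e0) powr \<gamma> = (1/e0) powr \<gamma> * e powr \<gamma>" using e e0 by (simp flip: powr_mult)
      also have "norm (x - z) powr \<gamma> + (1/e0) powr \<gamma> * e powr \<gamma> \<le> G * (norm (x - z) powr \<gamma> + e powr \<gamma>)"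
        by (simp add: G_def algebra_simps)
      finally show ?thesis .
    qed
    have AS: "A \<le> (2 + B) * (S + R\<^sup>2 * \<kappa>)" using B S0 \<kappa> by (simp add: A_def algebra_simps)
    have "\<bar>u x - u z\<bar> \<le> A / \<theta> * (d powr \<gamma> / R powr \<gamma>)" using main d0 R by (simp add: powr_divide)
    also have "\<dots> \<le> ((2 + B) * (S + R\<^sup>2 * \<kappa>)) / \<theta> * (G * (norm (x - z) powr \<gamma> + e powr \<gamma>) / R powr \<gamma>)"
      using AS dG A \<theta> B S0 \<kappa> by (intro mult_mono divide_right_mono) auto
    also have "\<dots> = K / R powr \<gamma> * (S + R\<^sup>2 * \<kappa>) * (norm (x - z) powr \<gamma> + e powr \<gamma>)"
      by (simp add: K_def)
    finally show "\<bar>u x - u z\<bar> \<le> K / R powr \<gamma> * (S + R\<^sup>2 * \<kappa>) * (norm (x - z) powr \<gamma> + e powr \<gamma>)" .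
  qed
qed

section \<open>Reduction to the extremal inequality\<close>

text \<open>Points outside the support have open null neighbourhoods, so compact sets outside the
  ball are null by finite covers. Inner regularity extends this to the whole complement of the
  ball.\<close>

lemma symmetric_measure_AE:
  assumes "M \<in> symmetric_measures_on_ball \<Lambda>"
  shows "AE z in M. norm z < \<Lambda>"
proof (rule AE_I')
  have M: "radon_measure M" "measure_support M \<subseteq> ball 0 \<Lambda>"
    using assms by (auto simp: symmetric_measures_on_ball_def)
  let ?A = "- ball 0 \<Lambda>"
  have s: "sets M = sets borel" using M by (simp add: radon_measure_def)
  have A: "?A \<in> sets M" by (simp add: s)
  have null: "emeasure M K = 0" if K: "compact K" "K \<subseteq> ?A" for K
  proof -
    have "\<forall>x\<in>K. \<exists>U. open U \<and> x \<in> U \<and> emeasure M U = 0"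
    proof
      fix x assume "x \<in> K"
      then have "x \<notin> measure_support M" using K(2) M(2) by blast
      then show "\<exists>U. open U \<and> x \<in> U \<and> emeasure M U = 0"
        unfolding measure_support_def mem_Collect_eq not_all not_imp not_gr_zero by blast
    qed
    then obtain U where U: "\<And>x. x \<in> K \<Longrightarrow> open (U x) \<and> x \<in> U x \<and> emeasure M (U x) = 0" by metis
    obtain F where F: "F \<subseteq> K" "finite F" "K \<subseteq> (\<Union>x\<in>F. U x)"
      by (rule compactE_image[OF K(1), of K U]) (use U in auto)
    have "U x \<in> null_sets M" if "x \<in> K" for x
      using U[OF that] s by (simp add: null_sets_def borel_open)
    then have "(\<Union>x\<in>F. U x) \<in> null_sets M"
      using F(1) by (intro null_sets_UN' countable_finite[OF F(2)]) blast
    moreover have "K \<in> sets M" using K(1) s by (simp add: borel_compact)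
    ultimately have "K \<in> null_sets M" using F(3) by (rule null_sets_subset)
    then show ?thesis by (rule null_setsD1)
  qed
  have "emeasure M ?A = (SUP K\<in>{K. compact K \<and> K \<subseteq> ?A}. emeasure M K)"
    using M(1) A unfolding radon_measure_def by blast
  also have "\<dots> \<le> 0" by (rule SUP_least) (simp add: null)
  finally show "?A \<in> null_sets M" using A by (simp add: null_sets_def)
qed (auto simp: dist_norm)

lemma symmetric_measure_integral_ge:
  fixes u :: "real ^ 'n \<Rightarrow> real"
  assumes M: "M \<in> symmetric_measures_on_ball \<Lambda>" and u: "u \<in> borel_measurable borel" "bounded (range u)"
    and m: "\<And>h. norm h < \<Lambda> \<Longrightarrow> 2 * m \<le> u (x + e *\<^sub>R h) + u (x - e *\<^sub>R h)"
  shows "m \<le> (LINT z|M. u (x + e *\<^sub>R z))"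
proof -
  interpret prob_space M using M by (simp add: symmetric_measures_on_ball_def)
  have s[measurable_cong]: "sets M = sets borel" using M by (simp add: symmetric_measures_on_ball_def radon_measure_def)
  have [measurable]: "u \<in> borel_measurable borel" by fact
  obtain B where B: "\<And>y. \<bar>u y\<bar> \<le> B" using u(2) by (auto simp: bounded_iff)
  have int: "integrable M (\<lambda>z. u (x + c *\<^sub>R z))" for c
    by (rule integrable_const_bound[where B=B]) (use B in auto)
  \<comment> \<open>Symmetry, given for images of sets, becomes invariance under a pushforward and
    hence invariance of integrals.\<close>
  have distr: "distr M M uminus = M"
  proof (rule measure_eqI)
    fix E assume "E \<in> sets (distr M M uminus)"
    then have E: "E \<in> sets M" by simp
    have [simp]: "space M = UNIV" using sets_eq_imp_space_eq[OF s] by simp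
    have "uminus -` E \<inter> space M = uminus ` E" by (auto simp: image_iff) (metis minus_minus)
    then have "emeasure (distr M M uminus) E = emeasure M (uminus ` E)"
      using E by (subst emeasure_distr) auto
    then show "emeasure (distr M M uminus) E = emeasure M E"
      using M E by (simp add: symmetric_measures_on_ball_def)
  qed simp
  have "(LINT z|M. u (x + e *\<^sub>R z)) = (LINT z|distr M M uminus. u (x + e *\<^sub>R z))" by (simp only: distr)
  also have "\<dots> = (LINT z|M. u (x + (- e) *\<^sub>R z))" by (subst integral_distr) auto
  finally have sym: "(LINT z|M. u (x + e *\<^sub>R z)) = (LINT z|M. u (x + (- e) *\<^sub>R z))" .
  have "2 * m = (LINT z|M. 2 * m)" using prob_space by simp
  also have "\<dots> \<le> (LINT z|M. u (x + e *\<^sub>R z) + u (x + (- e) *\<^sub>R z))"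
  proof (rule integral_mono_AE)
    show "integrable M (\<lambda>z. u (x + e *\<^sub>R z) + u (x + (- e) *\<^sub>R z))"
      by (intro Bochner_Integration.integrable_add int)
    show "AE z in M. 2 * m \<le> u (x + e *\<^sub>R z) + u (x + (- e) *\<^sub>R z)"
      using symmetric_measure_AE[OF M] by (rule eventually_mono) (use m in simp)
  qed simp
  also have "\<dots> = 2 * (LINT z|M. u (x + e *\<^sub>R z))"
    unfolding Bochner_Integration.integral_add[OF int int] sym[symmetric] by simp
  finally show ?thesis by simp
qed

lemma equation_almost_supersol:
  fixes u f :: "real ^ 'n \<Rightarrow> real"
  assumes \<beta>: "\<beta> \<le> 1" and \<nu>: "\<And>x. \<nu> x \<in> symmetric_measures_on_ball \<Lambda>"
    and u: "u \<in> borel_measurable borel" "bounded (range u)"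
    and eq: "\<And>x. x \<in> D \<Longrightarrow> u x = (1 - \<beta>) * (LINT z|\<nu> x. u (x + e *\<^sub>R z)) + \<beta> * ball_avg u x e + e\<^sup>2 * f x"
    and f: "\<And>x. x \<in> D \<Longrightarrow> - \<kappa> \<le> f x"
  shows "almost_supersol \<beta> \<Lambda> e \<kappa> D u"
  unfolding almost_supersol_def
proof (intro ballI allI impI)
  fix x m assume x: "x \<in> D" and m: "\<forall>h. norm h < \<Lambda> \<longrightarrow> 2 * m \<le> u (x + e *\<^sub>R h) + u (x - e *\<^sub>R h)"
  have "(1 - \<beta>) * m \<le> (1 - \<beta>) * (LINT z|\<nu> x. u (x + e *\<^sub>R z))"
    using m \<beta> by (intro mult_left_mono symmetric_measure_integral_ge[OF \<nu> u]) auto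
  moreover have "e\<^sup>2 * - \<kappa> \<le> e\<^sup>2 * f x" using f[OF x] by (intro mult_left_mono) auto
  then have "- (\<kappa> * e\<^sup>2) \<le> e\<^sup>2 * f x" by (simp add: mult.commute)
  ultimately show "(1 - \<beta>) * m + \<beta> * ball_avg u x e \<le> u x + \<kappa> * e\<^sup>2"
    using eq[OF x] by linarith
qed

theorem theorem1p1:
  fixes \<Lambda> \<alpha> \<beta> :: real
  assumes "\<Lambda> \<ge> 1" and "0 < \<beta>" and "\<beta> \<le> 1" and "\<alpha> = 1 - \<beta>"
  shows "\<exists>\<epsilon>\<^sub>0 C \<gamma> :: real. \<epsilon>\<^sub>0 > 0 \<and> C > 0 \<and> \<gamma> > 0 \<and>
    (\<forall>(R::real) (\<epsilon>::real) (\<nu> :: real ^ 'n \<Rightarrow> (real ^ 'n) measure)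
       (f :: real ^ 'n \<Rightarrow> real) (u :: real ^ 'n \<Rightarrow> real).
       R > 0 \<longrightarrow> 0 < \<epsilon> \<longrightarrow> \<epsilon> < \<epsilon>\<^sub>0 * R \<longrightarrow>
       admissible_family \<Lambda> \<nu> \<longrightarrow>
       f \<in> borel_measurable (restrict_space borel (ball 0 (2 * R))) \<longrightarrow>
       bounded (f ` ball 0 (2 * R)) \<longrightarrow>
       u \<in> borel_measurable borel \<longrightarrow>
       bounded (range u) \<longrightarrow>
       (\<forall>x \<in> ball 0 (2 * R).
          u x = \<alpha> * (LINT z|\<nu> x. u (x + \<epsilon> *\<^sub>R z))
              + \<beta> / measure lborel (ball (0 :: real ^ 'n) \<epsilon>) * (LINT y:ball x \<epsilon>|lborel. u y)
              + \<epsilon>\<^sup>2 * f x) \<longrightarrow>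
       (\<forall>x \<in> ball 0 R. \<forall>z \<in> ball 0 R.
          \<bar>u x - u z\<bar> \<le> C / R powr \<gamma>
            * ((SUP y\<in>ball 0 (2 * R). \<bar>u y\<bar>) + R\<^sup>2 * (SUP y\<in>ball 0 (2 * R). \<bar>f y\<bar>))
            * (norm (x - z) powr \<gamma> + \<epsilon> powr \<gamma>)))"
proof -
  have \<Lambda>: "0 < \<Lambda>" using assms(1) by simp
  obtain C \<gamma> :: real where C: "0 < C" "0 < \<gamma>" and H:
    "\<And>R e \<kappa> S u x z. \<lbrakk>0 < R; 0 < e; 0 \<le> \<kappa>; loc_bdd (u :: real ^ 'n \<Rightarrow> real);
      \<And>x. x \<in> ball 0 (2 * R) \<Longrightarrow> \<bar>u x\<bar> \<le> S;
      almost_supersol \<beta> \<Lambda> e \<kappa> (ball 0 (2 * R)) u; almost_supersol \<beta> \<Lambda> e \<kappa> (ball 0 (2 * R)) (\<lambda>x. - u x);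
      x \<in> ball 0 R; z \<in> ball 0 R\<rbrakk>
     \<Longrightarrow> \<bar>u x - u z\<bar> \<le> C / R powr \<gamma> * (S + R\<^sup>2 * \<kappa>) * (norm (x - z) powr \<gamma> + e powr \<gamma>)"
    using holder_estimate[OF assms(2,3) \<Lambda>, where 'a="real ^ 'n"] by blast
  show ?thesis
  proof (intro exI conjI allI impI ballI)
    \<comment> \<open>The witness for the threshold is 1: \<open>holder_estimate\<close> already
      treats a large ratio of \<epsilon> to \<open>R\<close> by its trivial bound.\<close>
    show "(0::real) < 1" "0 < C" "0 < \<gamma>" using C by simp_all
    fix R \<epsilon> :: real and \<nu> :: "real ^ 'n \<Rightarrow> (real ^ 'n) measure" and f u :: "real ^ 'n \<Rightarrow> real" and x z :: "real ^ 'n"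
    assume R: "0 < R" and \<epsilon>: "0 < \<epsilon>" and adm: "admissible_family \<Lambda> \<nu>"
      and f: "bounded (f ` ball 0 (2 * R))" and u: "u \<in> borel_measurable borel" "bounded (range u)"
      and eq: "\<forall>x \<in> ball 0 (2 * R). u x = \<alpha> * (LINT z|\<nu> x. u (x + \<epsilon> *\<^sub>R z))
              + \<beta> / measure lborel (ball (0 :: real ^ 'n) \<epsilon>) * (LINT y:ball x \<epsilon>|lborel. u y) + \<epsilon>\<^sup>2 * f x"
      and xz: "x \<in> ball 0 R" "z \<in> ball 0 R"
    let ?D = "ball (0 :: real ^ 'n) (2 * R)"
    have \<nu>: "\<nu> x \<in> symmetric_measures_on_ball \<Lambda>" for x using adm by (simp add: admissible_family_def)
    have bdd: "bdd_above ((\<lambda>y. \<bar>g y\<bar>) ` ?D)" if "bounded (g ` ?D)" for g :: "real ^ 'n \<Rightarrow> real"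
      using that by (auto simp: bounded_iff bdd_above_def)
    have fb: "\<bar>f y\<bar> \<le> (SUP y\<in>?D. \<bar>f y\<bar>)" if "y \<in> ?D" for y using that bdd[OF f] by (rule cSUP_upper)
    have ub: "\<bar>u y\<bar> \<le> (SUP y\<in>?D. \<bar>u y\<bar>)" if "y \<in> ?D" for y
      using that bdd[OF bounded_subset[OF u(2) image_mono[OF subset_UNIV]]] by (rule cSUP_upper)
    have lb: "loc_bdd u"
      unfolding loc_bdd_def using u bounded_subset[OF u(2) image_mono[OF subset_UNIV]] by blast
    have eq': "u y = (1 - \<beta>) * (LINT z|\<nu> y. u (y + \<epsilon> *\<^sub>R z)) + \<beta> * ball_avg u y \<epsilon> + \<epsilon>\<^sup>2 * f y" if "y \<in> ?D" for y
      using bspec[OF eq that] assms(4) by (simp add: ball_avg_eq[OF \<epsilon> u(1)])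
    have "almost_supersol \<beta> \<Lambda> \<epsilon> (SUP y\<in>?D. \<bar>f y\<bar>) ?D u"
      by (rule equation_almost_supersol[OF assms(3) \<nu> u eq']) (use fb in \<open>force simp: abs_le_iff\<close>)+
    \<comment> \<open>The function \<open>- u\<close> solves the equation with right-hand side
      \<open>- f\<close>. Each sign yields lower bounds only, and the oscillation needs
      both.\<close>
    moreover have "almost_supersol \<beta> \<Lambda> \<epsilon> (SUP y\<in>?D. \<bar>f y\<bar>) ?D (\<lambda>x. - u x)"
    proof (rule equation_almost_supersol[OF assms(3) \<nu>, where f="\<lambda>x. - f x"])
      show "(\<lambda>x. - u x) \<in> borel_measurable borel" using u by simp
      show "bounded (range (\<lambda>x. - u x))" using u(2) by (auto simp: bounded_iff)
      fix y assume y: "y \<in> ?D"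
      show "- u y = (1 - \<beta>) * (LINT z|\<nu> y. - u (y + \<epsilon> *\<^sub>R z)) + \<beta> * ball_avg (\<lambda>x. - u x) y \<epsilon> + \<epsilon>\<^sup>2 * - f y"
        using eq'[OF y] by (simp add: ball_avg_def)
      show "- (SUP y\<in>?D. \<bar>f y\<bar>) \<le> - f y" using fb[OF y] by linarith
    qed
    moreover have "0 \<le> (SUP y\<in>?D. \<bar>f y\<bar>)" using order_trans[OF abs_ge_zero fb[of 0]] R by simp
    ultimately show "\<bar>u x - u z\<bar> \<le> C / R powr \<gamma>
            * ((SUP y\<in>?D. \<bar>u y\<bar>) + R\<^sup>2 * (SUP y\<in>?D. \<bar>f y\<bar>)) * (norm (x - z) powr \<gamma> + \<epsilon> powr \<gamma>)"
      using ub xz by (intro H[OF R \<epsilon> _ lb]) auto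
  qed
qed

end
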